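(* Let $k$ be a field of characteristic $p \geq 0$ and let $g \in k[X,Y,Z]$ (polynomial ring in three variables) be of the form $g = bZ^n - a$, where $a, b \in k[X,Y]$ with $b \neq 0$ and $n \geq 2$ is an integer not divisible by $p$. Suppose that $B := k[X,Y,Z]/(g)$ is $k$-isomorphic to a polynomial ring in two variables over $k$, and identify $k[X,Y]$ with its image in $B$. Then there exist $U, V \in B$ with $B = k[U,V]$ such that $V$ is the image of $Z$ in $B$, $U \in k[X,Y]$, $b \in k[U]$, $k[X,Y] = k[U,a]$, and $k[X,Y,Z] = k[U, g, Z]$. *)

theory Defs
  imports "HOL-Computational_Algebra.Polynomial"
begin

text \<open>Polynomial rings over a field k are modelled by nested univariate polynomials:
  k[X,Y] = 'a poly poly (inner variable X, outer variable Y),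
  k[X,Y,Z] = 'a poly poly poly (outer variable Z).
  k[X,Y] is embedded in k[X,Y,Z] as the constants [:f:].\<close>

definition varX2 :: "'a::comm_semiring_1 poly poly" where
  "varX2 = [:[:0, 1:]:]"

definition varY2 :: "'a::comm_semiring_1 poly poly" where
  "varY2 = [:0, 1:]"

definition varZ3 :: "'a::comm_semiring_1 poly poly poly" where
  "varZ3 = [:0, 1:]"

definition const2 :: "'a::comm_semiring_1 \<Rightarrow> 'a poly poly" where
  "const2 c = [:[:c:]:]"

definition eval2 :: "('a::comm_semiring_1 \<Rightarrow> 'r::comm_semiring_1) \<Rightarrow> 'r \<Rightarrow> 'r \<Rightarrow> 'a poly poly \<Rightarrow> 'r" where
  "eval2 h x y p = poly (map_poly (\<lambda>q. poly (map_poly h q) x) p) y"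

definition eval3 :: "('a::comm_semiring_1 \<Rightarrow> 'r::comm_semiring_1) \<Rightarrow> 'r \<Rightarrow> 'r \<Rightarrow> 'r \<Rightarrow> 'a poly poly poly \<Rightarrow> 'r" where
  "eval3 h x y z F = poly (map_poly (eval2 h x y) F) z"

end

theory Submission
  imports Defs "HOL-Algebra.Algebraic_Closure_Type"
begin

hide_const (open) UnivPoly.coeff UnivPoly.monom Polynomials.degree up_ring.coeff up_ring.monom
  Polynomials.lead_coeff Module.smult Divisibility.prime

text \<open>
  Pass to an algebraic closure \<open>K\<close>, write \<open>B = K[P, Q]\<close>, let \<open>x, y, z\<close> be the images of \<open>X, Y, Z\<close>, and
  let \<open>\<zeta> \<noteq> 1\<close> be an \<open>n\<close>-th root of unity. Then \<open>z \<mapsto> \<zeta> z\<close> defines an automorphism of finite order of \<open>B\<close>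
  over \<open>k[x, y]\<close>. A leading form argument in the style of Newton polygons, valid in every characteristic,
  conjugates such an automorphism to a linear or triangular one; as it is trivial modulo its eigenvector
  \<open>z\<close>, this makes \<open>z\<close> a coordinate of \<open>B\<close>, first over \<open>k(\<zeta>)\<close> and then, by separability of \<open>\<zeta>\<close>, over \<open>k\<close>.

  Say \<open>B = K[z, U]\<close>. If \<open>b\<close> is not constant, every root \<open>c\<close> of \<open>b\<close> modulo \<open>z\<close> gives a curve
  \<open>U = u\<^sub>c(z)\<close> on which \<open>b\<close> vanishes; these curves are translates of each other, so \<open>b\<close> is a polynomial in
  some \<open>U - r(z)\<close>, and averaging over the roots of unity shows that \<open>U - r(z)\<close> lies in \<open>K[x, y]\<close>, as \<open>K[x, y]\<close>
  is integrally closed. If \<open>b\<close> is constant, the average alone supplies \<open>r\<close>. A \<open>k\<close>-linear retraction \<open>K \<rightarrow> k\<close> descends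
  this to \<open>u \<in> k[x, y]\<close> with \<open>B = k[u, z]\<close> and \<open>b \<in> k[u]\<close>. Finally \<open>k[x, y] \<inter> z B = a k[x, y]\<close> yields
  \<open>k[X, Y] = k[u, a]\<close> by induction on the degree in \<open>z\<close>, and \<open>a = b Z\<^sup>n - g\<close> yields the last claim.
\<close>

section \<open>Evaluation homomorphisms\<close>

text \<open>Why leading forms are so restricted: a coordinate \<open>\<theta> X\<close> is invariant
  under conjugated translations, and its leading form inherits invariance under a nontrivial
  deformation of the identity. Factors of invariants are invariant, and two different prime forms
  cannot both be invariant, so the form is a power of one prime; a binomial
  \<open>Y^a - c X^b\<close> with \<open>a, b \<ge> 2\<close> admits no such deformation, by a
  degree count with a Jacobian. Finite order serves to exclude iterates of exponentially growing
  degree. The obstacle is rationality. Splitting forms into primes needs an algebraically closed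
  field, but a coordinate over the closure need not descend through an inseparable extension. Hence
  automorphisms carry a coefficient set \<open>S\<close>, finally \<open>k(\<zeta>)\<close>, inside
  the type of the closure: the constants of the elementary maps are ratios of coefficients and stay
  in \<open>S\<close>. From \<open>S\<close> to \<open>k\<close> the only danger is some
  \<open>c\<close> outside \<open>k\<close> for which \<open>(T - c)^m\<close> has coefficients in
  \<open>k\<close>; \<open>radically_closed\<close> excludes it.\<close>

definition rhom :: "('a::comm_ring_1 \<Rightarrow> 'b::comm_ring_1) \<Rightarrow> bool" where
  "rhom f \<longleftrightarrow> f 1 = 1 \<and> (\<forall>x y. f (x + y) = f x + f y) \<and> (\<forall>x y. f (x * y) = f x * f y)"

lemma rhomI:
  assumes "f 1 = 1" "\<And>x y. f (x + y) = f x + f y" "\<And>x y. f (x * y) = f x * f y"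
  shows "rhom f"
  using assms by (simp add: rhom_def)

lemma rhom_1: "rhom f \<Longrightarrow> f 1 = 1"
  and rhom_add: "rhom f \<Longrightarrow> f (x + y) = f x + f y"
  and rhom_mult: "rhom f \<Longrightarrow> f (x * y) = f x * f y"
  by (simp_all add: rhom_def)

lemma rhom_0: assumes "rhom f" shows "f 0 = 0"
  using rhom_add[OF assms, of 0 0] by simp

lemma rhom_minus: assumes "rhom f" shows "f (- x) = - f x"
  using rhom_add[OF assms, of x "- x"] by (simp add: rhom_0[OF assms] eq_neg_iff_add_eq_0 add.commute)

lemma rhom_diff: assumes "rhom f" shows "f (x - y) = f x - f y"
  using rhom_add[OF assms, of x "- y"] by (simp add: rhom_minus[OF assms])

lemma rhom_power: assumes "rhom f" shows "f (x ^ n) = f x ^ n"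
  by (induction n) (simp_all add: rhom_1[OF assms] rhom_mult[OF assms])

lemma rhom_sum: assumes "rhom f" shows "f (sum g A) = (\<Sum>x\<in>A. f (g x))"
  by (induction A rule: infinite_finite_induct) (simp_all add: rhom_0[OF assms] rhom_add[OF assms])

lemma rhom_of_nat: assumes "rhom f" shows "f (of_nat n) = of_nat n"
  by (induction n) (simp_all add: rhom_0[OF assms] rhom_1[OF assms] rhom_add[OF assms])

lemmas rhom_simps = rhom_0 rhom_1 rhom_add rhom_mult rhom_minus rhom_diff rhom_power rhom_of_nat

lemma rhom_id: "rhom (\<lambda>x. x)"
  by (simp add: rhom_def)

lemma rhom_comp: "rhom f \<Longrightarrow> rhom g \<Longrightarrow> rhom (\<lambda>x. f (g x))"
  by (simp add: rhom_def)

lemma rhom_const_poly: "rhom (\<lambda>c. [:c:])"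
  by (rule rhomI) simp_all

lemma rhom_poly: "rhom (\<lambda>p. poly p x)"
  by (rule rhomI) simp_all

lemma rhom_map_poly: assumes "rhom f" shows "rhom (map_poly f)"
proof (rule rhomI)
  show "map_poly f 1 = 1"
    by (simp add: map_poly_1 rhom_1[OF assms])
  show "map_poly f (p + q) = map_poly f p + map_poly f q" for p q
    by (rule poly_eqI) (simp add: coeff_map_poly rhom_simps[OF assms])
  show "map_poly f (p * q) = map_poly f p * map_poly f q" for p q
    by (rule poly_eqI) (simp add: coeff_map_poly rhom_simps[OF assms] coeff_mult rhom_sum[OF assms])
qed

lemma eval2_alt: "eval2 h x y = (\<lambda>p. poly (map_poly (\<lambda>q. poly (map_poly h q) x) p) y)"
  by (simp add: eval2_def fun_eq_iff)

lemma rhom_eval2: assumes "rhom h" shows "rhom (eval2 h x y)"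
  unfolding eval2_alt
  by (rule rhom_comp[OF rhom_poly rhom_map_poly[OF rhom_comp[OF rhom_poly rhom_map_poly[OF assms]]]])

lemma rhom_eval3: assumes "rhom h" shows "rhom (eval3 h x y z)"
proof -
  have "eval3 h x y z = (\<lambda>F. poly (map_poly (eval2 h x y) F) z)"
    by (simp add: eval3_def fun_eq_iff)
  then show ?thesis
    using rhom_comp[OF rhom_poly rhom_map_poly[OF rhom_eval2[OF assms]]] by metis
qed

lemma rhom_const2: "rhom const2"
  unfolding const2_def by (rule rhom_comp[OF rhom_const_poly rhom_const_poly])

lemma rhom_const3: "rhom (\<lambda>c. [:const2 c:])"
  by (rule rhom_comp[OF rhom_const_poly rhom_const2])

lemma eval2_const: assumes "h 0 = 0" shows "eval2 h x y (const2 c) = h c"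
  using assms by (simp add: eval2_def const2_def map_poly_pCons)

lemma eval2_varX: assumes "rhom h" shows "eval2 h x y varX2 = x"
  by (simp add: eval2_def varX2_def map_poly_pCons rhom_simps[OF assms])

lemma eval2_varY: assumes "rhom h" shows "eval2 h x y varY2 = y"
  by (simp add: eval2_def varY2_def map_poly_pCons rhom_simps[OF assms])

lemma eval3_const: "eval3 h x y z [:f:] = eval2 h x y f"
  by (simp add: eval3_def map_poly_pCons eval2_def)

lemma eval3_varZ: assumes "rhom h" shows "eval3 h x y z varZ3 = z"
  by (simp add: eval3_def varZ3_def map_poly_pCons rhom_simps[OF rhom_eval2[OF assms]])

lemma eval3_pCons: assumes "rhom h"
  shows "eval3 h x y z (pCons f F) = eval2 h x y f + z * eval3 h x y z F"
  by (simp add: eval3_def map_poly_pCons rhom_simps[OF rhom_eval2[OF assms]])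

lemma pCons_decomp: "pCons a p = [:a:] + [:0, 1:] * (p :: 'a::comm_ring_1 poly)"
  by simp

lemma rhom_ext1:
  assumes "rhom f" "rhom g" "\<And>c. f [:c:] = g [:c:]" "f [:0, 1:] = g [:0, 1:]"
  shows "f p = g p"
proof (induction p)
  case 0
  then show ?case by (simp add: rhom_0 assms)
next
  case (pCons a p)
  then show ?case
    unfolding pCons_decomp[of a p] by (simp only: rhom_add rhom_mult assms)
qed

lemma rhom_ext2:
  assumes "rhom f" "rhom g" "\<And>c. f (const2 c) = g (const2 c)"
    and "f varX2 = g varX2" "f varY2 = g varY2"
  shows "f p = g p"
proof (rule rhom_ext1[OF assms(1,2)])
  show "f [:c:] = g [:c:]" for c
    by (rule rhom_ext1[of "\<lambda>c. f [:c:]" "\<lambda>c. g [:c:]"])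
      (use assms in \<open>auto simp: const2_def varX2_def intro: rhom_comp[OF _ rhom_const_poly]\<close>)
  show "f [:0, 1:] = g [:0, 1:]"
    using assms(5) by (simp add: varY2_def)
qed

lemma rhom_ext3:
  assumes "rhom f" "rhom g" "\<And>c. f [:const2 c:] = g [:const2 c:]"
    and "f [:varX2:] = g [:varX2:]" "f [:varY2:] = g [:varY2:]" "f varZ3 = g varZ3"
  shows "f p = g p"
proof (rule rhom_ext1[OF assms(1,2)])
  show "f [:c:] = g [:c:]" for c
    by (rule rhom_ext2[of "\<lambda>c. f [:c:]" "\<lambda>c. g [:c:]"])
      (use assms in \<open>auto intro: rhom_comp[OF _ rhom_const_poly]\<close>)
  show "f [:0, 1:] = g [:0, 1:]"
    using assms(6) by (simp add: varZ3_def)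
qed

lemma rhom_eq_eval2:
  assumes "rhom f" shows "f p = eval2 (\<lambda>c. f (const2 c)) (f varX2) (f varY2) p"
  by (rule rhom_ext2[OF assms rhom_eval2])
    (simp_all add: eval2_const eval2_varX eval2_varY rhom_comp[OF assms rhom_const2] rhom_0[OF assms]
      rhom_0[OF rhom_const2])

lemma eval2_id: "eval2 const2 varX2 varY2 p = (p :: 'a::comm_ring_1 poly poly)"
  by (rule rhom_ext2[of "eval2 const2 varX2 varY2" "\<lambda>x. x", OF rhom_eval2[OF rhom_const2] rhom_id])
    (simp_all add: eval2_const eval2_varX eval2_varY rhom_const2 rhom_0[OF rhom_const2])

lemma eval2_comp:
  assumes "rhom f" "rhom h"
  shows "f (eval2 h x y p) = eval2 (\<lambda>c. f (h c)) (f x) (f y) p"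
  by (rule rhom_ext2[OF rhom_comp[OF assms(1) rhom_eval2[OF assms(2)]] rhom_eval2[OF rhom_comp[OF assms]]])
    (simp_all add: eval2_const eval2_varX eval2_varY assms rhom_0[OF assms(1)] rhom_0[OF assms(2)] rhom_comp[OF assms])

lemma eval3_comp:
  assumes "rhom f" "rhom h"
  shows "f (eval3 h x y z p) = eval3 (\<lambda>c. f (h c)) (f x) (f y) (f z) p"
  by (rule rhom_ext3[OF rhom_comp[OF assms(1) rhom_eval3[OF assms(2)]] rhom_eval3[OF rhom_comp[OF assms]]])
    (simp_all add: eval3_const eval3_varZ eval2_const eval2_varX eval2_varY assms rhom_0[OF assms(1)] rhom_0[OF assms(2)] rhom_comp[OF assms])

lemma poly_map_poly_sum:
  fixes h :: "'a::comm_ring_1 \<Rightarrow> 'b::comm_ring_1"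
  assumes "h 0 = 0" "degree q \<le> n"
  shows "poly (map_poly h q) x = (\<Sum>i\<le>n. h (coeff q i) * x ^ i)"
proof -
  have "degree (map_poly h q) \<le> n"
    using map_poly_degree_leq[of h q] assms by linarith
  then have "poly (map_poly h q) x = (\<Sum>i\<le>n. coeff (map_poly h q) i * x ^ i)"
    unfolding poly_altdef[of "map_poly h q"] by (intro sum.mono_neutral_left) (auto simp: coeff_eq_0)
  then show ?thesis by (simp add: coeff_map_poly assms)
qed

lemma eval2_sum:
  assumes "rhom h"
  shows "eval2 h x y p = (\<Sum>j\<le>degree p. \<Sum>i\<le>degree (coeff p j). h (coeff (coeff p j) i) * x ^ i * y ^ j)"
  unfolding eval2_def
  by (simp add: poly_map_poly_sum[OF _ order.refl] rhom_0[OF assms] sum_distrib_right)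

lemma eval3_sum:
  assumes "rhom h"
  shows "eval3 h x y z F = (\<Sum>k\<le>degree F. eval2 h x y (coeff F k) * z ^ k)"
  unfolding eval3_def
  by (simp add: poly_map_poly_sum[OF _ order.refl] rhom_0[OF rhom_eval2[OF assms]])

lemma const2_mult: "const2 (c * d) = const2 c * const2 d"
  and const2_add: "const2 (c + d) = const2 c + const2 (d::'a::comm_ring_1)"
  and const2_0 [simp]: "const2 0 = 0" and const2_1 [simp]: "const2 1 = 1"
  by (simp_all add: const2_def one_pCons)

lemma const2_eq_0_iff [simp]: "const2 c = 0 \<longleftrightarrow> c = 0"
  by (simp add: const2_def)

lemma coeff_const2_mult [simp]: "coeff (coeff (const2 c * f) j) i = c * coeff (coeff f j) i"
  by (simp add: const2_def)

lemma varX2_nz [simp]: "varX2 \<noteq> (0::'a::comm_ring_1 poly poly)"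
  and varY2_nz [simp]: "varY2 \<noteq> (0::'a::comm_ring_1 poly poly)"
  by (simp_all add: varX2_def varY2_def)

section \<open>Weighted gradings and leading forms\<close>

text \<open>\<open>Hm d\<close> are the homogeneous elements of degree \<open>d\<close>, and \<open>Fil d\<close> those of degree at most \<open>d\<close>.\<close>

locale graded =
  fixes Hm Fil :: "int \<Rightarrow> 'r::comm_ring_1 set" and h :: "'c::comm_ring_1 \<Rightarrow> 'r"
  assumes rhom_h: "rhom h"
    and Hm_0: "0 \<in> Hm d"
    and Hm_add: "x \<in> Hm d \<Longrightarrow> y \<in> Hm d \<Longrightarrow> x + y \<in> Hm d"
    and Hm_mult: "x \<in> Hm d \<Longrightarrow> y \<in> Hm e \<Longrightarrow> x * y \<in> Hm (d + e)"
    and Hm_const: "h c \<in> Hm 0"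
    and Fil_add: "x \<in> Fil d \<Longrightarrow> y \<in> Fil d \<Longrightarrow> x + y \<in> Fil d"
    and Fil_mult: "x \<in> Fil d \<Longrightarrow> y \<in> Fil e \<Longrightarrow> x * y \<in> Fil (d + e)"
    and Hm_Fil: "x \<in> Hm d \<Longrightarrow> x \<in> Fil d"
    and Fil_mono: "x \<in> Fil d \<Longrightarrow> d \<le> e \<Longrightarrow> x \<in> Fil e"
    and Hm_Fil_0: "x \<in> Hm d \<Longrightarrow> x \<in> Fil e \<Longrightarrow> e < d \<Longrightarrow> x = 0"
begin

text \<open>Degrees are upper bounds: \<open>x0\<close> may be \<open>0\<close>, in which case \<open>x\<close> has degree less than \<open>d\<close>.\<close>

definition lead :: "int \<Rightarrow> 'r \<Rightarrow> 'r \<Rightarrow> bool" where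
  "lead d x x0 \<longleftrightarrow> x0 \<in> Hm d \<and> x - x0 \<in> Fil (d - 1)"

lemma Hm_minus: assumes "x \<in> Hm d" shows "- x \<in> Hm d"
proof -
  have "h (- 1) * x \<in> Hm (0 + d)"
    by (rule Hm_mult[OF Hm_const assms])
  then show ?thesis by (simp add: rhom_simps[OF rhom_h])
qed

lemma Fil_minus: assumes "x \<in> Fil d" shows "- x \<in> Fil d"
proof -
  have "h (- 1) * x \<in> Fil (0 + d)"
    by (rule Fil_mult[OF Hm_Fil[OF Hm_const] assms])
  then show ?thesis by (simp add: rhom_simps[OF rhom_h])
qed

lemma Hm_diff: "x \<in> Hm d \<Longrightarrow> y \<in> Hm d \<Longrightarrow> x - y \<in> Hm d"
  using Hm_add[OF _ Hm_minus] by fastforce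

lemma Fil_diff: "x \<in> Fil d \<Longrightarrow> y \<in> Fil d \<Longrightarrow> x - y \<in> Fil d"
  using Fil_add[OF _ Fil_minus] by fastforce

lemma Fil_0: "0 \<in> Fil d"
  by (rule Hm_Fil[OF Hm_0])

lemma Hm_cmult: "x \<in> Hm d \<Longrightarrow> h c * x \<in> Hm d"
  using Hm_mult[OF Hm_const] by force

lemma Fil_cmult: "x \<in> Fil d \<Longrightarrow> h c * x \<in> Fil d"
  using Fil_mult[OF Hm_Fil[OF Hm_const]] by force

lemma Hm_1: "1 \<in> Hm 0"
  using Hm_const[of 1] by (simp add: rhom_simps[OF rhom_h])

lemma Hm_power: "x \<in> Hm d \<Longrightarrow> x ^ n \<in> Hm (int n * d)"
proof (induction n)
  case 0
  then show ?case by (simp add: Hm_1)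
next
  case (Suc n)
  then show ?case using Hm_mult[of x d "x ^ n" "int n * d"] by (simp add: algebra_simps)
qed

lemma Fil_power: "x \<in> Fil d \<Longrightarrow> x ^ n \<in> Fil (int n * d)"
proof (induction n)
  case 0
  then show ?case by (simp add: Hm_Fil[OF Hm_1])
next
  case (Suc n)
  then show ?case using Fil_mult[of x d "x ^ n" "int n * d"] by (simp add: algebra_simps)
qed

lemma lead_self: "x \<in> Hm d \<Longrightarrow> lead d x x"
  by (simp add: lead_def Fil_0)

lemma lead_Fil: "lead d x x0 \<Longrightarrow> x \<in> Fil d"
  unfolding lead_def using Fil_add[OF Fil_mono[of "x - x0" "d - 1" d] Hm_Fil[of x0 d]] by simp

lemma lead_lower: "x \<in> Fil (d - 1) \<Longrightarrow> lead d x 0"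
  by (simp add: lead_def Hm_0)

lemma lead_0_iff: "lead d x 0 \<longleftrightarrow> x \<in> Fil (d - 1)"
  by (simp add: lead_def Hm_0)

lemma lead_add: "lead d x x0 \<Longrightarrow> lead d y y0 \<Longrightarrow> lead d (x + y) (x0 + y0)"
  unfolding lead_def using Hm_add Fil_add[of "x - x0" "d - 1" "y - y0"] by (simp add: algebra_simps)

lemma lead_cmult: "lead d x x0 \<Longrightarrow> lead d (h c * x) (h c * x0)"
  unfolding lead_def using Hm_cmult Fil_cmult[of "x - x0" "d - 1" c] by (simp add: algebra_simps)

lemma lead_minus: "lead d x x0 \<Longrightarrow> lead d (- x) (- x0)"
  using lead_cmult[of d x x0 "- 1"] by (simp add: rhom_simps[OF rhom_h])

lemma lead_diff: "lead d x x0 \<Longrightarrow> lead d y y0 \<Longrightarrow> lead d (x - y) (x0 - y0)"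
  using lead_add[OF _ lead_minus] by fastforce

lemma lead_mult:
  assumes "lead d x x0" "lead e y y0" shows "lead (d + e) (x * y) (x0 * y0)"
proof -
  have "(x - x0) * y \<in> Fil ((d - 1) + e)"
    using assms(1) lead_Fil[OF assms(2)] by (intro Fil_mult) (simp_all add: lead_def)
  moreover have "x0 * (y - y0) \<in> Fil (d + (e - 1))"
    using assms by (intro Fil_mult) (simp_all add: lead_def Hm_Fil)
  ultimately have "(x - x0) * y + x0 * (y - y0) \<in> Fil (d + e - 1)"
    by (intro Fil_add) (simp_all add: algebra_simps)
  moreover have "(x - x0) * y + x0 * (y - y0) = x * y - x0 * y0"
    by (simp add: algebra_simps)
  ultimately show ?thesis
    using assms Hm_mult by (auto simp: lead_def)
qed

lemma lead_power: "lead d x x0 \<Longrightarrow> lead (int n * d) (x ^ n) (x0 ^ n)"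
proof (induction n)
  case 0
  then show ?case by (simp add: lead_self Hm_1)
next
  case (Suc n)
  then show ?case
    using lead_mult[of d x x0 "int n * d" "x ^ n" "x0 ^ n"] by (simp add: algebra_simps)
qed

lemma lead_sum: "(\<And>i. i \<in> A \<Longrightarrow> lead d (f i) (g i)) \<Longrightarrow> lead d (sum f A) (sum g A)"
  by (induction A rule: infinite_finite_induct) (simp_all add: lead_self Hm_0 lead_add)

lemma lead_unique: assumes "lead d x x0" "lead d x x1" shows "x0 = x1"
proof -
  have "x0 - x1 \<in> Hm d" using assms Hm_diff by (simp add: lead_def)
  moreover have "(x - x1) - (x - x0) \<in> Fil (d - 1)"
    using assms by (intro Fil_diff[of "x - x1" "d - 1" "x - x0"]) (simp_all add: lead_def)
  ultimately show ?thesis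
    using Hm_Fil_0[of "x0 - x1" d "d - 1"] by simp
qed

text \<open>Source of relations between leading forms: if cancellation makes \<open>x\<close>
  lighter than expected, the expected leading form is zero.\<close>

lemma lead_Fil_lower: "lead d x x0 \<Longrightarrow> x \<in> Fil e \<Longrightarrow> e < d \<Longrightarrow> x0 = 0"
  using lead_unique[OF _ lead_lower] Fil_mono[of x e "d - 1"] by simp

end

section \<open>Monomial supports and weighted degrees of nested polynomials\<close>

definition idx_map :: "(nat \<Rightarrow> 'a \<Rightarrow> 'a) \<Rightarrow> 'a::comm_monoid_add poly \<Rightarrow> 'a poly" where
  "idx_map h p = (\<Sum>k\<le>degree p. monom (h k (coeff p k)) k)"

lemma coeff_idx_map: assumes "\<And>k. h k 0 = 0" shows "coeff (idx_map h p) k = h k (coeff p k)"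
proof -
  have "coeff (idx_map h p) k = (\<Sum>i\<le>degree p. if i = k then h k (coeff p k) else 0)"
    unfolding idx_map_def coeff_sum by (intro sum.cong) simp_all
  also have "\<dots> = h k (coeff p k)"
    using assms by (simp add: coeff_eq_0)
  finally show ?thesis .
qed

definition restr2 :: "(nat \<Rightarrow> nat \<Rightarrow> bool) \<Rightarrow> 'a::comm_monoid_add poly poly \<Rightarrow> 'a poly poly" where
  "restr2 A f = idx_map (\<lambda>j. idx_map (\<lambda>i c. if A i j then c else 0)) f"

lemma coeff_restr2: "coeff (coeff (restr2 A f) j) i = (if A i j then coeff (coeff f j) i else 0)"
proof -
  have "idx_map (\<lambda>i c. if A i k then c else 0) 0 = 0" for k
    by (rule poly_eqI) (simp add: coeff_idx_map)
  then have "coeff (restr2 A f) j = idx_map (\<lambda>i c. if A i j then c else 0) (coeff f j)"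
    unfolding restr2_def by (rule coeff_idx_map)
  then show ?thesis
    by (simp add: coeff_idx_map)
qed

definition restr3 :: "(nat \<Rightarrow> nat \<Rightarrow> nat \<Rightarrow> bool) \<Rightarrow> 'a::comm_monoid_add poly poly poly \<Rightarrow> 'a poly poly poly" where
  "restr3 A F = idx_map (\<lambda>k. restr2 (\<lambda>i j. A i j k)) F"

lemma poly_poly_eqI:
  "(\<And>i j. coeff (coeff f j) i = coeff (coeff g j) i) \<Longrightarrow> f = g"
  by (simp add: poly_eq_iff)

lemma coeff_restr3:
  "coeff (coeff (coeff (restr3 A F) k) j) i = (if A i j k then coeff (coeff (coeff F k) j) i else 0)"
proof -
  have "restr2 (\<lambda>i j. A i j k) 0 = (0 :: 'a poly poly)" for k
    by (intro poly_poly_eqI) (simp add: coeff_restr2)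
  then have "coeff (restr3 A F) k = restr2 (\<lambda>i j. A i j k) (coeff F k)"
    unfolding restr3_def by (rule coeff_idx_map)
  then show ?thesis
    by (simp add: coeff_restr2)
qed

text \<open>The weights are arbitrary integers: \<open>0\<close> is used for a variable that is
  replaced by \<open>0\<close>, and the parameter \<open>t\<close> of a family may get a negative
  weight in \<open>Hm3\<close>.\<close>

definition Hm2 :: "int \<Rightarrow> int \<Rightarrow> int \<Rightarrow> 'a::comm_ring_1 poly poly set" where
  "Hm2 a b d = {f. \<forall>i j. coeff (coeff f j) i \<noteq> 0 \<longrightarrow> a * int i + b * int j = d}"

definition Fil2 :: "int \<Rightarrow> int \<Rightarrow> int \<Rightarrow> 'a::comm_ring_1 poly poly set" where
  "Fil2 a b d = {f. \<forall>i j. coeff (coeff f j) i \<noteq> 0 \<longrightarrow> a * int i + b * int j \<le> d}"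

definition Hm3 :: "int \<Rightarrow> int \<Rightarrow> int \<Rightarrow> int \<Rightarrow> 'a::comm_ring_1 poly poly poly set" where
  "Hm3 a b w d = {F. \<forall>i j k. coeff (coeff (coeff F k) j) i \<noteq> 0 \<longrightarrow> a * int i + b * int j + w * int k = d}"

definition Fil3 :: "int \<Rightarrow> int \<Rightarrow> int \<Rightarrow> int \<Rightarrow> 'a::comm_ring_1 poly poly poly set" where
  "Fil3 a b w d = {F. \<forall>i j k. coeff (coeff (coeff F k) j) i \<noteq> 0 \<longrightarrow> a * int i + b * int j + w * int k \<le> d}"

lemma coeff_mult_nz:
  fixes p q :: "'a::comm_ring_1 poly"
  assumes "coeff (p * q) n \<noteq> 0"
  obtains k l where "k + l = n" "coeff p k \<noteq> 0" "coeff q l \<noteq> 0"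
proof -
  have "(\<Sum>i\<le>n. coeff p i * coeff q (n - i)) \<noteq> 0"
    using assms by (simp add: coeff_mult)
  then obtain i where "i \<le> n" "coeff p i * coeff q (n - i) \<noteq> 0"
    by (metis (no_types, lifting) atMost_iff sum.neutral)
  then show ?thesis using that[of i "n - i"] by fastforce
qed

lemma coeff2_mult_nz:
  fixes f g :: "'a::comm_ring_1 poly poly"
  assumes "coeff (coeff (f * g) j) i \<noteq> 0"
  obtains i1 j1 i2 j2 where "i1 + i2 = i" "j1 + j2 = j"
    "coeff (coeff f j1) i1 \<noteq> 0" "coeff (coeff g j2) i2 \<noteq> 0"
proof -
  have "(\<Sum>k\<le>j. coeff (coeff f k * coeff g (j - k)) i) \<noteq> 0"
    using assms by (simp add: coeff_mult[of f g] coeff_sum)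
  then obtain k where k: "k \<le> j" "coeff (coeff f k * coeff g (j - k)) i \<noteq> 0"
    by (metis (no_types, lifting) atMost_iff sum.neutral)
  obtain i1 i2 where "i1 + i2 = i" "coeff (coeff f k) i1 \<noteq> 0" "coeff (coeff g (j - k)) i2 \<noteq> 0"
    using coeff_mult_nz[OF k(2)] by metis
  then show ?thesis using that[of i1 i2 k "j - k"] k(1) by auto
qed

lemma coeff3_mult_nz:
  fixes f g :: "'a::comm_ring_1 poly poly poly"
  assumes "coeff (coeff (coeff (f * g) k) j) i \<noteq> 0"
  obtains i1 j1 k1 i2 j2 k2 where "i1 + i2 = i" "j1 + j2 = j" "k1 + k2 = k"
    "coeff (coeff (coeff f k1) j1) i1 \<noteq> 0" "coeff (coeff (coeff g k2) j2) i2 \<noteq> 0"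
proof -
  have "(\<Sum>l\<le>k. coeff (coeff (coeff f l * coeff g (k - l)) j) i) \<noteq> 0"
    using assms by (simp add: coeff_mult[of f g] coeff_sum)
  then obtain l where l: "l \<le> k" "coeff (coeff (coeff f l * coeff g (k - l)) j) i \<noteq> 0"
    by (metis (no_types, lifting) atMost_iff sum.neutral)
  obtain i1 j1 i2 j2 where "i1 + i2 = i" "j1 + j2 = j" "coeff (coeff (coeff f l) j1) i1 \<noteq> 0"
      "coeff (coeff (coeff g (k - l)) j2) i2 \<noteq> 0"
    using coeff2_mult_nz[OF l(2)] by metis
  then show ?thesis using that[of i1 i2 j1 j2 l "k - l"] l(1) by auto
qed

lemma coeff2_add_nz:
  assumes "coeff (coeff (f + g) j) i \<noteq> 0"
  shows "coeff (coeff f j) i \<noteq> 0 \<or> coeff (coeff g j) i \<noteq> (0::'a::comm_ring_1)"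
  using assms by auto

lemma coeff3_add_nz:
  assumes "coeff (coeff (coeff (f + g) k) j) i \<noteq> 0"
  shows "coeff (coeff (coeff f k) j) i \<noteq> 0 \<or> coeff (coeff (coeff g k) j) i \<noteq> (0::'a::comm_ring_1)"
  using assms by auto

lemma coeff_const2: "coeff (coeff (const2 c) j) i = (if i = 0 \<and> j = 0 then c else 0)"
  by (simp add: const2_def coeff_pCons split: nat.splits)

lemma coeff_const_poly: "coeff [:c:] k = (if k = 0 then c else 0)"
  by (simp add: coeff_pCons split: nat.splits)

lemma graded2: "graded (Hm2 a b) (Fil2 a b) (const2 :: 'a::comm_ring_1 \<Rightarrow> _)"
proof
  show "rhom (const2 :: 'a \<Rightarrow> _)" by (rule rhom_const2)
  fix x y :: "'a poly poly" and d e :: int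
  show "0 \<in> Hm2 a b d" by (simp add: Hm2_def)
  show "x + y \<in> Hm2 a b d" if "x \<in> Hm2 a b d" "y \<in> Hm2 a b d"
    using that coeff2_add_nz unfolding Hm2_def mem_Collect_eq by metis
  show "x + y \<in> Fil2 a b d" if "x \<in> Fil2 a b d" "y \<in> Fil2 a b d"
    using that coeff2_add_nz unfolding Fil2_def mem_Collect_eq by metis
  show "x * y \<in> Hm2 a b (d + e)" if xy: "x \<in> Hm2 a b d" "y \<in> Hm2 a b e"
    unfolding Hm2_def mem_Collect_eq
  proof (intro allI impI)
    fix i j assume "coeff (coeff (x * y) j) i \<noteq> 0"
    from coeff2_mult_nz[OF this] obtain i1 j1 i2 j2 where s: "i1 + i2 = i" "j1 + j2 = j"
      "coeff (coeff x j1) i1 \<noteq> 0" "coeff (coeff y j2) i2 \<noteq> 0" by metis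
    then have "a * int i1 + b * int j1 = d" "a * int i2 + b * int j2 = e"
      using xy by (auto simp: Hm2_def)
    then show "a * int i + b * int j = d + e"
      unfolding s(1,2)[symmetric] by (simp add: algebra_simps)
  qed
  show "x * y \<in> Fil2 a b (d + e)" if xy: "x \<in> Fil2 a b d" "y \<in> Fil2 a b e"
    unfolding Fil2_def mem_Collect_eq
  proof (intro allI impI)
    fix i j assume "coeff (coeff (x * y) j) i \<noteq> 0"
    from coeff2_mult_nz[OF this] obtain i1 j1 i2 j2 where s: "i1 + i2 = i" "j1 + j2 = j"
      "coeff (coeff x j1) i1 \<noteq> 0" "coeff (coeff y j2) i2 \<noteq> 0" by metis
    then have "a * int i1 + b * int j1 \<le> d" "a * int i2 + b * int j2 \<le> e"
      using xy by (auto simp: Fil2_def)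
    then show "a * int i + b * int j \<le> d + e"
      unfolding s(1,2)[symmetric] by (simp add: algebra_simps)
  qed
  show "const2 c \<in> Hm2 a b 0" for c :: 'a
    by (simp add: Hm2_def coeff_const2)
  show "x \<in> Fil2 a b d" if "x \<in> Hm2 a b d"
    using that by (simp add: Hm2_def Fil2_def)
  show "x \<in> Fil2 a b e" if "x \<in> Fil2 a b d" "d \<le> e"
    using that by (force simp: Fil2_def)
  show "x = 0" if "x \<in> Hm2 a b d" "x \<in> Fil2 a b e" "e < d"
    by (rule poly_poly_eqI) (use that in \<open>force simp: Hm2_def Fil2_def\<close>)
qed

lemma graded3: "graded (Hm3 a b w) (Fil3 a b w) (\<lambda>c :: 'a::comm_ring_1. [:const2 c:])"
proof
  show "rhom (\<lambda>c :: 'a. [:const2 c:])" by (rule rhom_const3)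
  fix x y :: "'a poly poly poly" and d e :: int
  show "0 \<in> Hm3 a b w d" by (simp add: Hm3_def)
  show "x + y \<in> Hm3 a b w d" if "x \<in> Hm3 a b w d" "y \<in> Hm3 a b w d"
    using that coeff3_add_nz unfolding Hm3_def mem_Collect_eq by metis
  show "x + y \<in> Fil3 a b w d" if "x \<in> Fil3 a b w d" "y \<in> Fil3 a b w d"
    using that coeff3_add_nz unfolding Fil3_def mem_Collect_eq by metis
  show "x * y \<in> Hm3 a b w (d + e)" if xy: "x \<in> Hm3 a b w d" "y \<in> Hm3 a b w e"
    unfolding Hm3_def mem_Collect_eq
  proof (intro allI impI)
    fix i j k assume "coeff (coeff (coeff (x * y) k) j) i \<noteq> 0"
    from coeff3_mult_nz[OF this] obtain i1 j1 k1 i2 j2 k2 where s: "i1 + i2 = i" "j1 + j2 = j" "k1 + k2 = k"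
      "coeff (coeff (coeff x k1) j1) i1 \<noteq> 0" "coeff (coeff (coeff y k2) j2) i2 \<noteq> 0" by metis
    then have "a * int i1 + b * int j1 + w * int k1 = d" "a * int i2 + b * int j2 + w * int k2 = e"
      using xy by (auto simp: Hm3_def)
    then show "a * int i + b * int j + w * int k = d + e"
      unfolding s(1-3)[symmetric] by (simp add: algebra_simps)
  qed
  show "x * y \<in> Fil3 a b w (d + e)" if xy: "x \<in> Fil3 a b w d" "y \<in> Fil3 a b w e"
    unfolding Fil3_def mem_Collect_eq
  proof (intro allI impI)
    fix i j k assume "coeff (coeff (coeff (x * y) k) j) i \<noteq> 0"
    from coeff3_mult_nz[OF this] obtain i1 j1 k1 i2 j2 k2 where s: "i1 + i2 = i" "j1 + j2 = j" "k1 + k2 = k"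
      "coeff (coeff (coeff x k1) j1) i1 \<noteq> 0" "coeff (coeff (coeff y k2) j2) i2 \<noteq> 0" by metis
    then have "a * int i1 + b * int j1 + w * int k1 \<le> d" "a * int i2 + b * int j2 + w * int k2 \<le> e"
      using xy by (auto simp: Fil3_def)
    then show "a * int i + b * int j + w * int k \<le> d + e"
      unfolding s(1-3)[symmetric] by (simp add: algebra_simps)
  qed
  show "[:const2 c:] \<in> Hm3 a b w 0" for c :: 'a
    by (simp add: Hm3_def coeff_const_poly coeff_const2)
  show "x \<in> Fil3 a b w d" if "x \<in> Hm3 a b w d"
    using that by (simp add: Hm3_def Fil3_def)
  show "x \<in> Fil3 a b w e" if "x \<in> Fil3 a b w d" "d \<le> e"
    using that by (force simp: Fil3_def)
  show "x = 0" if "x \<in> Hm3 a b w d" "x \<in> Fil3 a b w e" "e < d"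
    by (rule poly_eqI, rule poly_poly_eqI) (use that in \<open>force simp: Hm3_def Fil3_def\<close>)
qed

definition part :: "int \<Rightarrow> int \<Rightarrow> int \<Rightarrow> 'a::comm_ring_1 poly poly \<Rightarrow> 'a poly poly" where
  "part a b d f = restr2 (\<lambda>i j. a * int i + b * int j = d) f"

lemma coeff_part:
  "coeff (coeff (part a b d f) j) i = (if a * int i + b * int j = d then coeff (coeff f j) i else 0)"
  by (simp add: part_def coeff_restr2)

lemma part_Hm2: "part a b d f \<in> Hm2 a b d"
  by (simp add: Hm2_def coeff_part)

lemma lead_part: "f \<in> Fil2 a b d \<Longrightarrow> graded.lead (Hm2 a b) (Fil2 a b) d f (part a b d f)"
  unfolding graded.lead_def[OF graded2] by (force simp: part_Hm2 Fil2_def coeff_part)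

lemma eval2_sum_le:
  assumes "rhom h" "\<And>i j. coeff (coeff f j) i \<noteq> 0 \<Longrightarrow> i \<le> M \<and> j \<le> N"
  shows "eval2 h x y f = (\<Sum>j\<le>N. \<Sum>i\<le>M. h (coeff (coeff f j) i) * x ^ i * y ^ j)"
proof -
  have "degree f \<le> N"
  proof (rule degree_le, intro allI impI)
    fix j assume "N < j"
    then have "coeff (coeff f j) i = 0" for i using assms(2)[of j i] by force
    then show "coeff f j = 0" by (simp add: poly_eq_iff)
  qed
  moreover have "degree (coeff f j) \<le> M" for j
    by (rule degree_le) (use assms(2) in force)
  ultimately show ?thesis
    unfolding eval2_def
    by (simp add: poly_map_poly_sum[of _ f N] poly_map_poly_sum[of h _ M] rhom_0[OF assms(1)] sum_distrib_right)
qed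

lemma coeff2_bound:
  obtains M N where "\<And>i j. coeff (coeff f j) i \<noteq> 0 \<Longrightarrow> i \<le> M \<and> j \<le> N"
proof -
  have "i \<le> Max ((\<lambda>j. degree (coeff f j)) ` {..degree f}) \<and> j \<le> degree f"
    if "coeff (coeff f j) i \<noteq> 0" for i j
  proof
    show "j \<le> degree f" using that by (metis coeff_0 le_degree)
    then have "degree (coeff f j) \<le> Max ((\<lambda>j. degree (coeff f j)) ` {..degree f})"
      by (intro Max_ge) auto
    then show "i \<le> Max ((\<lambda>j. degree (coeff f j)) ` {..degree f})"
      using le_degree[OF that] by linarith
  qed
  then show ?thesis using that by blast
qed

text \<open>Monomials of weight \<open>d\<close> contribute products of \<open>x0\<close> and
  \<open>y0\<close>; lighter ones fall into the lower filtration. The weights are the degrees of the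
  substituted elements, and the substituted form may vanish: this is how relations between
  \<open>x0\<close> and \<open>y0\<close> are found.\<close>

lemma (in graded) lead_eval2:
  assumes f: "f \<in> Fil2 a b d" and x: "lead a x x0" and y: "lead b y y0"
  shows "lead d (eval2 h x y f) (eval2 h x0 y0 (part a b d f))"
proof -
  obtain M N where MN: "\<And>i j. coeff (coeff f j) i \<noteq> 0 \<Longrightarrow> i \<le> M \<and> j \<le> N"
    using coeff2_bound[of f] by metis
  have MN': "i \<le> M \<and> j \<le> N" if "coeff (coeff (part a b d f) j) i \<noteq> 0" for i j
    using that MN[of j i] by (auto simp: coeff_part split: if_splits)
  have "lead d (\<Sum>j\<le>N. \<Sum>i\<le>M. h (coeff (coeff f j) i) * x ^ i * y ^ j)
      (\<Sum>j\<le>N. \<Sum>i\<le>M. h (coeff (coeff (part a b d f) j) i) * x0 ^ i * y0 ^ j)"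
  proof (intro lead_sum)
    fix j i
    have xy: "lead (int i * a + int j * b) (x ^ i * y ^ j) (x0 ^ i * y0 ^ j)"
      by (intro lead_mult lead_power x y)
    show "lead d (h (coeff (coeff f j) i) * x ^ i * y ^ j) (h (coeff (coeff (part a b d f) j) i) * x0 ^ i * y0 ^ j)"
    proof (cases "a * int i + b * int j = d")
      case True
      then show ?thesis
        using lead_cmult[OF xy, of "coeff (coeff f j) i"] by (simp add: coeff_part algebra_simps)
    next
      case False
      show ?thesis
      proof (cases "coeff (coeff f j) i = 0")
        case True
        then show ?thesis by (simp add: coeff_part rhom_0[OF rhom_h] lead_self Hm_0)
      next
        case nz: False
        then have "a * int i + b * int j \<le> d - 1"
          using f False by (force simp: Fil2_def)
        then have "h (coeff (coeff f j) i) * (x ^ i * y ^ j) \<in> Fil (d - 1)"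
          by (intro Fil_cmult Fil_mono[OF lead_Fil[OF xy]]) (simp add: algebra_simps)
        then show ?thesis
          using False by (simp add: coeff_part rhom_0[OF rhom_h] lead_0_iff algebra_simps)
      qed
    qed
  qed
  moreover have "eval2 h x y f = (\<Sum>j\<le>N. \<Sum>i\<le>M. h (coeff (coeff f j) i) * x ^ i * y ^ j)"
    by (rule eval2_sum_le[OF rhom_h MN])
  moreover have "eval2 h x0 y0 (part a b d f) =
      (\<Sum>j\<le>N. \<Sum>i\<le>M. h (coeff (coeff (part a b d f) j) i) * x0 ^ i * y0 ^ j)"
    by (rule eval2_sum_le[OF rhom_h MN'])
  ultimately show ?thesis by simp
qed

section \<open>Polynomials over subrings\<close>

text \<open>Subrings are sets so that the ground field, \<open>k(\<zeta>)\<close> and the closure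
  can be handled within the polynomial types over one field.\<close>

definition sring :: "'a::comm_ring_1 set \<Rightarrow> bool" where
  "sring S \<longleftrightarrow> 1 \<in> S \<and> (\<forall>x\<in>S. \<forall>y\<in>S. x - y \<in> S \<and> x * y \<in> S)"

definition sfield :: "'a::field set \<Rightarrow> bool" where
  "sfield S \<longleftrightarrow> sring S \<and> (\<forall>x\<in>S. inverse x \<in> S)"

lemma sring_1: "sring S \<Longrightarrow> 1 \<in> S"
  and sring_diff: "sring S \<Longrightarrow> x \<in> S \<Longrightarrow> y \<in> S \<Longrightarrow> x - y \<in> S"
  and sring_mult: "sring S \<Longrightarrow> x \<in> S \<Longrightarrow> y \<in> S \<Longrightarrow> x * y \<in> S"
  by (simp_all add: sring_def)

lemma sring_0: "sring S \<Longrightarrow> 0 \<in> S"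
  using sring_diff[of S 1 1] sring_1[of S] by simp

lemma sring_minus: "sring S \<Longrightarrow> x \<in> S \<Longrightarrow> - x \<in> S"
  using sring_diff[of S 0 x] sring_0[of S] by simp

lemma sring_add: "sring S \<Longrightarrow> x \<in> S \<Longrightarrow> y \<in> S \<Longrightarrow> x + y \<in> S"
  using sring_diff[of S x "- y"] sring_minus[of S y] by simp

lemma sring_power: "sring S \<Longrightarrow> x \<in> S \<Longrightarrow> x ^ n \<in> S"
  by (induction n) (simp_all add: sring_1 sring_mult)

lemma sring_sum: "sring S \<Longrightarrow> (\<And>i. i \<in> A \<Longrightarrow> f i \<in> S) \<Longrightarrow> sum f A \<in> S"
  by (induction A rule: infinite_finite_induct) (simp_all add: sring_0 sring_add)

lemma sfield_sring: "sfield S \<Longrightarrow> sring S"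
  by (simp add: sfield_def)

lemma sfield_divide: "sfield S \<Longrightarrow> x \<in> S \<Longrightarrow> y \<in> S \<Longrightarrow> x / y \<in> S"
  by (simp add: sfield_def sring_mult divide_inverse)

definition pset :: "'a::comm_ring_1 set \<Rightarrow> 'a poly set" where
  "pset S = {p. \<forall>i. coeff p i \<in> S}"

lemma coeff_pset: "p \<in> pset S \<Longrightarrow> coeff p i \<in> S"
  by (simp add: pset_def)

lemma sring_pset: assumes "sring S" shows "sring (pset S)"
  unfolding sring_def
proof (intro conjI ballI)
  show "1 \<in> pset S"
    using assms by (simp add: pset_def sring_0 sring_1)
  fix p q assume pq: "p \<in> pset S" "q \<in> pset S"
  then show "p - q \<in> pset S"
    using assms by (simp add: pset_def sring_diff)
  show "p * q \<in> pset S"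
    using assms pq by (auto simp: pset_def coeff_mult intro!: sring_sum sring_mult)
qed

lemma pset_pCons: "sring S \<Longrightarrow> a \<in> S \<Longrightarrow> p \<in> pset S \<Longrightarrow> pCons a p \<in> pset S"
  by (simp add: pset_def coeff_pCons split: nat.splits)

lemma pset_0: "sring S \<Longrightarrow> 0 \<in> pset S"
  by (simp add: pset_def sring_0)

lemma varX2_pset: "sring S \<Longrightarrow> varX2 \<in> pset (pset S)"
  and varY2_pset: "sring S \<Longrightarrow> varY2 \<in> pset (pset S)"
  and const2_pset: "sring S \<Longrightarrow> c \<in> S \<Longrightarrow> const2 c \<in> pset (pset S)"
  by (simp_all add: varX2_def varY2_def const2_def pset_pCons sring_pset pset_0 sring_0 sring_1
      sring_1[OF sring_pset] sring_0[OF sring_pset])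

lemma eval2_mem:
  assumes "rhom h" "sring T" "\<And>c. c \<in> S \<Longrightarrow> h c \<in> T" "x \<in> T" "y \<in> T" "f \<in> pset (pset S)"
  shows "eval2 h x y f \<in> T"
  unfolding eval2_sum[OF assms(1)] using assms
  by (intro sring_sum sring_mult sring_power) (auto simp: pset_def)

section \<open>Derivations and rigidity of binomial curves\<close>

definition der :: "('a::comm_ring_1 \<Rightarrow> 'a) \<Rightarrow> bool" where
  "der D \<longleftrightarrow> (\<forall>x y. D (x + y) = D x + D y) \<and> (\<forall>x y. D (x * y) = x * D y + D x * y)"

lemma der_add: "der D \<Longrightarrow> D (x + y) = D x + D y"
  and der_mult: "der D \<Longrightarrow> D (x * y) = x * D y + D x * y"
  by (simp_all add: der_def)

lemma der_0: "der D \<Longrightarrow> D 0 = 0"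
  using der_add[of D 0 0] by simp

lemma der_diff: "der D \<Longrightarrow> D (x - y) = D x - D y"
  using der_add[of D "x - y" y] by (simp add: algebra_simps)

lemma der_sum: "der D \<Longrightarrow> D (sum f A) = (\<Sum>i\<in>A. D (f i))"
  by (induction A rule: infinite_finite_induct) (simp_all add: der_0 der_add)

lemma der_power: assumes "der D" shows "D (x ^ Suc n) = of_nat (Suc n) * x ^ n * D x"
  by (induction n) (simp_all add: der_mult[OF assms] algebra_simps)

lemma der_power': "der D \<Longrightarrow> n > 0 \<Longrightarrow> D (x ^ n) = of_nat n * x ^ (n - 1) * D x"
  by (cases n) (simp_all add: der_power[of D] del: power_Suc)

lemma der_pderiv: "der (pderiv :: 'a::idom poly \<Rightarrow> 'a poly)"
  by (simp add: der_def pderiv_add pderiv_mult algebra_simps)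

lemma der_map_poly: assumes "der D" shows "der (map_poly D)"
  unfolding der_def
proof (intro conjI allI)
  show "map_poly D (p + q) = map_poly D p + map_poly D q" for p q
    by (rule poly_eqI) (simp add: coeff_map_poly der_0 der_add assms)
  show "map_poly D (p * q) = p * map_poly D q + map_poly D p * q" for p q
    by (rule poly_eqI)
      (simp add: coeff_map_poly der_0 assms coeff_mult der_sum der_mult sum.distrib)
qed

lemma map_poly_const: "f 0 = 0 \<Longrightarrow> map_poly f [:c:] = [:f c:]"
  by (simp add: map_poly_pCons)

text \<open>Coprime weights that are at least \<open>2\<close> cannot both be \<open>2\<close>,
  which makes \<open>b (a - 1) > a\<close> strict; the two degree relations give
  \<open>b (a - 1) y \<le> a y\<close> and hence \<open>y = 0\<close>.\<close>

lemma coprime_weights_arith: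
  fixes a b x y :: nat
  assumes "coprime a b" "a \<ge> 2" "b \<ge> 2" "a * y = b * x" "(a - 1) * y \<le> x"
  shows "x = 0 \<and> y = 0"
proof (cases "y = 0")
  case True
  then show ?thesis using assms by auto
next
  case False
  have "\<not> (a = 2 \<and> b = 2)" using assms(1) by auto
  then consider "a = 2" "b \<ge> 3" | "a \<ge> 3" using assms(2,3) by linarith
  then have ab: "a < b * (a - 1)"
  proof cases
    case 2
    then have "a < 2 * (a - 1)" by simp
    also have "\<dots> \<le> b * (a - 1)" using assms(3) by (intro mult_right_mono) simp_all
    finally show ?thesis .
  qed simp
  have "b * ((a - 1) * y) \<le> b * x" using assms(5) by (rule mult_left_mono) simp
  then have "(b * (a - 1)) * y \<le> a * y" using assms(4) by (simp add: mult.assoc)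
  then show ?thesis using ab False by simp
qed

text \<open>The two partial derivatives of the relation express multiples of the Jacobian determinant
  of \<open>(p, q)\<close>, which does not vanish because it is \<open>1\<close> at \<open>t = 0\<close>; comparing
  degrees in \<open>t\<close> then forces \<open>p\<close> and \<open>q\<close> to be constant. At least one of \<open>a\<close>, \<open>b\<close>
  is nonzero in the field, so this works in every characteristic.\<close>

lemma binomial_curve_rigid:
  fixes p q :: "'c::field poly poly poly"
  assumes p0: "coeff p 0 = varX2" and q0: "coeff q 0 = varY2"
    and ab: "coprime a b" "a \<ge> 2" "b \<ge> 2" and c: "c \<noteq> 0"
    and rel: "q ^ a - [:const2 c:] * p ^ b = [:varY2 ^ a - const2 c * varX2 ^ b:]"
  shows "degree p = 0 \<and> degree q = 0"
proof -
  define C :: "'c poly poly poly" where "C = [:const2 c:]"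
  define dX dY :: "'c poly poly poly \<Rightarrow> 'c poly poly poly"
    where "dX = map_poly (map_poly pderiv)" and "dY = map_poly pderiv"
  have derX: "der dX" and derY: "der dY"
    unfolding dX_def dY_def by (intro der_map_poly der_pderiv)+
  have derX2: "der (map_poly pderiv :: 'c poly poly \<Rightarrow> _)" and derY2: "der (pderiv :: 'c poly poly \<Rightarrow> _)"
    by (intro der_map_poly der_pderiv)+
  have X1: "map_poly pderiv varX2 = (1 :: 'c poly poly)" "map_poly pderiv varY2 = (0 :: 'c poly poly)"
    "map_poly pderiv (const2 d) = (0 :: 'c poly poly)" for d :: 'c
    by (simp_all add: varX2_def varY2_def const2_def map_poly_pCons pderiv_pCons one_pCons)
  have Y1: "pderiv varX2 = (0 :: 'c poly poly)" "pderiv varY2 = (1 :: 'c poly poly)"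
    "pderiv (const2 d) = (0 :: 'c poly poly)" for d :: 'c
    by (simp_all add: varX2_def varY2_def const2_def pderiv_pCons one_pCons)
  define e where "e = varY2 ^ a - const2 c * varX2 ^ b"
  have dXe: "dX [:e:] = - (C * [:of_nat b * varX2 ^ (b - 1):])"
    unfolding dX_def C_def e_def using ab
    by (simp add: map_poly_const der_0 derX2 der_diff der_mult der_power' X1)
  have dYe: "dY [:e:] = [:of_nat a * varY2 ^ (a - 1):]"
    unfolding dY_def C_def e_def using ab
    by (simp add: map_poly_const der_0 derY2 der_diff der_mult der_power' Y1)
  have dC: "dX C = 0" "dY C = 0"
    unfolding dX_def dY_def C_def by (simp_all add: map_poly_const der_0 derX2 derY2 X1 Y1)
  have rel': "q ^ a - C * p ^ b = [:e:]"
    using rel by (simp add: C_def e_def)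
  have EX: "of_nat a * q ^ (a - 1) * dX q - C * (of_nat b * p ^ (b - 1) * dX p) =
      - (C * [:of_nat b * varX2 ^ (b - 1):])"
    using arg_cong[OF rel', of dX] ab by (simp add: dXe der_diff derX der_mult der_power' dC)
  have EY: "of_nat a * q ^ (a - 1) * dY q - C * (of_nat b * p ^ (b - 1) * dY p) =
      [:of_nat a * varY2 ^ (a - 1):]"
    using arg_cong[OF rel', of dY] ab by (simp add: dYe der_diff derY der_mult der_power' dC)
  define J where "J = dX p * dY q - dY p * dX q"
  have coeff0: "coeff (f * g) 0 = coeff f 0 * coeff g 0" for f g :: "'c poly poly poly"
    by (simp add: coeff_mult)
  have "coeff J 0 = 1"
    unfolding J_def dX_def dY_def
    by (simp add: coeff0 coeff_map_poly p0 q0 X1 Y1 del: coeff_mult_0)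
  then have J0: "J \<noteq> 0" by auto
  \<comment> \<open>Cramer's rule for \<open>EX\<close> and \<open>EY\<close>, regarded as linear
    equations for \<open>of_nat a * q ^ (a - 1)\<close> and
    \<open>C * (of_nat b * p ^ (b - 1))\<close>: each elimination leaves a right side of degree in
    \<open>t\<close> at most that of \<open>p\<close>, respectively \<open>q\<close>.\<close>
  have J1: "of_nat a * q ^ (a - 1) * J =
      [:of_nat a * varY2 ^ (a - 1):] * dX p + C * [:of_nat b * varX2 ^ (b - 1):] * dY p"
    using arg_cong2[OF arg_cong[OF EY, of "\<lambda>z. z * dX p"] arg_cong[OF EX, of "\<lambda>z. z * dY p"], of "(-)"]
    unfolding J_def by (simp add: algebra_simps)
  have J2: "C * (of_nat b * p ^ (b - 1)) * J =
      [:of_nat a * varY2 ^ (a - 1):] * dX q + C * [:of_nat b * varX2 ^ (b - 1):] * dY q"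
    using arg_cong2[OF arg_cong[OF EY, of "\<lambda>z. z * dX q"] arg_cong[OF EX, of "\<lambda>z. z * dY q"], of "(-)"]
    unfolding J_def by (simp add: algebra_simps)
  have degC: "degree ([:u:] * f) \<le> degree f" for u and f :: "'c poly poly poly"
    by (simp add: degree_smult_le)
  have bound: "degree ([:u:] * dX f + C * [:v:] * dY f) \<le> degree f" for u v f
  proof (rule degree_add_le)
    show "degree ([:u:] * dX f) \<le> degree f"
      using degC[of u "dX f"] map_poly_degree_leq[of "map_poly pderiv" f] unfolding dX_def by linarith
    show "degree (C * [:v:] * dY f) \<le> degree f"
      using degC[of "const2 c * v" "dY f"] map_poly_degree_leq[of pderiv f]
      unfolding dY_def C_def by simp
  qed
  have pn: "p \<noteq> 0" and qn: "q \<noteq> 0" using p0 q0 by auto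
  have Cn: "C \<noteq> 0" using c by (simp add: C_def)
  have degC0: "degree C = 0" by (simp add: C_def)
  \<comment> \<open>The difference of \<open>q ^ a\<close> and \<open>C * p ^ b\<close> is free of
    \<open>t\<close>, so their degrees in \<open>t\<close> agree.\<close>
  have deg: "a * degree q = b * degree p"
  proof -
    have eq: "q ^ a = C * p ^ b + [:e:]" using rel' by (simp add: algebra_simps)
    have d: "degree (C * p ^ b) = b * degree p" "degree (q ^ a) = a * degree q"
      using Cn pn qn by (simp_all add: degree_mult_eq degree_power_eq degC0)
    show ?thesis
    proof (cases "degree p = 0")
      case True
      then have "degree (C * p ^ b + [:e:]) \<le> 0" using d by (intro degree_add_le) simp_all
      then show ?thesis using eq d True by simp
    next
      case False
      then have "degree [:e:] < degree (C * p ^ b)" using d ab by simp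
      then show ?thesis using eq d degree_add_eq_left by metis
    qed
  qed
  have nz: "of_nat a \<noteq> (0::'c) \<or> of_nat b \<noteq> (0::'c)"
  proof (rule ccontr)
    assume "\<not> ?thesis"
    then have "CHAR('c) dvd a" "CHAR('c) dvd b" by (simp_all add: of_nat_eq_0_iff_char_dvd)
    then have "CHAR('c) = 1" using ab(1) by (meson coprime_common_divisor_nat nat_dvd_1_iff_1)
    then show False by simp
  qed
  have ofn: "of_nat m \<noteq> (0::'c poly poly poly)" "degree (of_nat m :: 'c poly poly poly) = 0"
    if "of_nat m \<noteq> (0::'c)" for m
    using that by (simp_all add: of_nat_poly of_nat_eq_0_iff_char_dvd)
  from nz show ?thesis
  proof
    assume a0: "of_nat a \<noteq> (0::'c)"
    have "(a - 1) * degree q \<le> degree (of_nat a * q ^ (a - 1) * J)"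
      using qn J0 ofn[OF a0] by (simp add: degree_mult_eq degree_power_eq)
    also have "\<dots> \<le> degree p" unfolding J1 by (rule bound)
    finally show ?thesis using coprime_weights_arith[OF ab deg] by simp
  next
    assume b0: "of_nat b \<noteq> (0::'c)"
    have "(b - 1) * degree p \<le> degree (C * (of_nat b * p ^ (b - 1)) * J)"
      using pn Cn J0 ofn[OF b0] by (simp add: degree_mult_eq degree_power_eq degC0)
    also have "\<dots> \<le> degree q" unfolding J2 by (rule bound)
    finally show ?thesis
      using coprime_weights_arith[of b a "degree p" "degree q"] ab deg by (simp add: coprime_commute)
  qed
qed

section \<open>Weighted homogeneous polynomials and their factors\<close>

lemma monom2_eq: "const2 c * varX2 ^ m * varY2 ^ k = monom (monom c m) (k::nat)"
proof -
  have "(varX2 :: 'a poly poly) ^ m = [:[:0, 1:] ^ m:]"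
    by (simp add: varX2_def poly_const_pow)
  then have "const2 c * varX2 ^ m = [:monom c m:]"
    by (simp add: const2_def monom_altdef)
  then show ?thesis by (simp add: varY2_def monom_altdef)
qed

lemma coeff_monom2: "coeff (coeff (const2 c * varX2 ^ m * varY2 ^ k) j) i = (if i = m \<and> j = k then c else 0)"
  by (simp add: monom2_eq)

lemma coeff_varX_power: "coeff (coeff (varX2 ^ m) j) i = (if i = m \<and> j = 0 then 1 else (0::'a::comm_ring_1))"
  using coeff_monom2[of "1::'a" m 0] by simp

lemma coeff_varY_power: "coeff (coeff (varY2 ^ m) j) i = (if i = 0 \<and> j = m then 1 else (0::'a::comm_ring_1))"
  using coeff_monom2[of "1::'a" 0 m] by simp

lemma coeff_varX: "coeff (coeff varX2 j) i = (if i = 1 \<and> j = 0 then 1 else (0::'a::comm_ring_1))"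
  using coeff_varX_power[of 1, where 'a='a] by simp

lemma coeff_varY: "coeff (coeff varY2 j) i = (if i = 0 \<and> j = 1 then 1 else (0::'a::comm_ring_1))"
  using coeff_varY_power[of 1, where 'a='a] by simp

lemma varX_Hm2: "varX2 \<in> Hm2 a b a" and varY_Hm2: "varY2 \<in> Hm2 a b b"
  by (auto simp: Hm2_def coeff_varX coeff_varY)

lemma varX_dvd:
  assumes "\<And>j. coeff (coeff f j) 0 = 0"
  shows "(varX2 :: 'a::comm_ring_1 poly poly) dvd f"
proof -
  define g where "g = map_poly (\<lambda>p. poly_shift 1 p) f"
  have "f = varX2 * g"
    by (rule poly_poly_eqI)
      (use assms in \<open>auto simp: g_def varX2_def coeff_map_poly coeff_poly_shift coeff_pCons split: nat.splits\<close>)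
  then show ?thesis by simp
qed

lemma varY_dvd:
  assumes "coeff f 0 = 0"
  shows "(varY2 :: 'a::comm_ring_1 poly poly) dvd f"
proof -
  have "f = varY2 * poly_shift 1 f"
    by (rule poly_eqI)
      (use assms in \<open>auto simp: varY2_def coeff_poly_shift coeff_pCons split: nat.splits\<close>)
  then show ?thesis by (metis dvd_triv_left)
qed

text \<open>\<open>A\<close> annihilates the part of \<open>F\<close> outside weight
  \<open>d - e\<close>: the product has weight \<open>d\<close>, yet each of its monomials would
  come from weights that do not add up to \<open>d\<close>.\<close>

lemma Hm2_cancel:
  assumes A: "A \<noteq> (0::'c::field poly poly)" "A \<in> Hm2 a b e" and AF: "A * F \<in> Hm2 a b d"
  shows "F \<in> Hm2 a b (d - e)"
proof -
  interpret g: graded "Hm2 a b" "Fil2 a b" "const2 :: 'c \<Rightarrow> _" by (rule graded2)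
  define F0 where "F0 = part a b (d - e) F"
  have "A * F0 \<in> Hm2 a b (e + (d - e))"
    unfolding F0_def by (intro g.Hm_mult A part_Hm2)
  then have 1: "A * (F - F0) \<in> Hm2 a b d"
    using g.Hm_diff[OF AF] by (simp add: algebra_simps)
  have "A * (F - F0) = 0"
  proof (rule ccontr)
    assume "A * (F - F0) \<noteq> 0"
    then obtain i j where ij: "coeff (coeff (A * (F - F0)) j) i \<noteq> 0"
      by (metis leading_coeff_0_iff)
    then obtain i1 j1 i2 j2 where s: "i1 + i2 = i" "j1 + j2 = j"
      "coeff (coeff A j1) i1 \<noteq> 0" "coeff (coeff (F - F0) j2) i2 \<noteq> 0"
      using coeff2_mult_nz by metis
    have "a * int i + b * int j = d" using 1 ij by (simp add: Hm2_def)
    moreover have "a * int i1 + b * int j1 = e" using s A by (simp add: Hm2_def)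
    moreover have "a * int i2 + b * int j2 \<noteq> d - e"
      using s(4) by (auto simp: F0_def coeff_part)
    ultimately show False unfolding s(1,2)[symmetric] by (simp add: algebra_simps)
  qed
  then have "F = F0" using A by simp
  then show ?thesis using part_Hm2 F0_def by metis
qed

lemma diff_dvd_power_diff: "x - y dvd x ^ n - (y::'a::comm_ring_1) ^ n"
  by (cases n) (simp_all add: diff_power_eq_sum del: power_Suc)

text \<open>If neither variable divides \<open>F\<close>, both pure powers occur and coprimality
  forces all monomials into the shape \<open>X^(b (M - l)) Y^(a l)\<close>. So \<open>F\<close> is
  \<open>X^(b M)\<close> times a polynomial \<open>G\<close> in \<open>Y^a / X^b\<close>, and a root
  \<open>r\<close> of \<open>G\<close> gives the binomial factor.\<close>

lemma homogeneous_factor: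
  fixes F :: "'c::alg_closed_field poly poly" and a b :: nat
  assumes F: "F \<in> Hm2 (int a) (int b) d" "F \<noteq> 0" and d: "d > 0" and ab: "coprime a b" "a > 0" "b > 0"
  shows "varX2 dvd F \<or> varY2 dvd F \<or> (\<exists>c. c \<noteq> 0 \<and> varY2 ^ a - const2 c * varX2 ^ b dvd F)"
proof (rule ccontr)
  assume neg: "\<not> ?thesis"
  then obtain j0 where j0: "coeff (coeff F j0) 0 \<noteq> 0" using varX_dvd by blast
  have "coeff F 0 \<noteq> 0" using neg varY_dvd by blast
  then obtain i0 where i0: "coeff (coeff F 0) i0 \<noteq> 0" by (metis leading_coeff_0_iff)
  have d1: "d = int (b * j0)" and d2: "d = int (a * i0)"
    using F(1) i0 j0 unfolding Hm2_def by fastforce+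
  have "a * i0 = b * j0" using d1 d2 by linarith
  then have "b dvd i0" using ab(1) by (metis coprime_commute coprime_dvd_mult_right_iff dvd_triv_left)
  then obtain M where M: "i0 = b * M" by blast
  then have j0M: "j0 = a * M" using \<open>a * i0 = b * j0\<close> ab(3) by simp
  have M0: "M > 0" using d d2 M by (auto intro: Nat.gr0I)
  have supp: "\<exists>l\<le>M. i = b * (M - l) \<and> j = a * l" if nz: "coeff (coeff F j) i \<noteq> 0" for i j
  proof -
    have "int a * int i + int b * int j = int (a * (b * M))"
      using F(1) nz d2 M by (simp add: Hm2_def)
    then have eq: "a * i + b * j = a * (b * M)" by (metis of_nat_add of_nat_eq_iff of_nat_mult)
    then have "b dvd a * i" "a dvd b * j"
      by (metis dvd_add_left_iff dvd_mult dvd_triv_left, metis dvd_add_right_iff dvd_triv_left)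
    then have "b dvd i" "a dvd j"
      using ab(1) by (metis coprime_commute coprime_dvd_mult_right_iff)+
    then obtain i' l where il: "i = b * i'" "j = a * l" by blast
    have "a * b * (i' + l) = a * b * M"
      using eq unfolding il by (simp add: algebra_simps)
    then have "i' + l = M" using ab by simp
    then show ?thesis using il by (intro exI[of _ l]) auto
  qed
  define c where "c l = coeff (coeff F (a * l)) (b * (M - l))" for l
  have Feq: "F = (\<Sum>l\<le>M. const2 (c l) * varX2 ^ (b * (M - l)) * varY2 ^ (a * l))"
  proof (rule poly_poly_eqI)
    fix i j
    have "coeff (coeff (\<Sum>l\<le>M. const2 (c l) * varX2 ^ (b * (M - l)) * varY2 ^ (a * l)) j) i =
        (\<Sum>l\<le>M. if i = b * (M - l) \<and> j = a * l then c l else 0)"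
      by (simp add: coeff_sum coeff_monom2)
    also have "\<dots> = coeff (coeff F j) i"
    proof (cases "\<exists>l\<le>M. i = b * (M - l) \<and> j = a * l")
      case True
      then obtain l where l: "l \<le> M" "i = b * (M - l)" "j = a * l" by blast
      have "(\<Sum>l'\<le>M. if i = b * (M - l') \<and> j = a * l' then c l' else 0) =
          (\<Sum>l'\<le>M. if l' = l then c l else 0)"
        using ab l by (intro sum.cong) auto
      also have "\<dots> = c l" using l by simp
      finally show ?thesis using l by (simp add: c_def)
    next
      case False
      then have "coeff (coeff F j) i = 0" using supp by blast
      moreover have "(\<Sum>l\<le>M. if i = b * (M - l) \<and> j = a * l then c l else 0) = 0"
        using False by (intro sum.neutral) auto
      ultimately show ?thesis by simp
    qed
    finally show "coeff (coeff F j) i =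
      coeff (coeff (\<Sum>l\<le>M. const2 (c l) * varX2 ^ (b * (M - l)) * varY2 ^ (a * l)) j) i" ..
  qed
  define G where "G = (\<Sum>l\<le>M. monom (c l) l)"
  have coG: "coeff G l = (if l \<le> M then c l else 0)" for l
    by (simp add: G_def coeff_sum)
  have "coeff G M \<noteq> 0" using j0 j0M by (simp add: coG c_def)
  then have "degree G > 0" using M0 le_degree by fastforce
  then obtain r where r: "poly G r = 0" using alg_closed_imp_poly_has_root by blast
  have "c 0 \<noteq> 0" using i0 M by (simp add: c_def)
  then have "poly G 0 \<noteq> 0" using coG[of 0] by (simp add: poly_0_coeff_0)
  then have r0: "r \<noteq> 0" using r by auto
  define h where "h = varY2 ^ a - const2 r * varX2 ^ b"
  have polyG: "poly G r = (\<Sum>l\<le>M. c l * r ^ l)"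
    by (simp add: G_def poly_sum poly_monom)
  \<comment> \<open>Replacing \<open>Y^a\<close> by \<open>r X^b\<close> turns \<open>F\<close> into
    \<open>poly G r\<close> times \<open>X^(b M)\<close>, which is \<open>0\<close>; so
    \<open>F\<close> is a combination of the differences \<open>(Y^a)^l - (r X^b)^l\<close>.\<close>
  have "(\<Sum>l\<le>M. const2 (c l) * varX2 ^ (b * (M - l)) * (const2 r * varX2 ^ b) ^ l) =
      (\<Sum>l\<le>M. const2 (c l * r ^ l) * varX2 ^ (b * M))"
  proof (intro sum.cong refl)
    fix l assume "l \<in> {..M}"
    then have "b * M = b * (M - l) + b * l" by (metis add_mult_distrib2 atMost_iff le_add_diff_inverse2)
    then have "(varX2 :: 'c poly poly) ^ (b * M) = varX2 ^ (b * (M - l)) * (varX2 ^ b) ^ l"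
      by (metis power_add power_mult)
    then show "const2 (c l) * varX2 ^ (b * (M - l)) * (const2 r * varX2 ^ b) ^ l =
        const2 (c l * r ^ l) * varX2 ^ (b * M)"
      by (simp add: power_mult_distrib const2_mult rhom_power[OF rhom_const2] algebra_simps)
  qed
  also have "\<dots> = const2 (poly G r) * varX2 ^ (b * M)"
    by (simp add: polyG rhom_sum[OF rhom_const2] sum_distrib_right)
  also have "\<dots> = 0" by (simp add: r)
  finally have "F = (\<Sum>l\<le>M. const2 (c l) * varX2 ^ (b * (M - l)) * ((varY2 ^ a) ^ l - (const2 r * varX2 ^ b) ^ l))"
    using Feq by (simp only: right_diff_distrib sum_subtractf power_mult[symmetric] diff_0_right)
  also have "h dvd \<dots>"
    unfolding h_def by (intro dvd_sum dvd_mult diff_dvd_power_diff)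
  finally show False using neg r0 unfolding h_def by blast
qed

section \<open>One-parameter families of endomorphisms\<close>

text \<open>A nontrivial deformation \<open>\<psi>\<^sub>t\<close> of the identity; \<open>\<psi> F = [:F:]\<close> says that \<open>F\<close> is invariant. Polynomials in the
  parameter \<open>t\<close> form the outer layer.\<close>

definition fam :: "('c::field poly poly \<Rightarrow> 'c poly poly poly) \<Rightarrow> bool" where
  "fam \<psi> \<longleftrightarrow> rhom \<psi> \<and> (\<forall>c. \<psi> (const2 c) = [:const2 c:]) \<and> (\<forall>G. coeff (\<psi> G) 0 = G)
    \<and> (\<psi> varX2 \<noteq> [:varX2:] \<or> \<psi> varY2 \<noteq> [:varY2:])"

text \<open>Degrees in \<open>t\<close> add up in a domain, so factors of an element free of
  \<open>t\<close> are free of \<open>t\<close>; the value at \<open>t = 0\<close> identifies the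
  factor.\<close>

lemma fam_inv_factor:
  assumes "fam \<psi>" "\<psi> (F * G) = [:F * G:]" "F * G \<noteq> 0"
  shows "\<psi> F = [:F:]"
proof -
  have r: "rhom \<psi>" and c0: "coeff (\<psi> G) 0 = G" for G using assms(1) by (auto simp: fam_def)
  have eq: "\<psi> F * \<psi> G = [:F * G:]" using assms(2) by (simp add: rhom_mult[OF r])
  have "\<psi> F \<noteq> 0" "\<psi> G \<noteq> 0" using eq assms(3) by auto
  then have "degree (\<psi> F) = 0" using arg_cong[OF eq, of degree] by (simp add: degree_mult_eq)
  then show ?thesis using c0[of F] by (metis coeff_pCons_0 degree_eq_zeroE)
qed

lemma fam_inv_power: assumes "fam \<psi>" "\<psi> (F ^ n) = [:F ^ n:]" "n > 0" "F \<noteq> 0" shows "\<psi> F = [:F:]"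
  using assms by (cases n) (auto intro!: fam_inv_factor[of \<psi> F])

lemma fam_inv_const: "fam \<psi> \<Longrightarrow> \<psi> (const2 c) = [:const2 c:]"
  by (simp add: fam_def)

lemma fam_not_XY: "fam \<psi> \<Longrightarrow> \<psi> varX2 = [:varX2:] \<Longrightarrow> \<psi> varY2 = [:varY2:] \<Longrightarrow> False"
  by (simp add: fam_def)

lemma fam_inv_ops:
  assumes "fam \<psi>" "\<psi> F = [:F:]" "\<psi> G = [:G:]"
  shows "\<psi> (F + G) = [:F + G:]" "\<psi> (F - G) = [:F - G:]" "\<psi> (F * G) = [:F * G:]" "\<psi> (F ^ n) = [:F ^ n:]"
proof -
  have r: "rhom \<psi>" using assms(1) by (simp add: fam_def)
  show "\<psi> (F + G) = [:F + G:]" "\<psi> (F - G) = [:F - G:]" "\<psi> (F * G) = [:F * G:]" "\<psi> (F ^ n) = [:F ^ n:]"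
    using assms by (simp_all add: rhom_simps[OF r] poly_const_pow)
qed

text \<open>Up to constants these are the prime factors of \<open>(a, b)\<close>-homogeneous polynomials when \<open>a, b\<close> are coprime.\<close>

definition atoms :: "nat \<Rightarrow> nat \<Rightarrow> 'c::field poly poly set" where
  "atoms a b = {varX2, varY2} \<union> {varY2 ^ a - const2 c * varX2 ^ b | c. c \<noteq> 0}"

lemma binomial_nz: "a > 0 \<Longrightarrow> varY2 ^ a - const2 c * varX2 ^ b \<noteq> (0 :: 'c::field poly poly)"
proof
  assume "a > 0" and "varY2 ^ a - const2 c * varX2 ^ b = (0 :: 'c poly poly)"
  then have "coeff (coeff (varY2 ^ a - const2 c * varX2 ^ b) a) 0 = (0 :: 'c)" by simp
  then show False using \<open>a > 0\<close>
    by (simp add: coeff_varY_power coeff_varX_power del: right_minus_eq)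
qed

lemma atom_nz: "A \<in> atoms a b \<Longrightarrow> a > 0 \<Longrightarrow> A \<noteq> 0"
  unfolding atoms_def by (elim UnE insertE emptyE CollectE exE conjE; hypsubst) (simp_all only: varX2_nz varY2_nz binomial_nz not_False_eq_True)

lemma binomial_Hm2: "varY2 ^ a - const2 c * varX2 ^ b \<in> Hm2 (int a) (int b) (int (a * b))"
  unfolding Hm2_def mem_Collect_eq
proof (intro allI impI)
  fix i j assume "coeff (coeff (varY2 ^ a - const2 c * varX2 ^ b) j) i \<noteq> 0"
  then consider "i = 0" "j = a" | "i = b" "j = 0"
    by (auto simp: coeff_varY_power coeff_varX_power split: if_splits)
  then show "int a * int i + int b * int j = int (a * b)"
    by cases simp_all
qed

lemma atom_Hm2: assumes "A \<in> atoms a b" "a > 0" "b > 0"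
  obtains e where "e > 0" "A \<in> Hm2 (int a) (int b) e"
proof -
  consider "A = varX2" | "A = varY2" | c where "A = varY2 ^ a - const2 c * varX2 ^ b"
    using assms(1) by (auto simp: atoms_def)
  then show ?thesis
  proof cases
    case 1
    show ?thesis by (rule that[of "int a"]) (use 1 assms varX_Hm2 in auto)
  next
    case 2
    show ?thesis by (rule that[of "int b"]) (use 2 assms varY_Hm2 in auto)
  next
    case 3
    show ?thesis by (rule that[of "int (a * b)"]) (use 3 assms binomial_Hm2[of a c b] in auto)
  qed
qed

text \<open>From two distinct invariant atoms, linear combinations produce invariant multiples of
  powers of \<open>X\<close> and \<open>Y\<close>; then \<open>X\<close> and \<open>Y\<close> are
  invariant themselves, contradicting nontriviality.\<close>

lemma fam_atom_unique:
  assumes fam: "fam \<psi>" and ab: "a > 0" "b > 0" and A: "A \<in> atoms a b" "\<psi> A = [:A:]"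
    and B: "B \<in> atoms a b" "\<psi> B = [:B:]"
  shows "A = B"
proof (rule ccontr)
  assume ne: "A \<noteq> B"
  note ops = fam_inv_ops[OF fam] fam_inv_const[OF fam]
  have X: "\<psi> varX2 = [:varX2:]" if "\<psi> (const2 c * varX2 ^ b) = [:const2 c * varX2 ^ b:]" "c \<noteq> 0" for c
    using fam_inv_power[OF fam fam_inv_factor[OF fam, of "varX2 ^ b" "const2 c"]] that ab
    by (simp add: mult.commute)
  have Y: "\<psi> varY2 = [:varY2:]" if "\<psi> (varY2 ^ a) = [:varY2 ^ a:]"
    using fam_inv_power[OF fam that ab(1)] by simp
  have XB: "\<psi> (const2 c * varX2 ^ b) = [:const2 c * varX2 ^ b:]" if "\<psi> varX2 = [:varX2:]" for c
    by (rule ops(3)[OF ops(5) ops(4)]) (use that in simp_all)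
  have 1: False if "\<psi> varX2 = [:varX2:]" "\<psi> (varY2 ^ a - const2 c * varX2 ^ b) = [:varY2 ^ a - const2 c * varX2 ^ b:]" for c
    using ops(1)[OF that(2) XB[OF that(1), of c]] Y that(1) fam_not_XY[OF fam] by simp
  have 2: False if y: "\<psi> varY2 = [:varY2:]"
    and h: "\<psi> (varY2 ^ a - const2 c * varX2 ^ b) = [:varY2 ^ a - const2 c * varX2 ^ b:]" and c: "c \<noteq> 0" for c
    using ops(2)[OF ops(4)[OF y y] h, of a] X[OF _ c] y fam_not_XY[OF fam] by simp
  have 3: False if h: "\<psi> (varY2 ^ a - const2 c * varX2 ^ b) = [:varY2 ^ a - const2 c * varX2 ^ b:]"
    "\<psi> (varY2 ^ a - const2 c' * varX2 ^ b) = [:varY2 ^ a - const2 c' * varX2 ^ b:]" and c: "c \<noteq> c'" for c c'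
  proof -
    have "(varY2 ^ a - const2 c * varX2 ^ b) - (varY2 ^ a - const2 c' * varX2 ^ b) = const2 (c' - c) * varX2 ^ b"
      by (simp add: rhom_diff[OF rhom_const2] algebra_simps)
    then have "\<psi> varX2 = [:varX2:]"
      using ops(2)[OF h] X[of "c' - c"] c by simp
    then show False using 1 h by blast
  qed
  show False
    using A B ne 1 2 3 fam_not_XY[OF fam] unfolding atoms_def by auto
qed

text \<open>Prime factors are split off by induction on the weight; each is an invariant atom, hence
  always the same \<open>A\<close>.\<close>

lemma fam_homogeneous_power:
  fixes \<psi> :: "'c::alg_closed_field poly poly \<Rightarrow> _"
  assumes fam: "fam \<psi>" and ab: "coprime a b" "a > 0" "b > 0" and A: "A \<in> atoms a b" "\<psi> A = [:A:]"
    and F: "F \<in> Hm2 (int a) (int b) d" "F \<noteq> 0" "\<psi> F = [:F:]"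
  shows "\<exists>\<alpha> m. F = const2 \<alpha> * A ^ m"
  using F
proof (induction "nat d" arbitrary: d F rule: less_induct)
  case less
  have d: "d \<ge> 0"
  proof -
    obtain i j where "coeff (coeff F j) i \<noteq> 0" using less.prems(2) by (metis leading_coeff_0_iff)
    then have "d = int a * int i + int b * int j" using less.prems(1) by (auto simp: Hm2_def)
    then show ?thesis by simp
  qed
  show ?case
  proof (cases "d = 0")
    case True
    have "F = const2 (coeff (coeff F 0) 0) * A ^ 0"
    proof (rule poly_poly_eqI)
      fix i j
      have "coeff (coeff F j) i = 0" if "\<not> (i = 0 \<and> j = 0)"
      proof (rule ccontr)
        assume "coeff (coeff F j) i \<noteq> 0"
        then have "int (a * i + b * j) = 0" using less.prems(1) True by (simp add: Hm2_def)
        then have "a * i + b * j = 0" by (simp only: of_nat_eq_0_iff)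
        then show False using that ab by simp
      qed
      then show "coeff (coeff F j) i = coeff (coeff (const2 (coeff (coeff F 0) 0) * A ^ 0) j) i"
        by (simp add: coeff_const2 del: coeff_const2_mult)
    qed
    then show ?thesis by blast
  next
    case False
    with d have "d > 0" by simp
    obtain B where B: "B \<in> atoms a b" "B dvd F"
      using homogeneous_factor[OF less.prems(1,2) \<open>d > 0\<close> ab] unfolding atoms_def by blast
    then obtain F' where F': "F = B * F'" by blast
    have "\<psi> B = [:B:]" using fam_inv_factor[OF fam, of B F'] less.prems(2,3) F' by simp
    then have "B = A" using fam_atom_unique[OF fam ab(2,3) B(1) _ A] by blast
    have F'inv: "\<psi> F' = [:F':]"
      using fam_inv_factor[OF fam, of F' B] less.prems(2,3) F' by (simp add: mult.commute)
    obtain e where e: "e > 0" "B \<in> Hm2 (int a) (int b) e" using atom_Hm2[OF B(1) ab(2,3)] .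
    have "F' \<in> Hm2 (int a) (int b) (d - e)"
      using Hm2_cancel[OF atom_nz[OF B(1) ab(2)] e(2)] less.prems(1) F' by blast
    moreover have "F' \<noteq> 0" using less.prems(2) F' by auto
    ultimately obtain \<alpha> m where "F' = const2 \<alpha> * A ^ m"
      using less.hyps[of "d - e" F'] F'inv e \<open>d > 0\<close> by auto
    then have "F = const2 \<alpha> * A ^ Suc m" using F' \<open>B = A\<close> by simp
    then show ?thesis by blast
  qed
qed

text \<open>Invariance says that \<open>\<psi> Y\<close> is \<open>c (\<psi> X)^b\<close> plus a
  term free of \<open>t\<close>. Some positive power of \<open>t\<close> occurs in
  \<open>(\<psi> X)^b\<close>, and there \<open>c\<close> is a quotient of two coefficients from
  \<open>S\<close>.\<close>

lemma fam_binomial_coeff: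
  assumes fam: "fam \<psi>" and S: "sfield S"
    and XY: "\<psi> varX2 \<in> pset (pset (pset S))" "\<psi> varY2 \<in> pset (pset (pset S))"
    and inv: "\<psi> (varY2 - const2 c * varX2 ^ b) = [:varY2 - const2 c * varX2 ^ b:]" and b: "b > 0"
  shows "c \<in> S"
proof -
  have r: "rhom \<psi>" using fam by (simp add: fam_def)
  have eq: "\<psi> varY2 = [:const2 c:] * \<psi> varX2 ^ b + [:varY2 - const2 c * varX2 ^ b:]"
    using inv by (simp add: rhom_simps[OF r] fam_inv_const[OF fam] algebra_simps)
  have "\<exists>k>0. coeff (\<psi> varX2 ^ b) k \<noteq> 0"
  proof (rule ccontr)
    assume "\<not> ?thesis"
    then have "degree (\<psi> varX2 ^ b) = 0" by (metis leading_coeff_0_iff degree_0 not_gr_zero)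
    moreover have nz: "\<psi> varX2 \<noteq> 0" using fam unfolding fam_def by (metis coeff_0 varX2_nz)
    ultimately have "degree (\<psi> varX2) = 0" using b by (simp add: degree_power_eq)
    then have X: "\<psi> varX2 = [:varX2:]"
      using fam unfolding fam_def by (metis coeff_pCons_0 degree_eq_zeroE)
    then have "\<psi> varY2 = [:varY2:]" using eq by (simp add: poly_const_pow)
    then show False using X fam_not_XY[OF fam] by blast
  qed
  then obtain k where k: "k > 0" "coeff (\<psi> varX2 ^ b) k \<noteq> 0" by blast
  then obtain i j where ij: "coeff (coeff (coeff (\<psi> varX2 ^ b) k) j) i \<noteq> 0"
    by (metis leading_coeff_0_iff)
  have "coeff (coeff (coeff (\<psi> varY2) k) j) i = c * coeff (coeff (coeff (\<psi> varX2 ^ b) k) j) i"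
    using k(1) by (subst eq) (simp add: coeff_const_poly)
  moreover have "coeff (coeff (coeff (\<psi> varX2 ^ b) k) j) i \<in> S" "coeff (coeff (coeff (\<psi> varY2) k) j) i \<in> S"
    using XY sring_power[OF sring_pset[OF sring_pset[OF sring_pset[OF sfield_sring[OF S]]]] XY(1), of b]
    by (auto simp: pset_def)
  ultimately show ?thesis using sfield_divide[OF S] ij by (metis nonzero_mult_div_cancel_right)
qed

text \<open>Rigidity excludes binomials with both exponents at least \<open>2\<close>. Membership of
  \<open>c\<close> in \<open>S\<close> is claimed for \<open>a = 1\<close>, the shape straightened
  by an elementary map \<open>Y \<mapsto> Y + c X^b\<close>.\<close>

lemma fam_homogeneous:
  fixes \<psi> :: "'c::alg_closed_field poly poly \<Rightarrow> _"
  assumes fam: "fam \<psi>" and ab: "coprime a b" "a > 0" "b > 0"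
    and F: "F \<in> Hm2 (int a) (int b) d" "F \<noteq> 0" "\<psi> F = [:F:]" "d > 0"
    and S: "sfield S" "\<psi> varX2 \<in> pset (pset (pset S))" "\<psi> varY2 \<in> pset (pset (pset S))"
  shows "\<exists>\<alpha> m. \<alpha> \<noteq> 0 \<and> m > 0 \<and> (F = const2 \<alpha> * varX2 ^ m \<or> F = const2 \<alpha> * varY2 ^ m \<or>
    (\<exists>c. c \<noteq> 0 \<and> (a = 1 \<or> b = 1) \<and> (a = 1 \<longrightarrow> c \<in> S) \<and> F = const2 \<alpha> * (varY2 ^ a - const2 c * varX2 ^ b) ^ m))"
proof -
  obtain A where A: "A \<in> atoms a b" "A dvd F"
    using homogeneous_factor[OF F(1,2,4) ab] unfolding atoms_def by blast
  then obtain F' where F': "F = A * F'" by blast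
  have Ai: "\<psi> A = [:A:]" using fam_inv_factor[OF fam, of A F'] F F' by simp
  obtain \<alpha> m where am: "F = const2 \<alpha> * A ^ m"
    using fam_homogeneous_power[OF fam ab A(1) Ai F(1-3)] by blast
  have "\<alpha> \<noteq> 0" using am F(2) by auto
  moreover have "m > 0"
  proof (rule ccontr)
    assume "\<not> m > 0"
    then have "coeff (coeff F 0) 0 \<noteq> 0" using am \<open>\<alpha> \<noteq> 0\<close> by (simp add: coeff_const2 del: coeff_const2_mult)
    then have "int a * int 0 + int b * int 0 = d" using F(1) unfolding Hm2_def by blast
    then show False using F(4) by simp
  qed
  moreover have "A = varX2 \<or> A = varY2 \<or>
    (\<exists>c. c \<noteq> 0 \<and> (a = 1 \<or> b = 1) \<and> (a = 1 \<longrightarrow> c \<in> S) \<and> A = varY2 ^ a - const2 c * varX2 ^ b)"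
  proof -
    have "(a = 1 \<or> b = 1) \<and> (a = 1 \<longrightarrow> c \<in> S)" if c: "c \<noteq> 0" and Ac: "A = varY2 ^ a - const2 c * varX2 ^ b" for c
    proof
      have r: "rhom \<psi>" and c0: "coeff (\<psi> G) 0 = G" for G using fam by (simp_all add: fam_def)
      show "a = 1 \<or> b = 1"
      proof (rule ccontr)
        assume "\<not> ?thesis"
        then have ge: "a \<ge> 2" "b \<ge> 2" using ab by auto
        have "\<psi> varY2 ^ a - [:const2 c:] * \<psi> varX2 ^ b = [:varY2 ^ a - const2 c * varX2 ^ b:]"
          using Ai unfolding Ac by (simp add: rhom_simps[OF r] fam_inv_const[OF fam])
        from binomial_curve_rigid[OF c0 c0 ab(1) ge c this]
        have "degree (\<psi> varX2) = 0" "degree (\<psi> varY2) = 0" by simp_all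
        then have "\<psi> varX2 = [:varX2:]" "\<psi> varY2 = [:varY2:]"
          using c0 by (metis coeff_pCons_0 degree_eq_zeroE)+
        then show False using fam_not_XY[OF fam] by blast
      qed
      show "a = 1 \<longrightarrow> c \<in> S"
      proof
        assume "a = 1"
        then have "\<psi> (varY2 - const2 c * varX2 ^ b) = [:varY2 - const2 c * varX2 ^ b:]"
          using Ai Ac by (simp only: power_one_right)
        then show "c \<in> S" by (rule fam_binomial_coeff[OF fam S _ ab(3)])
      qed
    qed
    then show ?thesis using A(1) unfolding atoms_def by blast
  qed
  ultimately show ?thesis using am by blast
qed

section \<open>Leading forms of plane automorphisms\<close>

abbreviation "const3 \<equiv> (\<lambda>c. [:const2 c:])"

definition endo :: "('c::comm_ring_1 poly poly \<Rightarrow> 'c poly poly) \<Rightarrow> bool" where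
  "endo \<theta> \<longleftrightarrow> rhom \<theta> \<and> (\<forall>c. \<theta> (const2 c) = const2 c)"

text \<open>The inverse is an explicit argument, and both directions preserve polynomials over
  \<open>S\<close>: these are the automorphisms defined over \<open>S\<close>, although they act
  over the whole field.\<close>

definition autp :: "'c::comm_ring_1 set \<Rightarrow> ('c poly poly \<Rightarrow> 'c poly poly) \<Rightarrow> ('c poly poly \<Rightarrow> 'c poly poly) \<Rightarrow> bool" where
  "autp S \<theta> \<theta>' \<longleftrightarrow> endo \<theta> \<and> endo \<theta>' \<and> (\<forall>F. \<theta> (\<theta>' F) = F) \<and> (\<forall>F. \<theta>' (\<theta> F) = F) \<and>
    (\<forall>F \<in> pset (pset S). \<theta> F \<in> pset (pset S) \<and> \<theta>' F \<in> pset (pset S))"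

lemma endo_rhom: "endo \<theta> \<Longrightarrow> rhom \<theta>"
  and endo_const: "endo \<theta> \<Longrightarrow> \<theta> (const2 c) = const2 c"
  by (simp_all add: endo_def)

lemma endo_eval2: "endo \<theta> \<Longrightarrow> \<theta> F = eval2 const2 (\<theta> varX2) (\<theta> varY2) F"
  using rhom_eq_eval2[of \<theta> F] by (simp add: endo_def)

lemma endo_eval2': assumes "endo \<theta>" shows "\<theta> (eval2 const2 x y F) = eval2 const2 (\<theta> x) (\<theta> y) F"
  using eval2_comp[OF endo_rhom[OF assms] rhom_const2, of x y F] by (simp add: endo_const assms)

lemma endo_eq_id: "endo \<theta> \<Longrightarrow> \<theta> varX2 = varX2 \<Longrightarrow> \<theta> varY2 = varY2 \<Longrightarrow> \<theta> F = F"
  using endo_eval2[of \<theta> F] by (simp add: eval2_id)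

lemma endo_of_eval2: "endo (eval2 const2 x y)"
  by (simp add: endo_def rhom_eval2 rhom_const2 eval2_const)

lemma endo_comp: "endo f \<Longrightarrow> endo g \<Longrightarrow> endo (\<lambda>x. f (g x))"
  by (simp add: endo_def rhom_comp)

lemma autp_sym: "autp S \<theta> \<theta>' \<Longrightarrow> autp S \<theta>' \<theta>"
  by (auto simp: autp_def)

lemma autp_comp: "autp S f f' \<Longrightarrow> autp S g g' \<Longrightarrow> autp S (\<lambda>x. f (g x)) (\<lambda>x. g' (f' x))"
  by (auto simp: autp_def endo_comp)

lemma autpD:
  assumes "autp S \<theta> \<theta>'"
  shows "endo \<theta>" "endo \<theta>'" "\<theta> (\<theta>' F) = F" "\<theta>' (\<theta> F) = F"
    "F \<in> pset (pset S) \<Longrightarrow> \<theta> F \<in> pset (pset S)" "F \<in> pset (pset S) \<Longrightarrow> \<theta>' F \<in> pset (pset S)"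
  using assms by (auto simp: autp_def)

lemma autp_eval2I:
  assumes S: "sring S" and "x \<in> pset (pset S)" "y \<in> pset (pset S)" "x' \<in> pset (pset S)" "y' \<in> pset (pset S)"
    and "eval2 const2 x y x' = varX2" "eval2 const2 x y y' = varY2"
    and "eval2 const2 x' y' x = varX2" "eval2 const2 x' y' y = varY2"
  shows "autp S (eval2 const2 x y) (eval2 const2 x' y')"
  unfolding autp_def
proof (intro conjI allI ballI)
  have e: "endo (\<lambda>F. eval2 const2 x y (eval2 const2 x' y' F))" "endo (\<lambda>F. eval2 const2 x' y' (eval2 const2 x y F))"
    by (rule endo_comp[OF endo_of_eval2 endo_of_eval2])+
  show "eval2 const2 x y (eval2 const2 x' y' F) = F" for F
    by (rule endo_eq_id[OF e(1)]) (simp_all add: eval2_varX eval2_varY rhom_const2 assms(6,7))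
  show "eval2 const2 x' y' (eval2 const2 x y F) = F" for F
    by (rule endo_eq_id[OF e(2)]) (simp_all add: eval2_varX eval2_varY rhom_const2 assms(8,9))
  note S2 = sring_pset[OF sring_pset[OF S]]
  show "eval2 const2 x y F \<in> pset (pset S)" if "F \<in> pset (pset S)" for F
    by (rule eval2_mem[OF rhom_const2 S2 const2_pset[OF S] assms(2,3) that])
  show "eval2 const2 x' y' F \<in> pset (pset S)" if "F \<in> pset (pset S)" for F
    by (rule eval2_mem[OF rhom_const2 S2 const2_pset[OF S] assms(4,5) that])
  show "endo (eval2 const2 x y)" "endo (eval2 const2 x' y')"
    by (rule endo_of_eval2)+
qed

lemma autp_nonzero: "autp S \<theta> \<theta>' \<Longrightarrow> F \<noteq> 0 \<Longrightarrow> \<theta> F \<noteq> 0"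
  by (metis autpD(1,2,4) endo_rhom rhom_0)

text \<open>The translations \<open>Y \<mapsto> Y + t\<close> fix \<open>X\<close>; conjugate them by \<open>\<theta>\<close>.\<close>

lemma autp_fam:
  fixes S :: "'c::field set"
  assumes S: "sring S" and aut: "autp S \<theta> \<theta>'"
  obtains \<psi> where "fam \<psi>" "\<psi> (\<theta> varX2) = [:\<theta> varX2:]"
    "\<psi> varX2 \<in> pset (pset (pset S))" "\<psi> varY2 \<in> pset (pset (pset S))"
proof -
  note r = endo_rhom[OF autpD(1)[OF aut]] endo_rhom[OF autpD(2)[OF aut]]
  define E :: "'c poly poly \<Rightarrow> 'c poly poly poly" where "E = eval2 const3 [:varX2:] [:varY2, 1:]"
  define \<psi> where "\<psi> F = map_poly \<theta> (E (\<theta>' F))" for F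
  have rE: "rhom E" unfolding E_def by (rule rhom_eval2[OF rhom_const3])
  have r\<psi>: "rhom \<psi>"
    unfolding \<psi>_def by (intro rhom_comp[OF rhom_map_poly rhom_comp[OF rE]] r)
  have EX: "E varX2 = [:varX2:]" "E varY2 = [:varY2, 1:]" and Ec: "E (const2 c) = [:const2 c:]" for c
    unfolding E_def by (simp_all add: eval2_varX eval2_varY eval2_const rhom_const3)
  have \<psi>X: "\<psi> (\<theta> varX2) = [:\<theta> varX2:]"
    by (simp add: \<psi>_def autpD[OF aut] EX map_poly_const rhom_0 r)
  have \<psi>Y: "\<psi> (\<theta> varY2) = [:\<theta> varY2, 1:]"
    by (simp add: \<psi>_def autpD[OF aut] EX map_poly_pCons rhom_0 rhom_1 r)
  have \<psi>c: "\<psi> (const2 c) = [:const2 c:]" for c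
    by (simp add: \<psi>_def endo_const autpD[OF aut] Ec map_poly_const rhom_0 r)
  have "coeff (E F) 0 = F" for F
    using rhom_ext2[OF rhom_comp[OF rhom_poly[of 0] rE] rhom_id, of F]
    by (simp add: EX Ec poly_0_coeff_0)
  then have \<psi>0: "coeff (\<psi> F) 0 = F" for F
    by (simp add: \<psi>_def coeff_map_poly rhom_0 r autpD[OF aut])
  have "\<psi> varX2 \<noteq> [:varX2:] \<or> \<psi> varY2 \<noteq> [:varY2:]"
  proof (rule ccontr)
    assume neg: "\<not> ?thesis"
    have "\<psi> F = [:F:]" for F
      by (rule rhom_ext2[OF r\<psi> rhom_const_poly]) (use neg in \<open>simp_all add: \<psi>c\<close>)
    then show False using \<psi>Y by simp
  qed
  then have \<psi>fam: "fam \<psi>"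
    unfolding fam_def using r\<psi> \<psi>c \<psi>0 by simp
  have S3: "\<psi> F \<in> pset (pset (pset S))" if F: "F \<in> pset (pset S)" for F
  proof -
    have "E (\<theta>' F) \<in> pset (pset (pset S))"
      unfolding E_def
      by (rule eval2_mem[OF rhom_const3 _ _ _ _ autpD(6)[OF aut F]])
        (simp_all add: sring_pset S pset_pCons pset_0 varX2_pset varY2_pset const2_pset sring_1)
    then show ?thesis
      unfolding \<psi>_def pset_def[of "pset (pset S)"] using autpD(5)[OF aut]
      by (simp add: coeff_map_poly rhom_0 r)
  qed
  show ?thesis
    by (rule that[OF \<psi>fam \<psi>X S3[OF varX2_pset[OF S]] S3[OF varY2_pset[OF S]]])
qed

lemma finite_max_ratio:
  fixes T :: "(int \<times> nat) set"
  assumes "finite T" "T \<noteq> {}" "\<And>N k. (N, k) \<in> T \<Longrightarrow> k > 0"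
  obtains N0 k0 where "(N0, k0) \<in> T" "k0 > 0" "\<And>N k. (N, k) \<in> T \<Longrightarrow> int k0 * N \<le> int k * N0"
proof -
  define r where "r = (\<lambda>(N, k). of_int N / of_nat k :: rat)"
  have "Max (r ` T) \<in> r ` T" using assms(1,2) by (intro Max_in) simp_all
  then obtain t where t1: "t \<in> T" "r t = Max (r ` T)" by force
  have t: "t \<in> T" "\<And>s. s \<in> T \<Longrightarrow> r s \<le> r t"
    unfolding t1(2) using assms(1) by (auto intro: t1(1))
  obtain N0 k0 where t0: "t = (N0, k0)" by (cases t)
  have k0: "k0 > 0" using assms(3) t t0 by blast
  show ?thesis
  proof (rule that)
    show "(N0, k0) \<in> T" "k0 > 0" using t t0 k0 by simp_all
    fix N k assume N: "(N, k) \<in> T"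
    then have "k > 0" using assms(3) by blast
    moreover have "of_int N / of_nat k \<le> (of_int N0 / of_nat k0 :: rat)"
      using t(2)[OF N] by (simp add: r_def t0)
    ultimately have "of_int N * of_nat k0 \<le> (of_int N0 * of_nat k :: rat)"
      using k0 by (simp add: field_simps)
    then have "of_int (int k0 * N) \<le> (of_int (int k * N0) :: rat)" by (simp add: mult.commute)
    then show "int k0 * N \<le> int k * N0" by (simp only: of_int_le_iff)
  qed
qed

lemma coeff3_finite: "finite {(i, j, k). coeff (coeff (coeff F k) j) i \<noteq> 0}"
proof -
  have "{(i, j, k). coeff (coeff (coeff F k) j) i \<noteq> 0} \<subseteq>
    (\<Union>k\<le>degree F. \<Union>j\<le>degree (coeff F k). \<Union>i\<le>degree (coeff (coeff F k) j). {(i, j, k)})"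
  proof clarify
    fix i j k assume nz: "coeff (coeff (coeff F k) j) i \<noteq> 0"
    then have "coeff (coeff F k) j \<noteq> 0" "coeff F k \<noteq> 0" by auto
    with nz have "i \<le> degree (coeff (coeff F k) j)" "j \<le> degree (coeff F k)" "k \<le> degree F"
      by (simp_all add: le_degree)
    then show "(i, j, k) \<in> (\<Union>k\<le>degree F. \<Union>j\<le>degree (coeff F k). \<Union>i\<le>degree (coeff (coeff F k) j). {(i, j, k)})"
      by blast
  qed
  then show ?thesis by (rule finite_subset) simp
qed

lemma lead_restr3:
  assumes "F \<in> Fil3 a b w d"
  shows "graded.lead (Hm3 a b w) (Fil3 a b w) d F (restr3 (\<lambda>i j k. a * int i + b * int j + w * int k = d) F)"
  unfolding graded.lead_def[OF graded3]
proof
  show "restr3 (\<lambda>i j k. a * int i + b * int j + w * int k = d) F \<in> Hm3 a b w d"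
    by (simp add: Hm3_def coeff_restr3)
  show "F - restr3 (\<lambda>i j k. a * int i + b * int j + w * int k = d) F \<in> Fil3 a b w (d - 1)"
    unfolding Fil3_def mem_Collect_eq
  proof (intro allI impI)
    fix i j k
    assume "coeff (coeff (coeff (F - restr3 (\<lambda>i j k. a * int i + b * int j + w * int k = d) F) k) j) i \<noteq> 0"
    then have "a * int i + b * int j + w * int k \<noteq> d" "coeff (coeff (coeff F k) j) i \<noteq> 0"
      by (auto simp: coeff_restr3 split: if_splits)
    moreover have "a * int i + b * int j + w * int k \<le> d"
      using assms calculation(2) by (simp add: Fil3_def)
    ultimately show "a * int i + b * int j + w * int k \<le> d - 1" by linarith
  qed
qed

text \<open>Weighting \<open>t\<close> so that \<open>\<psi>\<close> has a nontrivial leading part turns the leading form of an invariant into an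
  invariant of a new family.\<close>

lemma fam_newton:
  fixes \<psi> :: "'c::alg_closed_field poly poly \<Rightarrow> _" and a b :: nat
  assumes fam: "fam \<psi>" and inv: "\<psi> f = [:f:]" and S: "sfield S"
    and XY: "\<psi> varX2 \<in> pset (pset (pset S))" "\<psi> varY2 \<in> pset (pset (pset S))"
    and ab: "coprime a b" "a > 0" "b > 0"
    and f: "f \<in> Fil2 (int a) (int b) d" "part (int a) (int b) d f \<noteq> 0" "d > 0"
  shows "\<exists>\<alpha> m. \<alpha> \<noteq> 0 \<and> m > 0 \<and> (part a b d f = const2 \<alpha> * varX2 ^ m \<or> part a b d f = const2 \<alpha> * varY2 ^ m \<or>
    (\<exists>c. c \<noteq> 0 \<and> (a = 1 \<or> b = 1) \<and> (a = 1 \<longrightarrow> c \<in> S) \<and>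
      part a b d f = const2 \<alpha> * (varY2 ^ a - const2 c * varX2 ^ b) ^ m))"
proof -
  define p q where "p = \<psi> varX2" and "q = \<psi> varY2"
  have r: "rhom \<psi>" and c0: "coeff (\<psi> G) 0 = G" for G using fam by (simp_all add: fam_def)
  \<comment> \<open>An entry of \<open>T\<close> records the weight gain of a monomial of
    \<open>\<psi> X\<close> or \<open>\<psi> Y\<close> together with its degree in \<open>t\<close>;
    the maximal ratio \<open>N0 / k0\<close> is the slope of the face to be kept.\<close>
  define T1 T2 where "T1 = {(i, j, k). coeff (coeff (coeff p k) j) i \<noteq> 0 \<and> k > 0}"
    and "T2 = {(i, j, k). coeff (coeff (coeff q k) j) i \<noteq> 0 \<and> k > 0}"
  define T where "T = (\<lambda>(i, j, k). (int a * int i + int b * int j - int a, k)) ` T1 \<union>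
    (\<lambda>(i, j, k). (int a * int i + int b * int j - int b, k)) ` T2"
  have "finite T1" "finite T2"
    unfolding T1_def T2_def
    by (rule finite_subset[OF _ coeff3_finite[of p]], force, rule finite_subset[OF _ coeff3_finite[of q]], force)
  then have T1: "finite T" by (simp add: T_def)
  have T2: "T \<noteq> {}"
  proof
    assume "T = {}"
    then have "T1 = {}" "T2 = {}" by (simp_all add: T_def)
    then have "coeff (coeff (coeff p k) j) i = 0" "coeff (coeff (coeff q k) j) i = 0" if "k > 0" for i j k
      using that unfolding T1_def T2_def by blast+
    then have "coeff p k = 0" "coeff q k = 0" if "k > 0" for k
      using that by (simp_all add: poly_eq_iff)
    then have "p = [:varX2:]" "q = [:varY2:]"
      unfolding p_def q_def using c0 by (intro poly_eqI; auto simp: coeff_const_poly)+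
    then show False using fam_not_XY[OF fam] by (simp add: p_def q_def)
  qed
  have T3: "k > 0" if "(N, k) \<in> T" for N k using that by (auto simp: T_def T1_def T2_def)
  obtain N0 k0 where N0: "(N0, k0) \<in> T" "k0 > 0" "\<And>N k. (N, k) \<in> T \<Longrightarrow> int k0 * N \<le> int k * N0"
    by (rule finite_max_ratio[OF T1 T2 T3]) blast+
  \<comment> \<open>Giving \<open>t\<close> the weight \<open>- N0 / k0\<close> makes the steepest
    monomials exactly as heavy as the variable they deform; scaling by \<open>k0\<close> keeps all
    weights integral.\<close>
  define A B w where "A = int k0 * int a" and "B = int k0 * int b" and "w = - N0"
  interpret g: graded "Hm3 A B w" "Fil3 A B w" "const3 :: 'c \<Rightarrow> _" by (rule graded3)
  define p0 q0 where "p0 = restr3 (\<lambda>i j k. A * int i + B * int j + w * int k = A) p"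
    and "q0 = restr3 (\<lambda>i j k. A * int i + B * int j + w * int k = B) q"
  have pF: "A * int i + B * int j + w * int k \<le> A" if nz: "coeff (coeff (coeff p k) j) i \<noteq> 0" for i j k
  proof (cases "k = 0")
    case True
    then have "i = 1 \<and> j = 0" using nz c0 unfolding p_def by (simp add: coeff_varX split: if_splits)
    then show ?thesis using True by simp
  next
    case False
    then have "(i, j, k) \<in> T1" using nz by (simp add: T1_def)
    then have "(int a * int i + int b * int j - int a, k) \<in> T" unfolding T_def by force
    from N0(3)[OF this] show ?thesis by (simp add: A_def B_def w_def algebra_simps)
  qed
  have qF: "A * int i + B * int j + w * int k \<le> B" if nz: "coeff (coeff (coeff q k) j) i \<noteq> 0" for i j k
  proof (cases "k = 0")
    case True
    then have "i = 0 \<and> j = 1" using nz c0 unfolding q_def by (simp add: coeff_varY split: if_splits)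
    then show ?thesis using True by simp
  next
    case False
    then have "(i, j, k) \<in> T2" using nz by (simp add: T2_def)
    then have "(int a * int i + int b * int j - int b, k) \<in> T" unfolding T_def by force
    from N0(3)[OF this] show ?thesis by (simp add: A_def B_def w_def algebra_simps)
  qed
  have lp: "g.lead A p p0"
    unfolding p0_def by (rule lead_restr3) (simp add: Fil3_def pF)
  have lq: "g.lead B q q0"
    unfolding q0_def by (rule lead_restr3) (simp add: Fil3_def qF)
  define \<phi> where "\<phi> = eval2 const3 p0 q0"
  have r\<phi>: "rhom \<phi>" unfolding \<phi>_def by (rule rhom_eval2[OF rhom_const3])
  have \<phi>X: "\<phi> varX2 = p0" "\<phi> varY2 = q0" and \<phi>c: "\<phi> (const2 c) = [:const2 c:]" for c
    unfolding \<phi>_def by (simp_all add: eval2_varX eval2_varY eval2_const rhom_const3)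
  have p00: "coeff p0 0 = varX2"
    by (rule poly_poly_eqI) (auto simp: p0_def coeff_restr3 p_def c0 coeff_varX)
  have q00: "coeff q0 0 = varY2"
    by (rule poly_poly_eqI) (auto simp: q0_def coeff_restr3 q_def c0 coeff_varY)
  have "fam \<phi>"
    unfolding fam_def
  proof (intro conjI allI r\<phi> \<phi>c)
    show "coeff (\<phi> G) 0 = G" for G
      using rhom_ext2[OF rhom_comp[OF rhom_poly[of 0] r\<phi>] rhom_id, of G]
      by (simp add: \<phi>X \<phi>c poly_0_coeff_0 p00 q00)
    have "(\<exists>i j. (i, j, k0) \<in> T1 \<and> N0 = int a * int i + int b * int j - int a) \<or>
        (\<exists>i j. (i, j, k0) \<in> T2 \<and> N0 = int a * int i + int b * int j - int b)"
      using N0(1) by (auto simp: T_def)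
    then show "\<phi> varX2 \<noteq> [:varX2:] \<or> \<phi> varY2 \<noteq> [:varY2:]"
    proof (elim disjE exE conjE)
      fix i j assume ij: "(i, j, k0) \<in> T1" "N0 = int a * int i + int b * int j - int a"
      have "A * int i + B * int j + w * int k0 = A"
        unfolding A_def B_def w_def ij(2) by (simp add: algebra_simps)
      then have "coeff (coeff (coeff p0 k0) j) i \<noteq> 0"
        using ij(1) by (simp add: T1_def p0_def coeff_restr3)
      moreover have "coeff (coeff (coeff [:varX2:] k0) j) i = (0::'c)"
        using N0(2) by (simp add: coeff_const_poly)
      ultimately have "p0 \<noteq> [:varX2:]" by metis
      then show ?thesis unfolding \<phi>X by blast
    next
      fix i j assume ij: "(i, j, k0) \<in> T2" "N0 = int a * int i + int b * int j - int b"
      have "A * int i + B * int j + w * int k0 = B"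
        unfolding A_def B_def w_def ij(2) by (simp add: algebra_simps)
      then have "coeff (coeff (coeff q0 k0) j) i \<noteq> 0"
        using ij(1) by (simp add: T2_def q0_def coeff_restr3)
      moreover have "coeff (coeff (coeff [:varY2:] k0) j) i = (0::'c)"
        using N0(2) by (simp add: coeff_const_poly)
      ultimately have "q0 \<noteq> [:varY2:]" by metis
      then show ?thesis unfolding \<phi>X by blast
    qed
  qed
  define F where "F = part (int a) (int b) d f"
  have scale: "(A * int i + B * int j = int k0 * d) = (int a * int i + int b * int j = d)"
    "(A * int i + B * int j \<le> int k0 * d) = (int a * int i + int b * int j \<le> d)" for i j
  proof -
    have "A * int i + B * int j = int k0 * (int a * int i + int b * int j)"
      by (simp add: A_def B_def algebra_simps)
    then show "(A * int i + B * int j = int k0 * d) = (int a * int i + int b * int j = d)"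
      "(A * int i + B * int j \<le> int k0 * d) = (int a * int i + int b * int j \<le> d)"
      using N0(2) by simp_all
  qed
  have F': "part A B (int k0 * d) f = F"
    by (rule poly_poly_eqI) (simp add: F_def coeff_part scale)
  have fF: "f \<in> Fil2 A B (int k0 * d)"
    using f(1) by (simp add: Fil2_def scale)
  have l1: "g.lead (int k0 * d) (eval2 const3 p q f) (\<phi> F)"
    using g.lead_eval2[OF fF lp lq] by (simp add: F' \<phi>_def)
  have l2: "eval2 const3 p q f = [:f:]"
    using rhom_eq_eval2[OF r, of f] inv by (simp add: p_def q_def fam_inv_const[OF fam])
  have l3: "g.lead (int k0 * d) [:f:] [:F:]"
    unfolding g.lead_def
  proof
    show "[:F:] \<in> Hm3 A B w (int k0 * d)"
      by (auto simp: Hm3_def coeff_const_poly F'[symmetric] coeff_part)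
    show "[:f:] - [:F:] \<in> Fil3 A B w (int k0 * d - 1)"
      using fF by (force simp: Fil3_def coeff_const_poly F'[symmetric] coeff_part Fil2_def)
  qed
  \<comment> \<open>\<open>l1\<close> and \<open>l3\<close> are leading forms of the same element,
    because \<open>f\<close> is invariant under \<open>\<psi>\<close>.\<close>
  have Finv: "\<phi> F = [:F:]" by (rule g.lead_unique[OF l1[unfolded l2] l3])
  have "p0 \<in> pset (pset (pset S))" "q0 \<in> pset (pset (pset S))"
    using XY sring_0[OF sfield_sring[OF S]] unfolding pset_def p0_def q0_def p_def q_def
    by (simp_all add: coeff_restr3)
  then show ?thesis
    using fam_homogeneous[OF \<open>fam \<phi>\<close> ab _ _ Finv f(3) S] part_Hm2[of a b d f] f(2)
    by (simp add: F_def[symmetric] \<phi>X)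
qed

text \<open>A coordinate is invariant under the translations conjugated by \<open>\<theta>\<close>,
  so for every pair of coprime positive weights its leading form is a power of a single
  atom.\<close>

lemma autp_top_form:
  fixes S :: "'c::alg_closed_field set" and a b :: nat
  assumes "sfield S" "autp S \<theta> \<theta>'" "coprime a b" "a > 0" "b > 0"
    and "\<theta> varX2 \<in> Fil2 (int a) (int b) d" "part (int a) (int b) d (\<theta> varX2) \<noteq> 0" "d > 0"
  shows "\<exists>\<alpha> m. \<alpha> \<noteq> 0 \<and> m > 0 \<and> (part a b d (\<theta> varX2) = const2 \<alpha> * varX2 ^ m \<or>
      part a b d (\<theta> varX2) = const2 \<alpha> * varY2 ^ m \<or>
    (\<exists>c. c \<noteq> 0 \<and> (a = 1 \<or> b = 1) \<and> (a = 1 \<longrightarrow> c \<in> S) \<and>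
      part a b d (\<theta> varX2) = const2 \<alpha> * (varY2 ^ a - const2 c * varX2 ^ b) ^ m))"
proof -
  obtain \<psi> where \<psi>: "fam \<psi>" "\<psi> (\<theta> varX2) = [:\<theta> varX2:]"
    "\<psi> varX2 \<in> pset (pset (pset S))" "\<psi> varY2 \<in> pset (pset (pset S))"
    using autp_fam[OF sfield_sring[OF assms(1)] assms(2)] .
  show ?thesis by (rule fam_newton[OF \<psi>(1,2) assms(1) \<psi>(3,4) assms(3-8)])
qed

section \<open>Leading forms under linear and elementary automorphisms\<close>

abbreviation lead2 :: "int \<Rightarrow> int \<Rightarrow> int \<Rightarrow> 'a::comm_ring_1 poly poly \<Rightarrow> 'a poly poly \<Rightarrow> bool" where
  "lead2 a b \<equiv> graded.lead (Hm2 a b) (Fil2 a b)"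

lemma Hm2_unique_weight:
  assumes "f \<in> Hm2 a b d" "f \<in> Hm2 a b e" "f \<noteq> 0" shows "d = e"
proof -
  obtain i j where "coeff (coeff f j) i \<noteq> 0" using assms(3) by (metis leading_coeff_0_iff)
  then show ?thesis using assms(1,2) unfolding Hm2_def by fastforce
qed

lemma part_of_Hm2: "f \<in> Hm2 a b d \<Longrightarrow> part a b d f = f"
  by (rule poly_poly_eqI) (auto simp: coeff_part Hm2_def)

lemma eval2_lead2:
  assumes "f \<in> Fil2 a' b' d" "lead2 a b a' x x0" "lead2 a b b' y y0"
  shows "lead2 a b d (eval2 const2 x y f) (eval2 const2 x0 y0 (part a' b' d f))"
  by (rule graded.lead_eval2[OF graded2 assms])

lemma endo_graded:
  assumes e: "endo \<theta>" and X: "\<theta> varX2 \<in> Hm2 a b a" and Y: "\<theta> varY2 \<in> Hm2 a b b"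
  shows "f \<in> Fil2 a b d \<Longrightarrow> \<theta> f \<in> Fil2 a b d" "f \<in> Hm2 a b d \<Longrightarrow> \<theta> f \<in> Hm2 a b d"
    "lead2 a b d f f0 \<Longrightarrow> lead2 a b d (\<theta> f) (\<theta> f0)"
proof -
  note g = graded2[where 'a='a and a = a and b = b]
  have *: "lead2 a b d (\<theta> f) (\<theta> (part a b d f))" if "f \<in> Fil2 a b d" for f d
    using eval2_lead2[OF that graded.lead_self[OF g X] graded.lead_self[OF g Y]] endo_eval2[OF e] by metis
  show 1: "\<theta> f \<in> Fil2 a b d" if "f \<in> Fil2 a b d" for f d
    by (rule graded.lead_Fil[OF g *[OF that]])
  show 2: "\<theta> f \<in> Hm2 a b d" if "f \<in> Hm2 a b d" for f d
    using *[OF graded.Hm_Fil[OF g that]] unfolding part_of_Hm2[OF that] graded.lead_def[OF g] by blast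
  show "lead2 a b d (\<theta> f) (\<theta> f0)" if "lead2 a b d f f0"
    using that 1[of "f - f0" "d - 1"] 2[of f0 d] unfolding graded.lead_def[OF g]
    by (simp add: rhom_diff[OF endo_rhom[OF e]])
qed

definition elem :: "'c::comm_ring_1 \<Rightarrow> nat \<Rightarrow> 'c poly poly \<Rightarrow> 'c poly poly" where
  "elem c s = eval2 const2 varX2 (varY2 + const2 c * varX2 ^ s)"

lemma endo_elem: "endo (elem c s)"
  unfolding elem_def by (rule endo_of_eval2)

lemma elem_X [simp]: "elem c s varX2 = varX2"
  and elem_Y [simp]: "elem c s varY2 = varY2 + const2 c * varX2 ^ s"
  and elem_const [simp]: "elem c s (const2 d) = const2 d"
  by (simp_all add: elem_def eval2_varX eval2_varY eval2_const rhom_const2)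

lemmas elem_simps = rhom_simps[OF endo_rhom[OF endo_elem]]

lemma autp_elem: assumes "sring S" "c \<in> S" shows "autp S (elem c s) (elem (- c) s)"
  unfolding elem_def[of c] elem_def[of "- c"]
proof (rule autp_eval2I[OF assms(1)])
  note S2 = sring_pset[OF sring_pset[OF assms(1)]]
  show "varY2 + const2 c * varX2 ^ s \<in> pset (pset S)" "varY2 + const2 (- c) * varX2 ^ s \<in> pset (pset S)"
    using assms by (auto intro!: sring_add[OF S2] sring_mult[OF S2] sring_power[OF S2] varX2_pset varY2_pset const2_pset sring_minus)
qed (simp_all add: rhom_simps[OF rhom_eval2[OF rhom_const2]] eval2_varX eval2_varY eval2_const rhom_const2
  rhom_minus[OF rhom_const2] varX2_pset assms)

lemma linear_Hm2: "const2 u * varX2 + const2 v * varY2 \<in> Hm2 1 1 1"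
proof -
  interpret g: graded "Hm2 1 1" "Fil2 1 1" "const2 :: 'a \<Rightarrow> _" by (rule graded2)
  show ?thesis by (intro g.Hm_add g.Hm_cmult varX_Hm2 varY_Hm2)
qed

text \<open>The last conjunct says that the linear forms \<open>u x + v y\<close> and \<open>u' x + v' y\<close>
  have no common zero.\<close>

lemma linear_autp:
  fixes S :: "'c::field set"
  assumes S: "sfield S" and uv: "u \<in> S" "v \<in> S" "u \<noteq> 0 \<or> v \<noteq> 0"
  obtains \<theta> \<theta>' u' v' where "autp S \<theta> \<theta>'" "\<theta> varX2 = const2 u * varX2 + const2 v * varY2"
    "\<theta> varY2 = const2 u' * varX2 + const2 v' * varY2" "\<theta>' varX2 \<in> Hm2 1 1 1" "\<theta>' varY2 \<in> Hm2 1 1 1"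
    "\<And>\<alpha> \<beta>. u * \<alpha> + v * \<beta> = 0 \<Longrightarrow> u' * \<alpha> + v' * \<beta> = 0 \<Longrightarrow> \<alpha> = 0 \<and> \<beta> = 0"
proof -
  note S1 = sfield_sring[OF S]
  note S2 = sring_pset[OF sring_pset[OF S1]]
  define L where "L w z = const2 w * varX2 + const2 z * varY2" for w z :: 'c
  have LS: "L w z \<in> pset (pset S)" if "w \<in> S" "z \<in> S" for w z
    using that S1 by (auto simp: L_def intro!: sring_add[OF S2] sring_mult[OF S2] varX2_pset varY2_pset const2_pset)
  have LH: "L w z \<in> Hm2 1 1 1" for w z unfolding L_def by (rule linear_Hm2)
  have ev: "eval2 const2 (L p q) (L r t) (L w z) = L (w * p + z * r) (w * q + z * t)" for p q r t w z
    unfolding L_def[of w z]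
    by (simp add: rhom_simps[OF rhom_eval2[OF rhom_const2]] eval2_varX eval2_varY eval2_const rhom_const2)
      (simp add: L_def const2_mult const2_add algebra_simps)
  have L1: "L 1 0 = varX2" "L 0 1 = varY2" by (simp_all add: L_def)
  have evXY: "eval2 const2 x y varX2 = x" "eval2 const2 x y varY2 = y" for x y :: "'c poly poly"
    by (simp_all add: eval2_varX eval2_varY rhom_const2)
  have mem: "0 \<in> S" "1 \<in> S" "inverse u \<in> S" "inverse v \<in> S"
    using S uv S1 by (simp_all add: sring_0 sring_1 sfield_def)
  have "- v / u \<in> S" by (rule sfield_divide[OF S sring_minus[OF S1 uv(2)] uv(1)])
  then have mem2: "- (v / u) \<in> S" "1 / u \<in> S" "1 / v \<in> S" using mem by (simp_all add: divide_inverse)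
  show ?thesis
  proof (cases "u = 0")
    case False
    show ?thesis
    proof (rule that[of "eval2 const2 (L u v) (L 0 1)" "eval2 const2 (L (inverse u) (- v / u)) (L 0 1)" 0 1])
      show "autp S (eval2 const2 (L u v) (L 0 1)) (eval2 const2 (L (inverse u) (- v / u)) (L 0 1))"
        by (rule autp_eval2I[OF S1]) (use False in \<open>simp_all add: LS mem mem2 uv ev L1[symmetric] field_simps\<close>)
    qed (use False in \<open>simp_all add: evXY LH, simp_all add: L_def\<close>)
  next
    case True
    then have v: "v \<noteq> 0" using uv by simp
    show ?thesis
    proof (rule that[of "eval2 const2 (L 0 v) (L 1 0)" "eval2 const2 (L 0 1) (L (inverse v) 0)" 1 0])
      show "autp S (eval2 const2 (L 0 v) (L 1 0)) (eval2 const2 (L 0 1) (L (inverse v) 0))"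
        by (rule autp_eval2I[OF S1]) (use v in \<open>simp_all add: LS mem mem2 uv ev L1[symmetric] field_simps\<close>)
    qed (use v True in \<open>simp_all add: evXY LH, simp_all add: L_def\<close>)
  qed
qed

lemma translation_autp:
  assumes S: "sring S" and w: "w \<in> S"
  shows "autp S (eval2 const2 (varX2 + const2 w) varY2) (eval2 const2 (varX2 - const2 w) varY2)"
proof (rule autp_eval2I[OF S])
  note S2 = sring_pset[OF sring_pset[OF S]]
  show "varX2 + const2 w \<in> pset (pset S)" "varX2 - const2 w \<in> pset (pset S)"
    using S w by (auto intro!: sring_add[OF S2] sring_diff[OF S2] varX2_pset const2_pset)
qed (simp_all add: rhom_simps[OF rhom_eval2[OF rhom_const2]] eval2_varX eval2_varY eval2_const rhom_const2 varY2_pset S)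

lemma supp2_finite: "finite {(i, j). coeff (coeff f j) i \<noteq> 0}"
proof -
  obtain M N where "\<And>i j. coeff (coeff f j) i \<noteq> 0 \<Longrightarrow> i \<le> M \<and> j \<le> N"
    using coeff2_bound[of f] by metis
  then have "{(i, j). coeff (coeff f j) i \<noteq> 0} \<subseteq> {..M} \<times> {..N}" by auto
  then show ?thesis by (rule finite_subset) simp
qed

lemma top_weight:
  assumes "f \<noteq> (0 :: 'a::comm_ring_1 poly poly)"
  obtains d where "f \<in> Fil2 a b d" "part a b d f \<noteq> 0"
proof -
  define T where "T = (\<lambda>(i, j). a * int i + b * int j) ` {(i, j). coeff (coeff f j) i \<noteq> 0}"
  have fin: "finite T" unfolding T_def by (intro finite_imageI supp2_finite)
  obtain i0 j0 where "coeff (coeff f j0) i0 \<noteq> 0" using assms by (metis leading_coeff_0_iff)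
  then have "T \<noteq> {}" by (auto simp: T_def)
  then have "Max T \<in> T" by (rule Max_in[OF fin])
  then obtain i j where ij: "coeff (coeff f j) i \<noteq> 0" "a * int i + b * int j = Max T"
    by (auto simp: T_def)
  have "part a b (Max T) f \<noteq> 0"
  proof
    assume "part a b (Max T) f = 0"
    then have "coeff (coeff (part a b (Max T) f) j) i = 0" by simp
    then show False using ij by (simp add: coeff_part)
  qed
  moreover have "a * int i + b * int j \<in> T" if "coeff (coeff f j) i \<noteq> 0" for i j
    using that by (force simp: T_def)
  then have "f \<in> Fil2 a b (Max T)" using fin by (simp add: Fil2_def)
  ultimately show ?thesis using that by metis
qed

lemma affine_of_low_support:
  fixes f :: "'a::comm_ring_1 poly poly"
  assumes "\<And>i j. coeff (coeff f j) i \<noteq> 0 \<Longrightarrow> j = 0 \<and> i \<le> 1"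
  shows "f = const2 (coeff (coeff f 0) 1) * varX2 + const2 (coeff (coeff f 0) 0)"
proof (rule poly_poly_eqI)
  fix i j
  show "coeff (coeff f j) i =
      coeff (coeff (const2 (coeff (coeff f 0) 1) * varX2 + const2 (coeff (coeff f 0) 0)) j) i"
    using assms[of j i] by (auto simp: coeff_varX coeff_const2 le_Suc_eq)
qed

lemma affine_inverse:
  fixes \<theta> :: "'c::field poly poly \<Rightarrow> _"
  assumes aut: "autp S \<theta> \<theta>'" and "\<theta>' varX2 = const2 \<alpha> * varX2 + const2 \<beta>"
  obtains \<alpha>' \<beta>' where "\<alpha>' \<noteq> 0" "\<theta> varX2 = const2 \<alpha>' * varX2 + const2 \<beta>'"
proof -
  note r = rhom_simps[OF endo_rhom[OF autpD(1)[OF aut]]]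
  have eq: "varX2 = const2 \<alpha> * \<theta> varX2 + const2 \<beta>"
    using arg_cong[OF assms(2), of \<theta>] by (simp add: r autpD[OF aut] endo_const)
  have a0: "\<alpha> \<noteq> 0"
  proof
    assume "\<alpha> = 0"
    then have "coeff (coeff varX2 0) 1 = coeff (coeff (const2 \<beta>) 0) 1" using eq by simp
    then show False by (simp add: coeff_varX coeff_const2)
  qed
  have "\<theta> varX2 = const2 (inverse \<alpha>) * (const2 \<alpha> * \<theta> varX2)"
    using a0 by (simp add: mult.assoc[symmetric] const2_mult[symmetric])
  also have "const2 \<alpha> * \<theta> varX2 = varX2 - const2 \<beta>" using eq by (simp add: algebra_simps)
  also have "const2 (inverse \<alpha>) * (varX2 - const2 \<beta>) = const2 (inverse \<alpha>) * varX2 + const2 (- inverse \<alpha> * \<beta>)"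
    by (simp add: algebra_simps const2_mult rhom_minus[OF rhom_const2])
  finally show ?thesis using that[of "inverse \<alpha>"] a0 by simp
qed

text \<open>The leading form theorem is applied to the inverse \<open>\<theta>'\<close> with weights proportional to the degrees \<open>d1, d2\<close> of
  \<open>\<theta> X, \<theta> Y\<close>: since \<open>X = \<theta>'X(\<theta> X, \<theta> Y)\<close> has low degree, the leading forms are dependent.\<close>

lemma autp_leads:
  fixes S :: "'c::alg_closed_field set" and s :: nat
  assumes S: "sfield S" and aut: "autp S \<theta> \<theta>'" and s: "s > 0"
    and f: "lead2 1 s d1 (\<theta> varX2) f0" "f0 \<noteq> 0" and g: "lead2 1 s d2 (\<theta> varY2) g0" "g0 \<noteq> 0"
    and d: "1 \<le> d1" "d1 \<le> d2" "2 \<le> d2"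
  shows "(\<exists>\<alpha> \<beta>. \<alpha> \<noteq> 0 \<and> \<theta> varX2 = const2 \<alpha> * varX2 + const2 \<beta>) \<or>
    (\<exists>e c. c \<noteq> 0 \<and> d2 = int e * d1 \<and> g0 = const2 c * f0 ^ e)"
proof -
  interpret gr: graded "Hm2 1 (int s)" "Fil2 1 (int s)" "const2 :: 'c \<Rightarrow> _" by (rule graded2)
  define fh where "fh = \<theta>' varX2"
  have "fh \<noteq> 0" unfolding fh_def by (rule autp_nonzero[OF autp_sym[OF aut]]) simp
  then obtain D where D: "fh \<in> Fil2 d1 d2 D" "part d1 d2 D fh \<noteq> 0" using top_weight by blast
  \<comment> \<open>The weights are \<open>d1, d2\<close>. If \<open>D \<le> 1\<close>, then
    \<open>d1 \<ge> 1\<close> and \<open>d2 \<ge> 2\<close> leave only the monomials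
    \<open>1\<close> and \<open>X\<close> in \<open>\<theta>' X\<close>. Otherwise
    \<open>\<theta> fh = X\<close> is lighter than \<open>D\<close>, so the form \<open>F\<close>
    vanishes at \<open>(f0, g0)\<close>.\<close>
  show ?thesis
  proof (cases "D \<le> 1")
    case True
    have "j = 0 \<and> i \<le> 1" if nz: "coeff (coeff fh j) i \<noteq> 0" for i j
    proof -
      have le: "d1 * int i + d2 * int j \<le> 1" using D(1) True nz by (force simp: Fil2_def)
      have "int i \<le> d1 * int i" "2 * int j \<le> d2 * int j"
        using d mult_right_mono[of 1 d1 "int i"] mult_right_mono[of 2 d2 "int j"] by simp_all
      then show ?thesis using le by linarith
    qed
    from affine_of_low_support[OF this] obtain \<alpha> \<beta> where "\<theta>' varX2 = const2 \<alpha> * varX2 + const2 \<beta>"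
      unfolding fh_def by blast
    from affine_inverse[OF aut this] show ?thesis by blast
  next
    case False
    define F where "F = part d1 d2 D fh"
    have "gr.lead D (\<theta> fh) (eval2 const2 f0 g0 F)"
      using eval2_lead2[OF D(1) f(1) g(1)] endo_eval2[OF autpD(1)[OF aut], of fh] by (simp add: F_def)
    moreover have "\<theta> fh \<in> Fil2 1 (int s) 1"
      using gr.Hm_Fil[OF varX_Hm2] by (simp add: fh_def autpD[OF aut])
    ultimately have F0: "eval2 const2 f0 g0 F = 0"
      by (rule gr.lead_Fil_lower) (use False in simp)
    \<comment> \<open>Division by the gcd makes the weights coprime, as \<open>autp_top_form\<close>
      demands.\<close>
    define G where "G = gcd d1 d2"
    define a b where "a = nat (d1 div G)" and "b = nat (d2 div G)"
    have G0: "G > 0" using d by (simp add: G_def)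
    have dd: "d1 = G * int a" "d2 = G * int b"
      unfolding a_def b_def using d G0 by (simp_all add: G_def pos_imp_zdiv_nonneg_iff)
    have ab0: "a > 0" "b > 0" using d dd by (auto intro!: Nat.gr0I)
    have "coprime (d1 div G) (d2 div G)" unfolding G_def using d by (intro div_gcd_coprime) simp
    moreover have "d1 div G = int a" "d2 div G = int b"
      using dd G0 by (metis less_irrefl nonzero_mult_div_cancel_left)+
    ultimately have cop: "coprime a b" by (simp only: coprime_int_iff)
    have "F \<noteq> 0" using D(2) by (simp add: F_def)
    then obtain i j where "coeff (coeff F j) i \<noteq> 0" by (metis leading_coeff_0_iff)
    then have "d1 * int i + d2 * int j = D" by (auto simp: F_def coeff_part split: if_splits)
    then obtain D' where D': "D = G * D'" unfolding dd by (metis distrib_left mult.assoc)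
    have scale: "(d1 * int i + d2 * int j = D) = (int a * int i + int b * int j = D')"
      "(d1 * int i + d2 * int j \<le> D) = (int a * int i + int b * int j \<le> D')" for i j
    proof -
      have "d1 * int i + d2 * int j = G * (int a * int i + int b * int j)"
        unfolding dd by (simp add: algebra_simps)
      then show "(d1 * int i + d2 * int j = D) = (int a * int i + int b * int j = D')"
        "(d1 * int i + d2 * int j \<le> D) = (int a * int i + int b * int j \<le> D')"
        using G0 D' by simp_all
    qed
    have Fp: "part (int a) (int b) D' (\<theta>' varX2) = F"
      by (rule poly_poly_eqI) (simp add: F_def coeff_part scale fh_def)
    have Ff: "\<theta>' varX2 \<in> Fil2 (int a) (int b) D'"
      using D(1) by (simp add: Fil2_def scale fh_def)
    have "D' > 0" using False D' G0 by (smt (verit) mult_nonneg_nonpos)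
    have ev: "eval2 const2 f0 g0 varX2 = f0" "eval2 const2 f0 g0 varY2 = g0" "eval2 const2 f0 g0 (const2 k) = const2 k" for k
      by (simp_all add: eval2_varX eval2_varY eval2_const rhom_const2)
    note evs = rhom_simps[OF rhom_eval2[OF rhom_const2], of f0 g0] ev
    obtain \<alpha> m where am: "\<alpha> \<noteq> 0" "m > 0" "F = const2 \<alpha> * varX2 ^ m \<or> F = const2 \<alpha> * varY2 ^ m \<or>
      (\<exists>c. c \<noteq> 0 \<and> (a = 1 \<or> b = 1) \<and> (a = 1 \<longrightarrow> c \<in> S) \<and> F = const2 \<alpha> * (varY2 ^ a - const2 c * varX2 ^ b) ^ m)"
      using autp_top_form[OF S autp_sym[OF aut] cop ab0 Ff _ \<open>D' > 0\<close>] unfolding Fp using \<open>F \<noteq> 0\<close> by blast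
    \<comment> \<open>Pure powers do not vanish at nonzero \<open>f0, g0\<close>. What remains is
      the binomial, and its vanishing at \<open>(f0, g0)\<close> is the claimed dependence;
      \<open>a \<le> b\<close> decides which exponent is \<open>1\<close>.\<close>
    have n1: "F \<noteq> const2 \<alpha> * varX2 ^ m" using F0 am(1) f(2) by (auto simp: evs)
    have n2: "F \<noteq> const2 \<alpha> * varY2 ^ m" using F0 am(1) g(2) by (auto simp: evs)
    obtain c where c: "c \<noteq> 0" "a = 1 \<or> b = 1" "F = const2 \<alpha> * (varY2 ^ a - const2 c * varX2 ^ b) ^ m"
      using am(3) n1 n2 by blast
    have "g0 ^ a - const2 c * f0 ^ b = 0"
      using F0 am(1) unfolding c(3) by (simp add: evs)
    moreover have "a \<le> b" using d(2) dd G0 by simp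
    then have "a = 1" using c(2) ab0 by auto
    ultimately have "g0 = const2 c * f0 ^ b" by simp
    moreover have "d2 = int b * d1" using dd \<open>a = 1\<close> by simp
    ultimately show ?thesis using c(1) by blast
  qed
qed

lemma autp_not_const: assumes "autp S \<theta> \<theta>'" shows "\<theta> varX2 \<noteq> const2 (k :: 'c::field)"
proof
  assume "\<theta> varX2 = const2 k"
  then have "varX2 = const2 k" using autpD(4)[OF assms, of varX2] endo_const[OF autpD(2)[OF assms]] by metis
  then have "coeff (coeff varX2 0) 1 = coeff (coeff (const2 k) 0) 1" by simp
  then show False by (simp add: coeff_varX coeff_const2)
qed

lemma const2_of_Fil2:
  assumes "f \<in> Fil2 a b 0" "a > 0" "b > 0" shows "f = const2 (coeff (coeff f 0) 0)"
proof (rule poly_poly_eqI)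
  fix i j
  have "i = 0 \<and> j = 0" if "coeff (coeff f j) i \<noteq> 0"
  proof -
    have "a * int i + b * int j \<le> 0" using assms(1) that by (simp add: Fil2_def)
    moreover have "int i \<le> a * int i" "int j \<le> b * int j"
      using assms mult_right_mono[of 1 a "int i"] mult_right_mono[of 1 b "int j"] by simp_all
    ultimately show ?thesis by linarith
  qed
  then show "coeff (coeff f j) i = coeff (coeff (const2 (coeff (coeff f 0) 0)) j) i"
    by (auto simp: coeff_const2)
qed

text \<open>For \<open>u = \<theta>' X\<close> of total degree \<open>D > 0\<close>, the identity
  \<open>X = \<phi>(u)\<close> forces \<open>D * degree \<phi> \<le> 1\<close>.\<close>

lemma autp_X_only:
  fixes \<theta> :: "'c::field poly poly \<Rightarrow> _"
  assumes aut: "autp S \<theta> \<theta>'" and f: "\<theta> varX2 = [:\<phi>:]"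
  shows "degree \<phi> = 1"
proof -
  interpret gr: graded "Hm2 1 1" "Fil2 1 1" "const2 :: 'c \<Rightarrow> _" by (rule graded2)
  define u where "u = \<theta>' varX2"
  have "u \<noteq> 0" unfolding u_def by (rule autp_nonzero[OF autp_sym[OF aut]]) simp
  then obtain D where D: "u \<in> Fil2 1 1 D" "part 1 1 D u \<noteq> 0" using top_weight by blast
  have D0: "D > 0"
  proof (rule ccontr)
    assume "\<not> D > 0"
    then have "u \<in> Fil2 1 1 0" using gr.Fil_mono[OF D(1)] by simp
    then show False using const2_of_Fil2[of u 1 1] autp_not_const[OF autp_sym[OF aut]] by (simp add: u_def)
  qed
  define n where "n = degree \<phi>"
  have ph: "\<phi> \<noteq> 0" using autp_nonzero[OF aut, of varX2] f by auto
  have n0: "n > 0"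
  proof (rule ccontr)
    assume "\<not> n > 0"
    then obtain k where "\<phi> = [:k:]" unfolding n_def by (metis degree_eq_zeroE not_gr_zero)
    then show False using autp_not_const[OF aut, of k] f by (simp add: const2_def)
  qed
  \<comment> \<open>\<open>\<phi>\<close> does not involve \<open>Y\<close>, so \<open>Y\<close> may
    be replaced by \<open>0\<close> and given weight \<open>0\<close>.\<close>
  have 1: "[:\<phi>:] \<in> Fil2 D 0 (D * int n)"
    using D0 by (auto simp: Fil2_def coeff_const_poly n_def le_degree split: if_splits)
  have p: "part D 0 (D * int n) [:\<phi>:] = const2 (coeff \<phi> n) * varX2 ^ n"
    by (rule poly_poly_eqI) (use D0 in \<open>auto simp: coeff_part coeff_const_poly coeff_varX_power\<close>)
  have "gr.lead (D * int n) (eval2 const2 u 0 [:\<phi>:]) (eval2 const2 (part 1 1 D u) 0 (const2 (coeff \<phi> n) * varX2 ^ n))"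
    using eval2_lead2[OF 1 lead_part[OF D(1)] gr.lead_self[OF gr.Hm_0]] by (simp add: p)
  moreover have "eval2 const2 u 0 [:\<phi>:] = varX2"
  proof -
    have "eval2 const2 u 0 [:\<phi>:] = eval2 const2 u (\<theta>' varY2) [:\<phi>:]"
      by (simp add: eval2_def map_poly_pCons)
    also have "\<dots> = \<theta>' (\<theta> varX2)"
      using endo_eval2[OF autpD(2)[OF aut], of "\<theta> varX2"] by (simp add: f u_def)
    finally show ?thesis by (simp add: autpD[OF aut])
  qed
  moreover have "eval2 const2 (part 1 1 D u) 0 (const2 (coeff \<phi> n) * varX2 ^ n) = const2 (coeff \<phi> n) * part 1 1 D u ^ n"
    by (simp add: rhom_simps[OF rhom_eval2[OF rhom_const2]] eval2_varX eval2_const rhom_const2)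
  ultimately have L: "gr.lead (D * int n) varX2 (const2 (coeff \<phi> n) * part 1 1 D u ^ n)" by simp
  have "\<not> 1 < D * int n"
  proof
    assume "1 < D * int n"
    then have "const2 (coeff \<phi> n) * part 1 1 D u ^ n = 0"
      using gr.lead_Fil_lower[OF L gr.Hm_Fil[OF varX_Hm2]] by simp
    then show False using D(2) ph by (simp add: n_def)
  qed
  moreover have "int n \<le> D * int n" using D0 mult_right_mono[of 1 D "int n"] by simp
  ultimately have "int n \<le> 1" by linarith
  then show ?thesis using n0 n_def by simp
qed

text \<open>The edge of the Newton polygon of \<open>\<theta> X\<close> that ends at the vertex \<open>X\<^bsup>d0\<^esup>\<close>.\<close>

lemma autp_pure_power_edge:
  fixes S :: "'c::alg_closed_field set"
  assumes S: "sfield S" and aut: "autp S \<theta> \<theta>'" and d0: "d0 \<ge> 2"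
    and f: "lead2 1 1 (int d0) (\<theta> varX2) (const2 \<alpha>1 * varX2 ^ d0)" "\<alpha>1 \<noteq> 0"
  obtains s m c \<alpha> where "s \<ge> 2" "m \<ge> 1" "c \<noteq> 0" "c \<in> S" "\<alpha> \<noteq> 0" "d0 = s * m"
    "lead2 1 (int s) (int d0) (\<theta> varX2) (const2 \<alpha> * (varY2 - const2 c * varX2 ^ s) ^ m)"
proof -
  define F where "F = \<theta> varX2"
  have sm: "i + j < d0" if nz: "coeff (coeff F j) i \<noteq> 0" and "\<not> (i = d0 \<and> j = 0)" for i j
  proof -
    have "F - const2 \<alpha>1 * varX2 ^ d0 \<in> Fil2 1 1 (int d0 - 1)"
      using f(1) by (simp add: graded.lead_def[OF graded2] F_def)
    moreover have "coeff (coeff (F - const2 \<alpha>1 * varX2 ^ d0) j) i \<noteq> 0"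
      using that by (auto simp: coeff_varX_power)
    ultimately have "1 * int i + 1 * int j \<le> int d0 - 1" unfolding Fil2_def by blast
    then show ?thesis by linarith
  qed
  have top: "coeff (coeff F 0) d0 = \<alpha>1"
  proof (rule ccontr)
    assume neq: "coeff (coeff F 0) d0 \<noteq> \<alpha>1"
    have "F - const2 \<alpha>1 * varX2 ^ d0 \<in> Fil2 1 1 (int d0 - 1)"
      using f(1) by (simp add: graded.lead_def[OF graded2] F_def)
    moreover have "coeff (coeff (F - const2 \<alpha>1 * varX2 ^ d0) 0) d0 \<noteq> 0"
      using neq by (simp add: coeff_varX_power)
    ultimately have "1 * int d0 + 1 * int 0 \<le> int d0 - 1" unfolding Fil2_def by blast
    then show False by simp
  qed
  define T where "T = (\<lambda>(i, j). (int i - int d0, j)) ` {(i, j). coeff (coeff F j) i \<noteq> 0 \<and> j > 0}"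
  have "{(i, j). coeff (coeff F j) i \<noteq> 0 \<and> j > 0} \<subseteq> {(i, j). coeff (coeff F j) i \<noteq> 0}" by auto
  then have T1: "finite T" unfolding T_def by (intro finite_imageI finite_subset[OF _ supp2_finite])
  \<comment> \<open>Without a monomial involving \<open>Y\<close>, \<open>\<theta> X\<close> would
    be a polynomial in \<open>X\<close> of degree at least \<open>d0 \<ge> 2\<close>, contradicting
    \<open>autp_X_only\<close>.\<close>
  have T2: "T \<noteq> {}"
  proof
    assume "T = {}"
    then have "coeff (coeff F j) i = 0" if "j > 0" for i j using that by (auto simp: T_def)
    then have "F = [:coeff F 0:]"
      by (intro poly_poly_eqI) (auto simp: coeff_const_poly)
    then have "degree (coeff F 0) = 1" using autp_X_only[OF aut] unfolding F_def by blast
    moreover have "d0 \<le> degree (coeff F 0)" using top f(2) by (simp add: le_degree)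
    ultimately show False using d0 by simp
  qed
  have T3: "k > 0" if "(N, k) \<in> T" for N k using that by (auto simp: T_def)
  obtain N0 k0 where N0: "(N0, k0) \<in> T" "k0 > 0" "\<And>N k. (N, k) \<in> T \<Longrightarrow> int k0 * N \<le> int k * N0"
    by (rule finite_max_ratio[OF T1 T2 T3]) blast+
  obtain i0 where i0: "coeff (coeff F k0) i0 \<noteq> 0" "N0 = int i0 - int d0" using N0(1) by (auto simp: T_def)
  have lt: "i0 + k0 < d0" using sm[OF i0(1)] N0(2) by simp
  define G where "G = gcd k0 (d0 - i0)"
  define a b where "a = k0 div G" and "b = (d0 - i0) div G"
  have G0: "G > 0" using N0(2) by (simp add: G_def)
  have ab: "k0 = G * a" "d0 - i0 = G * b" unfolding a_def b_def G_def by simp_all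
  have cop: "coprime a b" unfolding a_def b_def G_def using N0(2) by (intro div_gcd_coprime) simp
  have a0: "a > 0" using ab N0(2) by (auto intro: Nat.gr0I)
  have "G * a < G * b" using lt ab by linarith
  then have ab_lt: "a < b" by simp
  then have b0: "b > 0" by simp
  have supp: "a * i + b * j \<le> a * d0" if nz: "coeff (coeff F j) i \<noteq> 0" for i j
  proof (cases "j = 0")
    case True
    then have "i \<le> d0" using sm[OF nz] by (cases "i = d0") auto
    then show ?thesis using True by simp
  next
    case False
    then have "(int i - int d0, j) \<in> T" using nz by (force simp: T_def)
    from N0(3)[OF this] have 1: "int k0 * (int i - int d0) \<le> int j * (int i0 - int d0)" by (simp add: i0(2))
    have e: "int d0 - int i0 = int (G * b)" "int k0 = int (G * a)" using ab lt by linarith+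
    have "int j * (int i0 - int d0) = - (int j * (int d0 - int i0))" by (simp add: algebra_simps)
    then have "int (G * a) * (int i - int d0) \<le> - (int j * int (G * b))" using 1 by (simp only: e)
    then have "int (G * (a * i + b * j)) \<le> int (G * (a * d0))" by (simp add: algebra_simps)
    then show ?thesis using G0 by (simp only: of_nat_le_iff mult_le_cancel1)
  qed
  have eq0: "a * i0 + b * k0 = a * d0"
  proof -
    have "G * (a * i0 + b * k0) = k0 * i0 + (d0 - i0) * k0" unfolding ab(2)
      by (subst (2) ab(1)) (simp add: algebra_simps)
    also have "\<dots> = k0 * d0" using lt by (simp add: algebra_simps diff_mult_distrib)
    also have "\<dots> = G * (a * d0)" using ab(1) by simp
    finally show ?thesis using G0 by simp
  qed
  define P where "P = part (int a) (int b) (int (a * d0)) F"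
  have wt: "(int a * int i + int b * int j = int (a * d0)) = (a * i + b * j = a * d0)"
    "(int a * int i + int b * int j \<le> int (a * d0)) = (a * i + b * j \<le> a * d0)" for i j
    by (metis of_nat_add of_nat_eq_iff of_nat_mult, metis of_nat_add of_nat_le_iff of_nat_mult)
  have cP: "coeff (coeff P j) i = (if a * i + b * j = a * d0 then coeff (coeff F j) i else 0)" for i j
    by (simp only: P_def coeff_part wt)
  have P1: "coeff (coeff P 0) d0 \<noteq> 0" using top f(2) by (simp add: cP)
  have P2: "coeff (coeff P k0) i0 \<noteq> 0" using i0 eq0 by (simp add: cP)
  have Pn: "P \<noteq> 0" using P1 by auto
  have FF: "F \<in> Fil2 (int a) (int b) (int (a * d0))"
    unfolding Fil2_def mem_Collect_eq wt using supp by blast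
  have "int (a * d0) > 0" using a0 d0 by simp
  then obtain \<alpha> m where am: "\<alpha> \<noteq> 0" "m > 0" "P = const2 \<alpha> * varX2 ^ m \<or> P = const2 \<alpha> * varY2 ^ m \<or>
      (\<exists>c. c \<noteq> 0 \<and> (a = 1 \<or> b = 1) \<and> (a = 1 \<longrightarrow> c \<in> S) \<and> P = const2 \<alpha> * (varY2 ^ a - const2 c * varX2 ^ b) ^ m)"
    using autp_top_form[OF S aut cop a0 b0 FF[unfolded F_def]] Pn unfolding P_def F_def by blast
  \<comment> \<open>\<open>P\<close> contains both ends of the edge, \<open>X^d0\<close> and a
    monomial involving \<open>Y\<close>, so it is no pure power. As \<open>X^d0\<close> dominates in
    total degree, \<open>a < b\<close>, and the weight equal to \<open>1\<close> is
    \<open>a\<close>.\<close>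
  have "P \<noteq> const2 \<alpha> * varX2 ^ m" using P2 N0(2) by (auto simp: coeff_varX_power)
  moreover have "P \<noteq> const2 \<alpha> * varY2 ^ m" using P1 d0 by (auto simp: coeff_varY_power)
  ultimately obtain c where c: "c \<noteq> 0" "a = 1 \<or> b = 1" "a = 1 \<longrightarrow> c \<in> S"
    "P = const2 \<alpha> * (varY2 ^ a - const2 c * varX2 ^ b) ^ m" using am(3) by blast
  have a1: "a = 1" using c(2) ab_lt a0 by auto
  have P: "P = const2 \<alpha> * (varY2 - const2 c * varX2 ^ b) ^ m" using c(4) a1 by simp
  interpret gr: graded "Hm2 1 (int b)" "Fil2 1 (int b)" "const2 :: 'c \<Rightarrow> _" by (rule graded2)
  have "varY2 - const2 c * varX2 ^ b \<in> Hm2 1 (int b) (int b)" using binomial_Hm2[of 1 c b] by simp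
  from gr.Hm_cmult[OF gr.Hm_power[OF this, of m], of \<alpha>] have "P \<in> Hm2 1 (int b) (int m * int b)"
    by (simp add: P)
  moreover have "P \<in> Hm2 1 (int b) (int d0)" using part_Hm2[of "int a" "int b" "int (a * d0)" F] a1 by (simp add: P_def)
  ultimately have "int m * int b = int d0" using Hm2_unique_weight Pn by blast
  then have dm: "d0 = b * m" by (metis mult.commute of_nat_eq_iff of_nat_mult)
  have "gr.lead (int d0) F P" using lead_part[OF FF] a1 by (simp add: P_def)
  then show ?thesis
    using that[of b m c \<alpha>] ab_lt a1 am c dm P by (simp add: F_def)
qed

text \<open>\<open>Y^m\<close> has total degree only \<open>m < s m\<close>, and every other
  monomial has weight, hence total degree, below \<open>s m\<close>. So straightening an edge
  \<open>(Y - c X^s)^m\<close> to \<open>Y^m\<close> lowers the degree.\<close>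

lemma low_degree_after_shear:
  assumes "lead2 1 (int s) (int (s * m)) h (const2 \<alpha> * varY2 ^ m)" "s \<ge> 2" "m \<ge> 1"
  shows "h \<in> Fil2 1 1 (int (s * m) - 1)"
  unfolding Fil2_def mem_Collect_eq
proof (intro allI impI)
  fix i j assume nz: "coeff (coeff h j) i \<noteq> 0"
  show "1 * int i + 1 * int j \<le> int (s * m) - 1"
  proof (cases "i = 0 \<and> j = m")
    case True
    have "2 * m \<le> s * m" using assms(2) by simp
    then show ?thesis using True assms(3) by simp
  next
    case False
    have "h - const2 \<alpha> * varY2 ^ m \<in> Fil2 1 (int s) (int (s * m) - 1)"
      using assms(1) by (simp add: graded.lead_def[OF graded2])
    moreover have "coeff (coeff (h - const2 \<alpha> * varY2 ^ m) j) i \<noteq> 0"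
      using nz False by (auto simp: coeff_varY_power)
    ultimately have "1 * int i + int s * int j \<le> int (s * m) - 1" unfolding Fil2_def by blast
    moreover have "1 * int j \<le> int s * int j" using assms(2) by (intro mult_right_mono) simp_all
    ultimately show ?thesis by linarith
  qed
qed

text \<open>A weight of \<open>Y\<close> below the slope of the edge sees only the vertex
  \<open>X^d\<close>.\<close>

lemma lead_flatter:
  assumes F: "F \<in> Fil2 1 (int s) (int d)" and e: "e < s" and top: "coeff (coeff F 0) d = \<alpha>"
  shows "lead2 1 (int e) (int d) F (const2 \<alpha> * varX2 ^ d)"
  unfolding graded.lead_def[OF graded2]
proof
  show "const2 \<alpha> * varX2 ^ d \<in> Hm2 1 (int e) (int d)"
    by (auto simp: Hm2_def coeff_varX_power)
  show "F - const2 \<alpha> * varX2 ^ d \<in> Fil2 1 (int e) (int d - 1)"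
    unfolding Fil2_def mem_Collect_eq
  proof (intro allI impI)
    fix i j assume nz: "coeff (coeff (F - const2 \<alpha> * varX2 ^ d) j) i \<noteq> 0"
    then have n: "coeff (coeff F j) i \<noteq> 0" "\<not> (i = d \<and> j = 0)"
      using top by (auto simp: coeff_varX_power split: if_splits)
    then have le: "1 * int i + int s * int j \<le> int d" using F unfolding Fil2_def by blast
    show "1 * int i + int e * int j \<le> int d - 1"
    proof (cases "j = 0")
      case True
      then show ?thesis using le n by simp
    next
      case False
      have "(int e + 1) * int j \<le> int s * int j" using e by (intro mult_right_mono) simp_all
      then show ?thesis using le False by (simp add: algebra_simps)
    qed
  qed
qed

lemma eval2_Y0:
  fixes F :: "'a::comm_ring_1 poly poly"
  shows "eval2 const2 varX2 0 F = [:coeff F 0:]"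
proof -
  have r: "rhom (\<lambda>F :: 'a poly poly. [:coeff F 0:])"
    using rhom_comp[OF rhom_const_poly rhom_poly[of 0]] by (simp add: poly_0_coeff_0)
  show ?thesis
    by (rule rhom_ext2[OF rhom_eval2[OF rhom_const2] r])
      (simp_all add: eval2_varX eval2_varY eval2_const rhom_const2, simp_all add: varX2_def varY2_def const2_def)
qed

lemma elem_Hm2:
  fixes c :: "'a::comm_ring_1"
  shows "elem c s varX2 \<in> Hm2 1 (int s) 1" "elem c s varY2 \<in> Hm2 1 (int s) (int s)"
proof -
  interpret g: graded "Hm2 1 (int s)" "Fil2 1 (int s)" "const2 :: 'a \<Rightarrow> _" by (rule graded2)
  have "(varX2 :: 'a poly poly) ^ s \<in> Hm2 1 (int s) (int s)" using g.Hm_power[OF varX_Hm2, of s] by simp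
  then show "elem c s varY2 \<in> Hm2 1 (int s) (int s)"
    unfolding elem_Y by (intro g.Hm_add g.Hm_cmult varY_Hm2)
  show "elem c s varX2 \<in> Hm2 1 (int s) 1" by (simp add: varX_Hm2)
qed

section \<open>Automorphisms of finite order\<close>

text \<open>Dependence of leading forms gives \<open>\<sigma> X\<close> the leading form
  \<open>\<alpha> X^m0\<close> with \<open>D = e m0\<close>. At this vertex
  \<open>\<sigma> X\<close> has an edge \<open>h^m\<close> with \<open>h = Y - k X^s\<close>, and
  \<open>\<sigma> Y\<close> has the edge \<open>h^(m e)\<close>, up to constants. If
  \<open>s \<le> e\<close>, conjugation by an elementary map of exponent \<open>s\<close>
  straightens both edges; otherwise one of exponent \<open>e\<close> cancels the top of
  \<open>\<sigma> Y\<close>.\<close>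

lemma conjugate_of_lower_degree:
  fixes S :: "'c::alg_closed_field set"
  assumes S: "sfield S" and aut: "autp S \<sigma> \<sigma>'" and D: "D \<ge> 2"
    and f: "\<sigma> varX2 \<in> Fil2 1 1 (int D - 1)"
    and g: "lead2 1 1 (int D) (\<sigma> varY2) (const2 \<beta> * varX2 ^ D)" "\<beta> \<noteq> 0"
  shows "(\<exists>\<alpha> \<gamma>. \<alpha> \<noteq> 0 \<and> \<sigma> varX2 = const2 \<alpha> * varX2 + const2 \<gamma>) \<or>
    (\<exists>\<tau> \<tau>'. autp S \<tau> \<tau>' \<and> \<tau>' (\<sigma> (\<tau> varX2)) \<in> Fil2 1 1 (int D - 1) \<and> \<tau>' (\<sigma> (\<tau> varY2)) \<in> Fil2 1 1 (int D - 1))"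
proof (rule ccontr)
  assume neg: "\<not> ?thesis"
  then have naff: "\<not> (\<exists>\<alpha> \<gamma>. \<alpha> \<noteq> 0 \<and> \<sigma> varX2 = const2 \<alpha> * varX2 + const2 \<gamma>)"
    and nred: "\<And>\<tau> \<tau>'. autp S \<tau> \<tau>' \<Longrightarrow> \<tau>' (\<sigma> (\<tau> varX2)) \<in> Fil2 1 1 (int D - 1) \<Longrightarrow>
      \<tau>' (\<sigma> (\<tau> varY2)) \<in> Fil2 1 1 (int D - 1) \<Longrightarrow> False" by blast+
  interpret g1: graded "Hm2 1 1" "Fil2 1 1" "const2 :: 'c \<Rightarrow> _" by (rule graded2)
  note S1 = sfield_sring[OF S]
  note r\<sigma> = rhom_simps[OF endo_rhom[OF autpD(1)[OF aut]]]
  define F G where "F = \<sigma> varX2" and "G = \<sigma> varY2"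
  have Fn: "F \<noteq> 0" "G \<noteq> 0" unfolding F_def G_def by (rule autp_nonzero[OF aut], simp)+
  obtain d1 where d1: "F \<in> Fil2 1 1 d1" "part 1 1 d1 F \<noteq> 0" using top_weight[OF Fn(1)] .
  note lF = lead_part[OF d1(1)]
  have d1D: "d1 \<le> int D - 1"
    using g1.lead_Fil_lower[OF lF f[folded F_def]] d1(2) by linarith
  have d1_1: "d1 \<ge> 1"
  proof (rule ccontr)
    assume "\<not> d1 \<ge> 1"
    then have "F \<in> Fil2 1 1 0" using g1.Fil_mono[OF d1(1)] by simp
    from const2_of_Fil2[OF this] show False using autp_not_const[OF aut] by (simp add: F_def)
  qed
  have Xn: "const2 \<beta> * varX2 ^ D \<noteq> 0" using g(2) by simp
  obtain e c where ec: "c \<noteq> 0" "int D = int e * d1" "const2 \<beta> * varX2 ^ D = const2 c * part 1 1 d1 F ^ e"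
    using autp_leads[OF S aut, of 1 d1 "part 1 1 d1 F" "int D" "const2 \<beta> * varX2 ^ D"] lF d1(2) g(1) Xn d1_1 d1D D naff
    by (auto simp: F_def)
  have e0: "e > 0" using ec(2) D by (intro Nat.gr0I) simp
  obtain \<alpha> m0 where am: "\<alpha> \<noteq> 0" "m0 > 0" "part 1 1 d1 F = const2 \<alpha> * varX2 ^ m0 \<or> part 1 1 d1 F = const2 \<alpha> * varY2 ^ m0 \<or>
      (\<exists>k. k \<noteq> 0 \<and> part 1 1 d1 F = const2 \<alpha> * (varY2 - const2 k * varX2) ^ m0)"
    using autp_top_form[OF S aut, of 1 1 d1] d1 d1_1 unfolding F_def by auto
  \<comment> \<open>Setting \<open>X = 0\<close> tests divisibility by \<open>X\<close>: among the
    possible leading forms of \<open>F\<close> only a power of \<open>X\<close> is compatible with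
    \<open>\<beta> X^D\<close>.\<close>
  define \<epsilon> where "\<epsilon> = eval2 const2 (0 :: 'c poly poly) varY2"
  have \<epsilon>: "rhom \<epsilon>" "\<epsilon> varX2 = 0" "\<epsilon> varY2 = varY2" "\<epsilon> (const2 k) = const2 k" for k
    by (simp_all add: \<epsilon>_def eval2_varX eval2_varY eval2_const rhom_const2 rhom_eval2)
  have "\<epsilon> (const2 c * part 1 1 d1 F ^ e) = 0"
    unfolding ec(3)[symmetric] using D by (simp add: rhom_simps[OF \<epsilon>(1)] \<epsilon>)
  then have "\<epsilon> (part 1 1 d1 F) = 0" using ec(1) e0 by (simp add: rhom_simps[OF \<epsilon>(1)] \<epsilon>)
  then have top: "part 1 1 d1 F = const2 \<alpha> * varX2 ^ m0"
    using am by (auto simp: rhom_simps[OF \<epsilon>(1)] \<epsilon>)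
  have "(varX2 :: 'c poly poly) ^ m0 \<in> Hm2 1 1 (int m0 * 1)" by (rule g1.Hm_power[OF varX_Hm2])
  from g1.Hm_cmult[OF this, of \<alpha>] have "int m0 = d1"
    using Hm2_unique_weight[OF part_Hm2 _ d1(2), of "int m0 * 1"] by (simp add: top)
  then have lF': "g1.lead (int m0) F (const2 \<alpha> * varX2 ^ m0)" and eD: "D = e * m0"
    using lF top ec(2) by (simp_all, metis of_nat_eq_iff of_nat_mult)
  have m0D: "m0 < D" using d1D \<open>int m0 = d1\<close> by linarith
  have m02: "m0 \<ge> 2"
  proof (rule ccontr)
    assume "\<not> m0 \<ge> 2"
    then have "m0 = 1" using am(2) by simp
    then have "F - const2 \<alpha> * varX2 \<in> Fil2 1 1 0" using lF' by (simp add: g1.lead_def)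
    from const2_of_Fil2[OF this] obtain k where "F - const2 \<alpha> * varX2 = const2 k" by auto
    then have "F = const2 \<alpha> * varX2 + const2 k" by (simp add: algebra_simps)
    then show False using naff am(1) by (auto simp: F_def)
  qed
  have e2: "e \<ge> 2"
  proof (rule ccontr)
    assume "\<not> e \<ge> 2"
    then have "e = 1" using e0 by simp
    then show False using eD m0D by simp
  qed
  obtain s m k \<alpha>2 where s: "s \<ge> 2" "m \<ge> 1" "k \<noteq> 0" "k \<in> S" "\<alpha>2 \<noteq> 0" "m0 = s * m"
    "lead2 1 (int s) (int m0) F (const2 \<alpha>2 * (varY2 - const2 k * varX2 ^ s) ^ m)"
    using autp_pure_power_edge[OF S aut m02 lF'[unfolded F_def] am(1)] unfolding F_def by metis
  interpret gs: graded "Hm2 1 (int s)" "Fil2 1 (int s)" "const2 :: 'c \<Rightarrow> _" by (rule graded2)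
  define h where "h = varY2 - const2 k * varX2 ^ s"
  have h0: "h \<noteq> 0" using binomial_nz[of 1 k s] by (simp add: h_def)
  have coF: "coeff (coeff F 0) m0 = \<alpha>" and coG: "coeff (coeff G 0) D = \<beta>"
  proof -
    have "F - const2 \<alpha> * varX2 ^ m0 \<in> Fil2 1 1 (int m0 - 1)" "G - const2 \<beta> * varX2 ^ D \<in> Fil2 1 1 (int D - 1)"
      using lF' g(1) by (simp_all add: g1.lead_def G_def)
    then have "coeff (coeff (F - const2 \<alpha> * varX2 ^ m0) 0) m0 \<noteq> 0 \<Longrightarrow> 1 * int m0 + 1 * int 0 \<le> int m0 - 1"
      "coeff (coeff (G - const2 \<beta> * varX2 ^ D) 0) D \<noteq> 0 \<Longrightarrow> 1 * int D + 1 * int 0 \<le> int D - 1"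
      unfolding Fil2_def by blast+
    then show "coeff (coeff F 0) m0 = \<alpha>" "coeff (coeff G 0) D = \<beta>" by (auto simp: coeff_varX_power)
  qed
  obtain d2 where d2: "G \<in> Fil2 1 (int s) d2" "part 1 (int s) d2 G \<noteq> 0" using top_weight[OF Fn(2)] .
  have Dd2: "int D \<le> d2"
  proof -
    have "1 * int D + int s * int 0 \<le> d2" using d2(1) coG g(2) unfolding Fil2_def by blast
    then show ?thesis by simp
  qed
  have s0: "s > 0" using s(1) by simp
  have s7: "gs.lead (int m0) (\<sigma> varX2) (const2 \<alpha>2 * h ^ m)" using s(7) by (simp only: F_def h_def)
  have lG: "gs.lead d2 (\<sigma> varY2) (part 1 (int s) d2 G)" using lead_part[OF d2(1)] by (simp only: G_def)
  have l: "1 \<le> int m0" "int m0 \<le> d2" "2 \<le> d2" using Dd2 m0D m02 by linarith+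
  have "const2 \<alpha>2 * h ^ m \<noteq> 0" using s(5) h0 by simp
  then obtain e2' c2 where ec2: "c2 \<noteq> 0" "d2 = int e2' * int m0" "part 1 (int s) d2 G = const2 c2 * (const2 \<alpha>2 * h ^ m) ^ e2'"
    using autp_leads[OF S aut s0 s7 _ lG d2(2) l] naff by blast
  \<comment> \<open>Setting \<open>Y = 0\<close> reveals the monomial \<open>X^(m0 e2')\<close>, of
    weight \<open>d2\<close>, in \<open>G\<close>. The total degree of \<open>G\<close> is at most
    \<open>D\<close>, so \<open>d2 \<le> D\<close>.\<close>
  have d2D: "d2 = int D"
  proof -
    define \<kappa> where "\<kappa> = c2 * (\<alpha>2 * (- k) ^ m) ^ e2'"
    have ev: "eval2 const2 varX2 0 h = const2 (- k) * varX2 ^ s"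
      by (simp add: h_def rhom_simps[OF rhom_eval2[OF rhom_const2]] eval2_varX eval2_varY eval2_const rhom_const2 rhom_minus[OF rhom_const2])
    have "[:coeff (part 1 (int s) d2 G) 0:] = const2 c2 * (const2 \<alpha>2 * (const2 (- k) * varX2 ^ s) ^ m) ^ e2'"
      unfolding eval2_Y0[symmetric] ec2(3)
      by (simp only: rhom_simps[OF rhom_eval2[OF rhom_const2]] ev eval2_const rhom_0[OF rhom_const2])
    also have "\<dots> = const2 \<kappa> * ((varX2 ^ s) ^ m) ^ e2'"
      by (simp add: \<kappa>_def const2_mult rhom_power[OF rhom_const2] power_mult_distrib algebra_simps)
    also have "((varX2 ^ s) ^ m) ^ e2' = (varX2 :: 'c poly poly) ^ (m0 * e2')"
      by (simp only: power_mult s(6))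
    finally have "coeff (coeff [:coeff (part 1 (int s) d2 G) 0:] 0) (m0 * e2') = \<kappa>"
      by (simp only: coeff_const2_mult coeff_varX_power) simp
    moreover have "\<kappa> \<noteq> 0" using ec2(1) s(3,5) by (simp add: \<kappa>_def)
    ultimately have "coeff (coeff G 0) (m0 * e2') \<noteq> 0" by (auto simp: coeff_part split: if_splits)
    moreover have "G \<in> Fil2 1 1 (int D)" using g1.lead_Fil[OF g(1)] by (simp add: G_def)
    ultimately have "1 * int (m0 * e2') + 1 * int 0 \<le> int D" unfolding Fil2_def by blast
    then show ?thesis using ec2(2) Dd2 by (simp add: mult.commute)
  qed
  have "e2' = e" using ec2(2) d2D eD m02 by (metis mult_cancel2 not_numeral_le_zero of_nat_eq_iff of_nat_mult)
  show False
  proof (cases "s \<le> e")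
    case True
    \<comment> \<open>The conjugate sends \<open>Y\<close> to
      \<open>\<tau>' G - k (\<tau>' F)^s\<close>. Straightening lowers both degrees, and
      \<open>s (m0 - 1) \<le> e m0 - e < D\<close> controls the power.\<close>
    define \<tau>' where "\<tau>' = elem k s"
    have at: "autp S (elem (- k) s) \<tau>'"
      using autp_elem[OF S1 sring_minus[OF S1 s(4)], of s] by (simp add: \<tau>'_def)
    have \<tau>h: "\<tau>' h = varY2" by (simp add: \<tau>'_def h_def elem_simps)
    note eg = endo_graded[OF endo_elem[of k s] elem_Hm2[of k s], folded \<tau>'_def]
    note r\<tau> = elem_simps[of k s, folded \<tau>'_def] endo_const[OF endo_elem[of k s, folded \<tau>'_def]]
    have "gs.lead (int (s * m)) (\<tau>' F) (const2 \<alpha>2 * varY2 ^ m)"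
      using eg(3)[OF s(7)] by (simp add: r\<tau> h_def[symmetric] \<tau>h s(6))
    from low_degree_after_shear[OF this s(1,2)] have F1: "\<tau>' F \<in> Fil2 1 1 (int m0 - 1)" by (simp add: s(6))
    have "gs.lead (int D) G (const2 (c2 * \<alpha>2 ^ e) * h ^ (m * e))"
      using lead_part[OF d2(1)] ec2(3) unfolding d2D \<open>e2' = e\<close>
      by (simp add: const2_mult rhom_power[OF rhom_const2] power_mult_distrib power_mult[of h m e] mult.assoc)
    from eg(3)[OF this] have "gs.lead (int (s * (m * e))) (\<tau>' G) (const2 (c2 * \<alpha>2 ^ e) * varY2 ^ (m * e))"
      by (simp add: r\<tau> \<tau>h eD s(6) mult.commute mult.left_commute)
    from low_degree_after_shear[OF this s(1)] have G1: "\<tau>' G \<in> Fil2 1 1 (int D - 1)"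
      using s(2) e0 by (simp add: eD s(6) mult.commute mult.left_commute)
    have "s * (m0 - 1) \<le> D - 1"
    proof -
      have "s * (m0 - 1) \<le> e * (m0 - 1)" using True by simp
      also have "\<dots> = D - e" by (simp add: eD diff_mult_distrib2)
      finally show ?thesis using e0 by linarith
    qed
    then have "int s * (int m0 - 1) \<le> int D - 1"
      using m02 D by (metis (no_types, lifting) am(2) m0D of_nat_1 of_nat_diff of_nat_le_iff of_nat_mult One_nat_def Suc_leI less_trans)
    then have "\<tau>' G - const2 k * \<tau>' F ^ s \<in> Fil2 1 1 (int D - 1)"
      by (intro g1.Fil_diff[OF G1] g1.Fil_cmult g1.Fil_mono[OF g1.Fil_power[OF F1, of s]])
    then have 1: "\<tau>' (\<sigma> (elem (- k) s varY2)) \<in> Fil2 1 1 (int D - 1)"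
      by (simp add: r\<sigma> r\<tau> F_def G_def endo_const[OF autpD(1)[OF aut]] rhom_minus[OF rhom_const2])
    have 2: "\<tau>' (\<sigma> (elem (- k) s varX2)) \<in> Fil2 1 1 (int D - 1)"
      using g1.Fil_mono[OF F1, of "int D - 1"] m0D by (simp add: F_def)
    show False by (rule nred[OF at 2 1])
  next
    case False
    then have es: "e < s" by simp
    \<comment> \<open>For the weights \<open>(1, e)\<close>, flatter than the edge,
      \<open>F^e\<close> and \<open>G\<close> have leading forms \<open>\<alpha>^e X^D\<close> and
      \<open>\<beta> X^D\<close>; \<open>\<gamma>\<close> makes them cancel in
      \<open>G - \<gamma> F^e\<close>, and \<open>elem \<gamma> e\<close> preserves these
      weights.\<close>
    define \<gamma> where "\<gamma> = \<beta> / \<alpha> ^ e"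
    have "F \<in> pset (pset S)" "G \<in> pset (pset S)"
      unfolding F_def G_def using autpD(5)[OF aut] varX2_pset varY2_pset S1 by blast+
    then have "\<alpha> \<in> S" "\<beta> \<in> S" using coF coG unfolding pset_def by auto
    then have \<gamma>S: "\<gamma> \<in> S" unfolding \<gamma>_def by (intro sfield_divide[OF S] sring_power[OF S1])
    interpret ge: graded "Hm2 1 (int e)" "Fil2 1 (int e)" "const2 :: 'c \<Rightarrow> _" by (rule graded2)
    define \<tau>' where "\<tau>' = elem \<gamma> e"
    have at: "autp S (elem (- \<gamma>) e) \<tau>'"
      using autp_elem[OF S1 sring_minus[OF S1 \<gamma>S], of e] by (simp add: \<tau>'_def)
    note eg = endo_graded[OF endo_elem[of \<gamma> e] elem_Hm2[of \<gamma> e], folded \<tau>'_def]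
    have lFe: "ge.lead (int m0) F (const2 \<alpha> * varX2 ^ m0)"
      by (rule lead_flatter[OF gs.lead_Fil[OF s(7)] es coF])
    have lGe: "ge.lead (int D) G (const2 \<beta> * varX2 ^ D)"
      by (rule lead_flatter[OF d2(1)[unfolded d2D] es coG])
    have "ge.lead (int D) (const2 \<gamma> * F ^ e) (const2 \<gamma> * (const2 \<alpha> * varX2 ^ m0) ^ e)"
      using ge.lead_cmult[OF ge.lead_power[OF lFe, of e], of \<gamma>] by (simp add: eD)
    moreover have "const2 \<gamma> * (const2 \<alpha> * varX2 ^ m0) ^ e = const2 (\<gamma> * \<alpha> ^ e) * varX2 ^ D"
      by (simp add: const2_mult rhom_power[OF rhom_const2] power_mult_distrib eD power_mult[symmetric] mult.commute[of e])
    moreover have "\<gamma> * \<alpha> ^ e = \<beta>" using am(1) by (simp add: \<gamma>_def)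
    ultimately have "ge.lead (int D) (G - const2 \<gamma> * F ^ e) 0"
      using ge.lead_diff[OF lGe] by fastforce
    then have "\<tau>' (G - const2 \<gamma> * F ^ e) \<in> Fil2 1 (int e) (int D - 1)"
      unfolding ge.lead_0_iff by (rule eg(1))
    moreover have sub: "h \<in> Fil2 1 1 d" if "h \<in> Fil2 1 (int e) d" for h :: "'c poly poly" and d
      unfolding Fil2_def mem_Collect_eq
    proof (intro allI impI)
      fix i j assume "coeff (coeff h j) i \<noteq> 0"
      then have "1 * int i + int e * int j \<le> d" using that unfolding Fil2_def by blast
      moreover have "1 * int j \<le> int e * int j" using e0 by (intro mult_right_mono) simp_all
      ultimately show "1 * int i + 1 * int j \<le> d" by linarith
    qed
    moreover have "\<sigma> (elem (- \<gamma>) e varY2) = G - const2 \<gamma> * F ^ e"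
      by (simp add: r\<sigma> F_def G_def endo_const[OF autpD(1)[OF aut]] rhom_minus[OF rhom_const2])
    ultimately have 1: "\<tau>' (\<sigma> (elem (- \<gamma>) e varY2)) \<in> Fil2 1 1 (int D - 1)" by metis
    have "\<tau>' F \<in> Fil2 1 (int e) (int m0)" by (rule eg(1)[OF ge.lead_Fil[OF lFe]])
    from g1.Fil_mono[OF sub[OF this], of "int D - 1"] have 2: "\<tau>' (\<sigma> (elem (- \<gamma>) e varX2)) \<in> Fil2 1 1 (int D - 1)"
      using m0D by (simp add: F_def)
    show False by (rule nred[OF at 2 1])
  qed
qed

definition swap2 :: "'c::comm_ring_1 poly poly \<Rightarrow> 'c poly poly" where
  "swap2 = eval2 const2 varY2 varX2"

lemma swap2_simps [simp]: "swap2 varX2 = varY2" "swap2 varY2 = varX2"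
  by (simp_all add: swap2_def eval2_varX eval2_varY rhom_const2)

lemma autp_swap2: "sring S \<Longrightarrow> autp S swap2 swap2"
  unfolding swap2_def
  by (rule autp_eval2I) (simp_all add: varX2_pset varY2_pset eval2_varX eval2_varY rhom_const2)

lemma autp_id: "autp S (\<lambda>x. x) (\<lambda>x. x)"
  by (simp add: autp_def endo_def rhom_id)

text \<open>For weights \<open>(1, 1)\<close> every atom is a linear form, and \<open>a = 1\<close>
  puts its coefficient into \<open>S\<close>.\<close>

lemma newton_linear:
  fixes S :: "'c::alg_closed_field set"
  assumes S: "sfield S" and aut: "autp S \<theta> \<theta>'" and D: "D > 0"
    and f: "\<theta> varX2 \<in> Fil2 1 1 (int D)" "part 1 1 (int D) (\<theta> varX2) \<noteq> 0"
  shows "\<exists>\<alpha> u v. \<alpha> \<noteq> 0 \<and> u \<in> S \<and> v \<in> S \<and> (v = 0 \<and> u = 1 \<or> v = 1) \<and>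
    part 1 1 (int D) (\<theta> varX2) = const2 \<alpha> * (const2 u * varX2 + const2 v * varY2) ^ D"
proof -
  note S1 = sfield_sring[OF S]
  interpret g: graded "Hm2 1 1" "Fil2 1 1" "const2 :: 'c \<Rightarrow> _" by (rule graded2)
  define P where "P = part 1 1 (int D) (\<theta> varX2)"
  obtain \<alpha> m where am: "\<alpha> \<noteq> 0" "m > 0" "P = const2 \<alpha> * varX2 ^ m \<or> P = const2 \<alpha> * varY2 ^ m \<or>
      (\<exists>c\<in>S. P = const2 \<alpha> * (varY2 - const2 c * varX2) ^ m)"
    using autp_top_form[OF S aut, of 1 1 "int D"] f D unfolding P_def by auto
  have "\<exists>u v. u \<in> S \<and> v \<in> S \<and> (v = 0 \<and> u = 1 \<or> v = 1) \<and> P = const2 \<alpha> * (const2 u * varX2 + const2 v * varY2) ^ m"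
    using am(3)
  proof (elim disjE bexE)
    assume "P = const2 \<alpha> * varX2 ^ m"
    then show ?thesis using S1 by (intro exI[of _ 1] exI[of _ 0]) (simp add: sring_0 sring_1)
  next
    assume "P = const2 \<alpha> * varY2 ^ m"
    then show ?thesis using S1 by (intro exI[of _ 0] exI[of _ 1]) (simp add: sring_0 sring_1)
  next
    fix c assume "c \<in> S" "P = const2 \<alpha> * (varY2 - const2 c * varX2) ^ m"
    then show ?thesis using S1
      by (intro exI[of _ "- c"] exI[of _ 1]) (simp add: sring_1 sring_minus rhom_minus[OF rhom_const2])
  qed
  then obtain u v where uv: "u \<in> S" "v \<in> S" "v = 0 \<and> u = 1 \<or> v = 1"
    "P = const2 \<alpha> * (const2 u * varX2 + const2 v * varY2) ^ m" by blast
  have "P \<in> Hm2 1 1 (int m * 1)"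
    unfolding uv(4) by (rule g.Hm_cmult[OF g.Hm_power[OF linear_Hm2]])
  then have "m = D" using Hm2_unique_weight[OF _ part_Hm2 f(2), of "int m * 1"] by (simp add: P_def)
  then show ?thesis using am(1) uv unfolding P_def by blast
qed

text \<open>With \<open>c = u \<alpha> + v \<beta>\<close>, an element with leading form
  \<open>k l^m\<close> is sent to one with leading form \<open>k c^m l^(D m)\<close>. Iterating from
  \<open>l\<close> gives degrees \<open>D^i\<close>, which excludes a return to
  \<open>l\<close>.\<close>

lemma not_finite_order_of_growth:
  fixes \<sigma> :: "'c::field poly poly \<Rightarrow> _"
  assumes e: "endo \<sigma>" and D: "D \<ge> 2" and N: "N > 0" and l: "l = const2 u * varX2 + const2 v * varY2"
    and X: "lead2 1 1 (int D) (\<sigma> varX2) (const2 \<alpha> * l ^ D)"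
    and Y: "lead2 1 1 (int D) (\<sigma> varY2) (const2 \<beta> * l ^ D)" and nz: "u * \<alpha> + v * \<beta> \<noteq> 0"
  shows "(\<sigma> ^^ N) l \<noteq> l"
proof
  assume fix_l: "(\<sigma> ^^ N) l = l"
  interpret g: graded "Hm2 1 1" "Fil2 1 1" "const2 :: 'c \<Rightarrow> _" by (rule graded2)
  have lH: "l \<in> Hm2 1 1 1" unfolding l by (rule linear_Hm2)
  have "coeff (coeff l 0) 1 = u" "coeff (coeff l 1) 0 = v" unfolding l by (simp_all add: coeff_varX coeff_varY)
  then have l0: "l \<noteq> 0" using nz by auto
  have step: "\<exists>k. k \<noteq> 0 \<and> g.lead (int (D ^ i)) ((\<sigma> ^^ i) l) (const2 k * l ^ (D ^ i))" for i
  proof (induction i)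
    case 0
    show ?case by (rule exI[of _ 1]) (use g.lead_self[OF lH] in simp)
  next
    case (Suc i)
    define m F where "m = D ^ i" and "F = (\<sigma> ^^ i) l"
    obtain k where k: "k \<noteq> 0" "g.lead (int m) F (const2 k * l ^ m)" using Suc by (auto simp: m_def F_def)
    have FF: "F \<in> Fil2 1 1 (int m)" by (rule g.lead_Fil[OF k(2)])
    have P: "part 1 1 (int m) F = const2 k * l ^ m"
      by (rule g.lead_unique[OF lead_part[OF FF] k(2)])
    \<comment> \<open>Both variables are replaced by elements of degree \<open>D\<close>, so the
      weights \<open>(1, 1)\<close> are scaled by \<open>D\<close>.\<close>
    have wt: "(int D * int i + int D * int j = int (D * m)) = (1 * int i + 1 * int j = int m)"
      "(int D * int i + int D * int j \<le> int (D * m)) = (1 * int i + 1 * int j \<le> int m)" for i j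
      using D by (simp_all add: distrib_left[symmetric] del: of_nat_add)
    have P': "part (int D) (int D) (int (D * m)) F = const2 k * l ^ m"
      unfolding P[symmetric] by (rule poly_poly_eqI) (simp only: coeff_part wt)
    have FF': "F \<in> Fil2 (int D) (int D) (int (D * m))"
      using FF unfolding Fil2_def mem_Collect_eq wt .
    have "g.lead (int (D * m)) (\<sigma> F) (eval2 const2 (const2 \<alpha> * l ^ D) (const2 \<beta> * l ^ D) (const2 k * l ^ m))"
      using eval2_lead2[OF FF' X Y] endo_eval2[OF e, of F] by (simp only: P')
    moreover have "eval2 const2 (const2 \<alpha> * l ^ D) (const2 \<beta> * l ^ D) l = const2 (u * \<alpha> + v * \<beta>) * l ^ D"
      by (subst (3) l) (simp add: rhom_simps[OF rhom_eval2[OF rhom_const2]] eval2_varX eval2_varY eval2_const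
        rhom_const2 const2_add const2_mult algebra_simps)
    then have "eval2 const2 (const2 \<alpha> * l ^ D) (const2 \<beta> * l ^ D) (const2 k * l ^ m) =
        const2 (k * (u * \<alpha> + v * \<beta>) ^ m) * l ^ (D * m)"
      by (simp add: rhom_simps[OF rhom_eval2[OF rhom_const2]] eval2_const const2_mult rhom_power[OF rhom_const2]
        power_mult_distrib power_mult)
    ultimately have "g.lead (int (D ^ Suc i)) ((\<sigma> ^^ Suc i) l) (const2 (k * (u * \<alpha> + v * \<beta>) ^ m) * l ^ (D ^ Suc i))"
      by (simp add: m_def F_def)
    then show ?case using k(1) nz by (intro exI[of _ "k * (u * \<alpha> + v * \<beta>) ^ m"]) simp
  qed
  obtain k where k: "k \<noteq> 0" "g.lead (int (D ^ N)) l (const2 k * l ^ (D ^ N))" using step[of N] fix_l by auto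
  have "D ^ 1 \<le> D ^ N" using D N by (intro power_increasing) simp_all
  then have "1 < int (D ^ N)" using D by (simp only: power_one_right)
  from g.lead_Fil_lower[OF k(2) g.Hm_Fil[OF lH] this] show False using k(1) l0 by simp
qed

lemma conj_funpow:
  assumes "\<And>F. \<tau> (\<tau>' F) = F" "\<And>F. \<tau>' (\<tau> F) = F"
  shows "((\<lambda>x. \<tau>' (\<sigma> (\<tau> x))) ^^ N) F = \<tau>' ((\<sigma> ^^ N) (\<tau> F))"
  by (induction N) (simp_all add: assms)

lemma autp_conj: "autp S \<sigma> \<sigma>' \<Longrightarrow> autp S \<tau> \<tau>' \<Longrightarrow> autp S (\<lambda>x. \<tau>' (\<sigma> (\<tau> x))) (\<lambda>x. \<tau>' (\<sigma>' (\<tau> x)))"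
  by (rule autp_comp[OF autp_sym autp_comp])

text \<open>In the triangular alternative only the image of \<open>X\<close> is prescribed; the
  shape of the image of \<open>Y\<close> is a consequence of invertibility.\<close>

definition triangular_or_affine :: "('c::field poly poly \<Rightarrow> 'c poly poly) \<Rightarrow> bool" where
  "triangular_or_affine \<rho> \<longleftrightarrow> \<rho> varX2 \<in> Fil2 1 1 1 \<and> \<rho> varY2 \<in> Fil2 1 1 1 \<or>
    (\<exists>\<alpha> \<gamma>. \<alpha> \<noteq> 0 \<and> \<rho> varX2 = const2 \<alpha> * varX2 + const2 \<gamma>)"

text \<open>In degree \<open>D \<ge> 2\<close> the two images have leading forms
  \<open>\<alpha> l^D\<close> and \<open>\<beta> l^D\<close> for one linear form \<open>l\<close>,
  possibly zero, and finite order forces \<open>l\<close> to vanish at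
  \<open>(\<alpha>, \<beta>)\<close>. With \<open>l\<close> as the new \<open>X\<close>, the image
  of \<open>X\<close> drops in degree, and a further elementary conjugation lowers
  \<open>D\<close>.\<close>

lemma finite_order_normal_form:
  fixes S :: "'c::alg_closed_field set"
  assumes S: "sfield S" and N: "N > 0"
  shows "autp S \<sigma> \<sigma>' \<Longrightarrow> (\<And>F. (\<sigma> ^^ N) F = F) \<Longrightarrow> \<sigma> varX2 \<in> Fil2 1 1 (int D) \<Longrightarrow> \<sigma> varY2 \<in> Fil2 1 1 (int D) \<Longrightarrow>
    \<exists>\<tau> \<tau>'. autp S \<tau> \<tau>' \<and> triangular_or_affine (\<lambda>x. \<tau>' (\<sigma> (\<tau> x)))"
proof (induction D arbitrary: \<sigma> \<sigma>' rule: less_induct)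
  case (less D)
  interpret g: graded "Hm2 1 1" "Fil2 1 1" "const2 :: 'c \<Rightarrow> _" by (rule graded2)
  note S1 = sfield_sring[OF S]
  note aut = less.prems(1)
  note r\<sigma> = rhom_simps[OF endo_rhom[OF autpD(1)[OF aut]]] endo_const[OF autpD(1)[OF aut]]
  show ?case
  proof (cases "D \<le> 1 \<or> triangular_or_affine \<sigma>")
    case True
    then have "triangular_or_affine \<sigma>"
      unfolding triangular_or_affine_def using g.Fil_mono[OF less.prems(3), of 1] g.Fil_mono[OF less.prems(4), of 1] by auto
    then show ?thesis using autp_id by (intro exI[of _ "\<lambda>x. x"]) blast
  next
    case False
    then have D: "D \<ge> 2" and nta: "\<not> triangular_or_affine \<sigma>" by simp_all
    have naff: "\<not> (\<exists>\<alpha> \<gamma>. \<alpha> \<noteq> 0 \<and> \<sigma> varX2 = const2 \<alpha> * varX2 + const2 \<gamma>)"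
      using nta by (simp add: triangular_or_affine_def)
    define F G where "F = part 1 1 (int D) (\<sigma> varX2)" and "G = part 1 1 (int D) (\<sigma> varY2)"
    have lF: "g.lead (int D) (\<sigma> varX2) F" and lG: "g.lead (int D) (\<sigma> varY2) G"
      unfolding F_def G_def by (rule lead_part less.prems)+
    have D1: "int (D - 1) = int D - 1" using D by simp
    show ?thesis
    proof (cases "F = 0 \<and> G = 0")
      case True
      then have "\<sigma> varX2 \<in> Fil2 1 1 (int (D - 1))" "\<sigma> varY2 \<in> Fil2 1 1 (int (D - 1))"
        using lF lG unfolding D1 by (simp_all add: g.lead_0_iff)
      then show ?thesis using less.IH[OF _ aut less.prems(2), of "D - 1"] D by simp
    next
      case FG: False
      have autY: "autp S (\<lambda>x. \<sigma> (swap2 x)) (\<lambda>x. swap2 (\<sigma>' x))" by (rule autp_comp[OF aut autp_swap2[OF S1]])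
      have "\<exists>\<alpha> \<beta> u v. (\<alpha> \<noteq> 0 \<or> \<beta> \<noteq> 0) \<and> u \<in> S \<and> v \<in> S \<and> (u \<noteq> 0 \<or> v \<noteq> 0) \<and>
        F = const2 \<alpha> * (const2 u * varX2 + const2 v * varY2) ^ D \<and>
        G = const2 \<beta> * (const2 u * varX2 + const2 v * varY2) ^ D"
      proof (cases "F = 0")
        case True
        with FG have "part 1 1 (int D) (\<sigma> (swap2 varX2)) \<noteq> 0" by (simp add: G_def)
        from newton_linear[OF S autY _ _ this] less.prems(4) D obtain \<beta> u v
          where "\<beta> \<noteq> 0" "u \<in> S" "v \<in> S" "v = 0 \<and> u = 1 \<or> v = 1"
          "G = const2 \<beta> * (const2 u * varX2 + const2 v * varY2) ^ D" by (auto simp: G_def)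
        then show ?thesis using True by (intro exI[of _ 0] exI[of _ \<beta>] exI[of _ u] exI[of _ v]) auto
      next
        case F0: False
        from newton_linear[OF S aut _ less.prems(3) F0[unfolded F_def]] D obtain \<alpha> u v
          where w: "\<alpha> \<noteq> 0" "u \<in> S" "v \<in> S" "v = 0 \<and> u = 1 \<or> v = 1"
          "F = const2 \<alpha> * (const2 u * varX2 + const2 v * varY2) ^ D" by (auto simp: F_def)
        show ?thesis
        proof (cases "G = 0")
          case True
          then show ?thesis using w by (intro exI[of _ \<alpha>] exI[of _ 0] exI[of _ u] exI[of _ v]) auto
        next
          case G0: False
          have "int 1 = 1" by simp
          then obtain e c where ec: "int D = int e * int D" "G = const2 c * F ^ e"
            using autp_leads[OF S aut, of 1 "int D" F "int D" G] lF lG F0 G0 D naff by auto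
          have "e = 1" using ec(1) D by simp
          then have "G = const2 (c * \<alpha>) * (const2 u * varX2 + const2 v * varY2) ^ D"
            using ec(2) w(5) by (simp add: const2_mult mult.assoc)
          then show ?thesis using w by (intro exI[of _ \<alpha>] exI[of _ "c * \<alpha>"] exI[of _ u] exI[of _ v]) auto
        qed
      qed
      then obtain \<alpha> \<beta> u v where ab: "\<alpha> \<noteq> 0 \<or> \<beta> \<noteq> 0" and uv: "u \<in> S" "v \<in> S" "u \<noteq> 0 \<or> v \<noteq> 0"
        and FG': "F = const2 \<alpha> * (const2 u * varX2 + const2 v * varY2) ^ D"
          "G = const2 \<beta> * (const2 u * varX2 + const2 v * varY2) ^ D" by blast
      define l where "l = const2 u * varX2 + const2 v * varY2"
      have lF': "g.lead (int D) (\<sigma> varX2) (const2 \<alpha> * l ^ D)" and lG': "g.lead (int D) (\<sigma> varY2) (const2 \<beta> * l ^ D)"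
        using lF lG FG' by (simp_all only: l_def)
      have perp: "u * \<alpha> + v * \<beta> = 0"
        using not_finite_order_of_growth[OF autpD(1)[OF aut] D N l_def lF' lG'] less.prems(2) by blast
      obtain \<mu> \<mu>' u' v' where L: "autp S \<mu> \<mu>'" "\<mu> varX2 = const2 u * varX2 + const2 v * varY2"
        "\<mu> varY2 = const2 u' * varX2 + const2 v' * varY2" "\<mu>' varX2 \<in> Hm2 1 1 1" "\<mu>' varY2 \<in> Hm2 1 1 1"
        "\<And>\<alpha> \<beta>. u * \<alpha> + v * \<beta> = 0 \<Longrightarrow> u' * \<alpha> + v' * \<beta> = 0 \<Longrightarrow> \<alpha> = 0 \<and> \<beta> = 0"
        using linear_autp[OF S uv] by blast
      define \<kappa> where "\<kappa> = u' * \<alpha> + v' * \<beta>"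
      have \<kappa>: "\<kappa> \<noteq> 0" using L(6)[OF perp] ab by (auto simp: \<kappa>_def)
      define \<rho> where "\<rho> = (\<lambda>x. \<mu>' (\<sigma> (\<mu> x)))"
      define \<rho>' where "\<rho>' = (\<lambda>x. \<mu>' (\<sigma>' (\<mu> x)))"
      have aut\<rho>: "autp S \<rho> \<rho>'" unfolding \<rho>_def \<rho>'_def by (rule autp_conj[OF aut L(1)])
      note eg = endo_graded[OF autpD(2)[OF L(1)] L(4,5)]
      have "g.lead (int D) (const2 u * \<sigma> varX2 + const2 v * \<sigma> varY2) (const2 u * (const2 \<alpha> * l ^ D) + const2 v * (const2 \<beta> * l ^ D))"
        by (intro g.lead_add g.lead_cmult lF' lG')
      moreover have "const2 u * (const2 \<alpha> * l ^ D) + const2 v * (const2 \<beta> * l ^ D) = const2 (u * \<alpha> + v * \<beta>) * l ^ D"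
        by (simp add: const2_add const2_mult algebra_simps)
      ultimately have "const2 u * \<sigma> varX2 + const2 v * \<sigma> varY2 \<in> Fil2 1 1 (int D - 1)"
        by (simp add: perp g.lead_0_iff)
      from eg(1)[OF this] have \<rho>X: "\<rho> varX2 \<in> Fil2 1 1 (int D - 1)" by (simp add: \<rho>_def L(2) r\<sigma>)
      have "g.lead (int D) (const2 u' * \<sigma> varX2 + const2 v' * \<sigma> varY2) (const2 u' * (const2 \<alpha> * l ^ D) + const2 v' * (const2 \<beta> * l ^ D))"
        by (intro g.lead_add g.lead_cmult lF' lG')
      moreover have "const2 u' * (const2 \<alpha> * l ^ D) + const2 v' * (const2 \<beta> * l ^ D) = const2 \<kappa> * l ^ D"
        by (simp add: \<kappa>_def const2_add const2_mult algebra_simps)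
      ultimately have "g.lead (int D) (const2 u' * \<sigma> varX2 + const2 v' * \<sigma> varY2) (const2 \<kappa> * l ^ D)" by simp
      from eg(3)[OF this] have "g.lead (int D) (\<rho> varY2) (\<mu>' (const2 \<kappa> * l ^ D))"
        by (simp add: \<rho>_def L(3) r\<sigma>)
      moreover have "\<mu>' l = varX2" using autpD(4)[OF L(1), of varX2] L(2) by (simp add: l_def)
      ultimately have \<rho>Y: "g.lead (int D) (\<rho> varY2) (const2 \<kappa> * varX2 ^ D)"
        by (simp add: rhom_simps[OF endo_rhom[OF autpD(2)[OF L(1)]]] endo_const[OF autpD(2)[OF L(1)]])
      have \<rho>N: "(\<rho> ^^ N) F = F" for F
        unfolding \<rho>_def using conj_funpow[of \<mu> \<mu>' N \<sigma> F] autpD(3,4)[OF L(1)] less.prems(2) by simp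
      from conjugate_of_lower_degree[OF S aut\<rho> D \<rho>X \<rho>Y \<kappa>] show ?thesis
      proof (elim disjE exE conjE)
        fix a c assume "a \<noteq> 0" "\<rho> varX2 = const2 a * varX2 + const2 c"
        then have "triangular_or_affine \<rho>" unfolding triangular_or_affine_def by blast
        then show ?thesis using L(1) unfolding \<rho>_def by blast
      next
        fix \<tau> \<tau>' assume \<tau>: "autp S \<tau> \<tau>'" "\<tau>' (\<rho> (\<tau> varX2)) \<in> Fil2 1 1 (int D - 1)" "\<tau>' (\<rho> (\<tau> varY2)) \<in> Fil2 1 1 (int D - 1)"
        have \<rho>2N: "((\<lambda>x. \<tau>' (\<rho> (\<tau> x))) ^^ N) F = F" for F
          using conj_funpow[of \<tau> \<tau>' N \<rho> F] autpD(3,4)[OF \<tau>(1)] \<rho>N by simp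
        obtain \<eta> \<eta>' where \<eta>: "autp S \<eta> \<eta>'" "triangular_or_affine (\<lambda>x. \<eta>' (\<tau>' (\<rho> (\<tau> (\<eta> x)))))"
          using less.IH[OF _ autp_conj[OF aut\<rho> \<tau>(1)] \<rho>2N, of "D - 1"] \<tau>(2,3) D unfolding D1 by auto
        have "autp S (\<lambda>x. \<mu> (\<tau> (\<eta> x))) (\<lambda>x. \<eta>' (\<tau>' (\<mu>' x)))"
          by (rule autp_comp[OF L(1) autp_comp[OF \<tau>(1) \<eta>(1)]])
        then show ?thesis using \<eta>(2) unfolding \<rho>_def by blast
      qed
    qed
  qed
qed

section \<open>Eigenvectors of automorphisms in normal form\<close>

lemma rhom_pcompose: "rhom (\<lambda>p. pcompose p (q :: 'a::comm_ring_1 poly))"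
  by (rule rhomI) (simp_all add: pcompose_1 pcompose_add pcompose_mult)

text \<open>In terms of polynomials in \<open>Y\<close>, \<open>\<sigma>\<close> is the scaling
  \<open>X \<mapsto> \<alpha> X\<close> on coefficients followed by composition with
  \<open>g = \<sigma> Y\<close>. Degrees multiply under composition, so having \<open>Y\<close> in
  the image forces degree \<open>1\<close> and a unit leading coefficient.\<close>

lemma shear_shape:
  fixes \<sigma> :: "'c::field poly poly \<Rightarrow> _"
  assumes aut: "autp S \<sigma> \<sigma>'" and X: "\<sigma> varX2 = const2 \<alpha> * varX2" and a: "\<alpha> \<noteq> 0"
  obtains \<gamma> q where "\<gamma> \<noteq> 0" "\<sigma> varY2 = const2 \<gamma> * varY2 + [:q:]"
proof -
  define h :: "'c poly \<Rightarrow> 'c poly" where "h p = pcompose p [:0, \<alpha>:]" for p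
  define g where "g = \<sigma> varY2"
  have rh: "rhom h" unfolding h_def by (rule rhom_pcompose)
  have h0: "h p = 0 \<longleftrightarrow> p = 0" and dh: "degree (h p) = degree p" for p
    using a unfolding h_def by (auto simp: pcompose_eq_0 degree_pcompose)
  have \<sigma>: "\<sigma> F = pcompose (map_poly h F) g" for F
  proof (rule rhom_ext2[OF endo_rhom[OF autpD(1)[OF aut]] rhom_comp[OF rhom_pcompose rhom_map_poly[OF rh]]])
    show "\<sigma> (const2 c) = pcompose (map_poly h (const2 c)) g" for c
      by (simp add: endo_const[OF autpD(1)[OF aut]]) (simp add: const2_def map_poly_const rhom_0[OF rh] h_def)
    show "\<sigma> varX2 = pcompose (map_poly h varX2) g"
      unfolding X by (simp add: varX2_def const2_def map_poly_const rhom_0[OF rh] h_def pcompose_pCons)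
    show "\<sigma> varY2 = pcompose (map_poly h varY2) g"
      by (simp add: varY2_def g_def map_poly_pCons rhom_0[OF rh] rhom_1[OF rh] pcompose_pCons)
  qed
  define u where "u = \<sigma>' varY2"
  have Y: "varY2 = pcompose (map_poly h u) g" using \<sigma>[of u] by (simp add: u_def autpD[OF aut])
  have "degree (map_poly h u) * degree g = 1"
    using arg_cong[OF Y, of degree] by (simp add: degree_pcompose varY2_def)
  then have dg: "degree g = 1" by simp
  have "lead_coeff (map_poly h u) * lead_coeff g ^ degree (map_poly h u) = 1"
    using arg_cong[OF Y, of lead_coeff] dg by (simp add: lead_coeff_comp varY2_def)
  moreover have "degree (map_poly h u) = 1" using \<open>degree (map_poly h u) * degree g = 1\<close> by simp
  ultimately have "coeff g 1 dvd 1" using dg by (metis dvd_triv_right power_one_right)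
  then obtain \<gamma> where \<gamma>: "coeff g 1 = [:\<gamma>:]" "\<gamma> \<noteq> 0" by (auto simp: is_unit_poly_iff dvd_field_iff)
  have "g = const2 \<gamma> * varY2 + [:coeff g 0:]"
  proof (rule poly_eqI)
    fix n :: nat
    have "n = 0 \<or> n = 1 \<or> n > 1" by (cases "n = 0"; cases "n = 1") simp_all
    then consider "n = 0" | "n = 1" | "n > 1" by blast
    then show "coeff g n = coeff (const2 \<gamma> * varY2 + [:coeff g 0:]) n"
      by cases (use dg \<gamma> in \<open>simp_all add: const2_def varY2_def coeff_eq_0 coeff_const_poly coeff_pCons split: nat.splits\<close>)
  qed
  then show ?thesis using that[OF \<gamma>(2)] by (simp add: g_def)
qed

lemma coordinate_of_degree_one:
  fixes S :: "'c::field set"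
  assumes S: "sfield S" and z: "z \<in> Fil2 1 1 1" "z \<in> pset (pset S)" "\<And>k. z \<noteq> const2 k"
  shows "\<exists>\<theta> \<theta>'. autp S \<theta> \<theta>' \<and> \<theta> varX2 = z"
proof -
  define u v w where "u = coeff (coeff z 0) 1" and "v = coeff (coeff z 1) 0" and "w = coeff (coeff z 0) 0"
  have zeq: "z = const2 u * varX2 + const2 v * varY2 + const2 w"
  proof (rule poly_poly_eqI)
    fix i j
    have "coeff (coeff z j) i = 0" if "\<not> i + j \<le> 1"
    proof (rule ccontr)
      assume "coeff (coeff z j) i \<noteq> 0"
      then have "1 * int i + 1 * int j \<le> 1" using z(1) unfolding Fil2_def by blast
      then show False using that by simp
    qed
    moreover have "i = 0 \<and> j = 0 \<or> i = 1 \<and> j = 0 \<or> i = 0 \<and> j = 1 \<or> \<not> i + j \<le> 1" by linarith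
    then consider "i = 0" "j = 0" | "i = 1" "j = 0" | "i = 0" "j = 1" | "\<not> i + j \<le> 1" by blast
    ultimately show "coeff (coeff z j) i = coeff (coeff (const2 u * varX2 + const2 v * varY2 + const2 w) j) i"
      by cases (auto simp: coeff_varX coeff_varY coeff_const2 u_def v_def w_def)
  qed
  have "u \<noteq> 0 \<or> v \<noteq> 0" using zeq z(3)[of w] by auto
  moreover have mem: "u \<in> S" "v \<in> S" "w \<in> S" using z(2) by (simp_all add: u_def v_def w_def pset_def)
  ultimately obtain \<theta> \<theta>' u' v' where L: "autp S \<theta> \<theta>'" "\<theta> varX2 = const2 u * varX2 + const2 v * varY2"
    "\<theta> varY2 = const2 u' * varX2 + const2 v' * varY2"
    using linear_autp[OF S] by metis
  note T = translation_autp[OF sfield_sring[OF S] mem(3)]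
  have "\<theta> (eval2 const2 (varX2 + const2 w) varY2 varX2) = z"
    using L zeq by (simp add: eval2_varX rhom_const2 rhom_simps[OF endo_rhom[OF autpD(1)[OF L(1)]]] endo_const[OF autpD(1)[OF L(1)]])
  then show ?thesis using autp_comp[OF L(1) T] by blast
qed

text \<open>The second coordinate is \<open>X\<close>; the inverse solves
  \<open>k Y + q(X) = z\<close> for \<open>Y\<close>.\<close>

lemma coordinate_of_shear:
  fixes S :: "'c::field set"
  assumes S: "sfield S" and z: "z = const2 k * varY2 + [:q:]" "k \<noteq> 0" "z \<in> pset (pset S)"
  shows "\<exists>\<theta> \<theta>'. autp S \<theta> \<theta>' \<and> \<theta> varX2 = z"
proof -
  note S1 = sfield_sring[OF S]
  note S2 = sring_pset[OF sring_pset[OF S1]]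
  have "coeff (coeff z 1) 0 = k" "coeff z 0 = q" using z(1) by (simp_all add: coeff_varY varY2_def const2_def)
  then have kS: "k \<in> S" and qS: "q \<in> pset S" using z(3) by (auto simp: pset_def)
  define qY :: "'c poly poly" where "qY = eval2 const2 varY2 0 [:q:]"
  have ev0: "eval2 const2 x y [:q:] = eval2 const2 x 0 [:q:]" for x y :: "'c poly poly"
    by (simp add: eval2_def map_poly_pCons)
  have q2: "[:q:] \<in> pset (pset S)" using qS by (simp add: pset_pCons pset_0 sring_pset S1)
  have qYS: "qY \<in> pset (pset S)"
    unfolding qY_def by (rule eval2_mem[OF rhom_const2 S2 const2_pset[OF S1] varY2_pset[OF S1] sring_0[OF S2] q2])
  have evqY: "eval2 const2 x y qY = eval2 const2 y 0 [:q:]" for x y :: "'c poly poly"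
    unfolding qY_def
    by (subst endo_eval2'[OF endo_of_eval2]) (simp add: eval2_varX eval2_varY rhom_const2 rhom_0[OF rhom_eval2])
  have X0: "eval2 const2 varX2 0 [:q:] = [:q:]" using eval2_Y0[of "[:q:]"] by simp
  note ev = rhom_simps[OF rhom_eval2[OF rhom_const2]] eval2_varX eval2_varY eval2_const rhom_const2
  have c1: "const2 (inverse k) * (const2 k * f) = f" "const2 k * (const2 (inverse k) * f) = f" for f
    using z(2) by (simp_all add: mult.assoc[symmetric] const2_mult[symmetric])
  have au: "autp S (eval2 const2 z varX2) (eval2 const2 varY2 (const2 (inverse k) * (varX2 - qY)))"
  proof (rule autp_eval2I[OF S1 z(3)])
    have "inverse k \<in> S" using S kS by (simp add: sfield_def)
    then show "const2 (inverse k) * (varX2 - qY) \<in> pset (pset S)"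
      by (intro sring_mult[OF S2] sring_diff[OF S2] const2_pset[OF S1] varX2_pset[OF S1] qYS)
    show "eval2 const2 z varX2 (const2 (inverse k) * (varX2 - qY)) = varY2"
      by (simp add: ev evqY X0) (simp add: z(1) c1)
    show "eval2 const2 varY2 (const2 (inverse k) * (varX2 - qY)) z = varX2"
      unfolding z(1) by (simp add: ev ev0[of varY2 "const2 (inverse k) * (varX2 - qY)"] c1 qY_def[symmetric])
  qed (simp_all add: ev varX2_pset varY2_pset S1)
  show ?thesis
    by (rule exI[of _ "eval2 const2 z varX2"], rule exI, rule conjI[OF au]) (simp add: ev)
qed

lemma Fil2_factor:
  fixes z F :: "'c::field poly poly"
  assumes "z dvd F" "F \<noteq> 0" "F \<in> Fil2 1 1 d" shows "z \<in> Fil2 1 1 d"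
proof -
  interpret g: graded "Hm2 1 1" "Fil2 1 1" "const2 :: 'c \<Rightarrow> _" by (rule graded2)
  obtain q where q: "F = z * q" using assms(1) by blast
  then have nz: "z \<noteq> 0" "q \<noteq> 0" using assms(2) by auto
  obtain dz where dz: "z \<in> Fil2 1 1 dz" "part 1 1 dz z \<noteq> 0" using top_weight[OF nz(1)] .
  obtain dq where dq: "q \<in> Fil2 1 1 dq" "part 1 1 dq q \<noteq> 0" using top_weight[OF nz(2)] .
  have "g.lead (dz + dq) F (part 1 1 dz z * part 1 1 dq q)"
    unfolding q by (rule g.lead_mult[OF lead_part[OF dz(1)] lead_part[OF dq(1)]])
  then have "dz + dq \<le> d" using g.lead_Fil_lower[OF _ assms(3)] dz(2) dq(2) by (metis mult_eq_0_iff not_le)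
  moreover obtain i j where "coeff (coeff (part 1 1 dq q) j) i \<noteq> 0" using dq(2) by (metis leading_coeff_0_iff)
  then have "1 * int i + 1 * int j = dq" by (auto simp: coeff_part split: if_splits)
  then have "dq \<ge> 0" by simp
  ultimately show ?thesis using g.Fil_mono[OF dz(1)] by simp
qed

text \<open>If \<open>z\<close> divides a nonzero polynomial of degree at most \<open>1\<close>, it
  has degree \<open>1\<close> itself. Otherwise every \<open>F\<close> with \<open>F\<close> and
  \<open>\<sigma> F\<close> of degree at most \<open>1\<close> is fixed: an affine
  \<open>\<sigma>\<close> would be the identity, and for a triangular one \<open>z\<close> divides
  \<open>\<sigma> Y - Y = (k - 1) Y + q(X)\<close>, so its degree in \<open>Y\<close> is at most
  \<open>1\<close>.\<close>

lemma coordinate_of_eigenvector: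
  fixes S :: "'c::alg_closed_field set"
  assumes S: "sfield S" and aut: "autp S \<sigma> \<sigma>'" and ta: "triangular_or_affine \<sigma>"
    and z: "\<sigma> z = const2 \<zeta> * z" "\<zeta> \<noteq> 1" "z \<noteq> 0" "z \<in> pset (pset S)"
    and dvd: "\<And>F. z dvd \<sigma> F - F"
  shows "\<exists>\<theta> \<theta>'. autp S \<theta> \<theta>' \<and> \<theta> varX2 = z"
proof (cases "\<exists>F. F \<noteq> 0 \<and> z dvd F \<and> F \<in> Fil2 1 1 1")
  case True
  then have "z \<in> Fil2 1 1 1" using Fil2_factor by blast
  moreover have "z \<noteq> const2 k" for k
  proof
    assume zk: "z = const2 k"
    then have "const2 k = const2 (\<zeta> * k)" using z(1) endo_const[OF autpD(1)[OF aut]] by (simp add: const2_mult)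
    then have "coeff (coeff (const2 k) 0) 0 = coeff (coeff (const2 (\<zeta> * k)) 0) 0" by simp
    then show False using z(2,3) zk by (simp add: coeff_const2)
  qed
  ultimately show ?thesis using coordinate_of_degree_one[OF S _ z(4)] by blast
next
  case False
  interpret g: graded "Hm2 1 1" "Fil2 1 1" "const2 :: 'c \<Rightarrow> _" by (rule graded2)
  note e = autpD(1)[OF aut]
  have XF: "(varX2 :: 'c poly poly) \<in> Fil2 1 1 1" "(varY2 :: 'c poly poly) \<in> Fil2 1 1 1"
    using g.Hm_Fil[OF varX_Hm2] g.Hm_Fil[OF varY_Hm2] by simp_all
  have fixed: "\<sigma> F = F" if "\<sigma> F \<in> Fil2 1 1 1" "F \<in> Fil2 1 1 1" for F
    using False dvd[of F] g.Fil_diff[OF that] by auto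
  have nid: "\<not> (\<sigma> varX2 = varX2 \<and> \<sigma> varY2 = varY2)"
  proof
    assume "\<sigma> varX2 = varX2 \<and> \<sigma> varY2 = varY2"
    then have "\<sigma> z = z" using endo_eq_id[OF e] by blast
    then have "const2 (\<zeta> - 1) * z = 0" using z(1) by (simp add: rhom_diff[OF rhom_const2] algebra_simps)
    then show False using z(2,3) by simp
  qed
  then obtain \<alpha> \<gamma> where "\<sigma> varX2 = const2 \<alpha> * varX2 + const2 \<gamma>"
    using ta fixed XF unfolding triangular_or_affine_def by blast
  moreover have "const2 \<alpha> * varX2 + const2 \<gamma> \<in> Fil2 1 1 1"
    by (intro g.Fil_add g.Fil_cmult XF g.Fil_mono[OF g.Hm_Fil[OF g.Hm_const]]) simp
  ultimately have X: "\<sigma> varX2 = varX2" using fixed[OF _ XF(1)] by metis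
  obtain k q where k: "k \<noteq> 0" "\<sigma> varY2 = const2 k * varY2 + [:q:]"
    using shear_shape[OF aut, of 1] X by auto
  have "const2 k * varY2 + [:q:] - varY2 = const2 (k - 1) * varY2 + [:q:]"
    by (simp add: rhom_diff[OF rhom_const2] algebra_simps)
  then obtain w where w: "const2 (k - 1) * varY2 + [:q:] = z * w" using dvd[of varY2] k(2) by (metis dvd_def)
  have coeffs: "coeff (z * w) 0 = q" "coeff (z * w) 1 = [:k - 1:]" "degree (z * w) \<le> 1"
    unfolding w[symmetric] by (simp_all add: varY2_def const2_def degree_add_le)
  have "z * w \<noteq> 0"
  proof
    assume "z * w = 0"
    then have "q = 0" "[:k - 1:] = 0" using coeffs(1,2) by (metis coeff_0)+
    then have "k = 1" "q = 0" by simp_all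
    then show False using nid X k(2) by simp
  qed
  then have zw: "z \<noteq> 0" "w \<noteq> 0" "degree z + degree w \<le> 1" using coeffs(3) by (auto simp: degree_mult_eq)
  \<comment> \<open>A polynomial in \<open>X\<close> alone is fixed by \<open>\<sigma>\<close>,
    contrary to \<open>\<zeta> \<noteq> 1\<close>.\<close>
  have dz: "degree z \<noteq> 0"
  proof
    assume "degree z = 0"
    then obtain z0 where z0: "z = [:z0:]" by (metis degree_eq_zeroE)
    have "\<sigma> z = eval2 const2 varX2 (\<sigma> varY2) [:z0:]" using endo_eval2[OF e, of z] X z0 by simp
    also have "\<dots> = eval2 const2 varX2 0 [:z0:]" by (simp add: eval2_def map_poly_pCons)
    also have "\<dots> = z" using eval2_Y0[of "[:z0:]"] z0 by simp
    finally have "const2 (\<zeta> - 1) * z = 0" using z(1) by (simp add: rhom_diff[OF rhom_const2] algebra_simps)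
    then show False using z(2,3) by simp
  qed
  then have d1: "degree z = 1" "degree w = 0" using zw(3) by auto
  then obtain w0 where w0: "w = [:w0:]" by (metis degree_eq_zeroE)
  have "coeff z 1 * w0 = [:k - 1:]" using coeffs(2) w0 by (simp add: mult.commute)
  moreover have "coeff z 1 \<noteq> 0" using d1(1) by (metis leading_coeff_0_iff zw(1))
  moreover have "w0 \<noteq> 0" using w0 zw(2) by auto
  ultimately have "degree (coeff z 1) + degree w0 = 0" by (metis degree_mult_eq degree_pCons_0)
  then obtain z1 where z1: "coeff z 1 = [:z1:]" by (metis add_is_0 degree_eq_zeroE)
  have "z = const2 z1 * varY2 + [:coeff z 0:]"
  proof (rule poly_eqI)
    fix n :: nat
    have "n = 0 \<or> n = 1 \<or> n > 1" by (cases "n = 0"; cases "n = 1") simp_all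
    then consider "n = 0" | "n = 1" | "n > 1" by blast
    then show "coeff z n = coeff (const2 z1 * varY2 + [:coeff z 0:]) n"
      by cases (use d1 z1 in \<open>simp_all add: const2_def varY2_def coeff_eq_0 coeff_const_poly coeff_pCons split: nat.splits\<close>)
  qed
  moreover have "z1 \<noteq> 0" using z1 \<open>coeff z 1 \<noteq> 0\<close> by auto
  ultimately show ?thesis using coordinate_of_shear[OF S _ _ z(4)] by blast
qed

lemma eigenvector_is_coordinate:
  fixes S :: "'c::alg_closed_field set"
  assumes S: "sfield S" and aut: "autp S \<sigma> \<sigma>'" and N: "N > 0" "\<And>F. (\<sigma> ^^ N) F = F"
    and z: "\<sigma> z = const2 \<zeta> * z" "\<zeta> \<noteq> 1" "z \<noteq> 0" "z \<in> pset (pset S)"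
    and dvd: "\<And>F. z dvd \<sigma> F - F"
  shows "\<exists>\<theta> \<theta>'. autp S \<theta> \<theta>' \<and> \<theta> varX2 = z"
proof -
  interpret g: graded "Hm2 1 1" "Fil2 1 1" "const2 :: 'c \<Rightarrow> _" by (rule graded2)
  obtain dX where dX: "\<sigma> varX2 \<in> Fil2 1 1 dX" using top_weight[OF autp_nonzero[OF aut varX2_nz]] by blast
  obtain dY where dY: "\<sigma> varY2 \<in> Fil2 1 1 dY" using top_weight[OF autp_nonzero[OF aut varY2_nz]] by blast
  define D where "D = nat (max dX dY)"
  have D: "dX \<le> int D" "dY \<le> int D" unfolding D_def by linarith+
  have "\<sigma> varX2 \<in> Fil2 1 1 (int D)" "\<sigma> varY2 \<in> Fil2 1 1 (int D)"
    by (rule g.Fil_mono[OF dX D(1)] g.Fil_mono[OF dY D(2)])+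
  then obtain \<tau> \<tau>' where \<tau>: "autp S \<tau> \<tau>'" "triangular_or_affine (\<lambda>x. \<tau>' (\<sigma> (\<tau> x)))"
    using finite_order_normal_form[OF S N(1) aut N(2)] by blast
  note r\<tau> = rhom_simps[OF endo_rhom[OF autpD(2)[OF \<tau>(1)]]] endo_const[OF autpD(2)[OF \<tau>(1)]]
  have 1: "\<tau>' (\<sigma> (\<tau> (\<tau>' z))) = const2 \<zeta> * \<tau>' z" by (simp add: autpD[OF \<tau>(1)] z(1) r\<tau>)
  have 2: "\<tau>' z \<noteq> 0" by (rule autp_nonzero[OF autp_sym[OF \<tau>(1)] z(3)])
  have 3: "\<tau>' z dvd \<tau>' (\<sigma> (\<tau> F)) - F" for F
  proof -
    obtain q where "\<sigma> (\<tau> F) - \<tau> F = z * q" using dvd[of "\<tau> F"] by blast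
    then have "\<tau>' (\<sigma> (\<tau> F) - \<tau> F) = \<tau>' z * \<tau>' q" by (simp add: r\<tau>)
    then have "\<tau>' (\<sigma> (\<tau> F)) - F = \<tau>' z * \<tau>' q" by (simp add: r\<tau> autpD[OF \<tau>(1)])
    then show ?thesis by simp
  qed
  obtain \<theta> \<theta>' where \<theta>: "autp S \<theta> \<theta>'" "\<theta> varX2 = \<tau>' z"
    using coordinate_of_eigenvector[OF S autp_conj[OF aut \<tau>(1)] \<tau>(2) 1 z(2) 2 autpD(6)[OF \<tau>(1) z(4)] 3] by blast
  have "\<tau> (\<theta> varX2) = z" by (simp add: \<theta>(2) autpD[OF \<tau>(1)])
  then show ?thesis using autp_comp[OF \<tau>(1) \<theta>(1)] by blast
qed

lemma pset_mono: "k \<subseteq> S \<Longrightarrow> pset k \<subseteq> pset S"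
  by (auto simp: pset_def)

lemma autp_mono:
  assumes S: "sring S" and k: "sring k" "k \<subseteq> S" and aut: "autp k \<theta> \<theta>'"
  shows "autp S \<theta> \<theta>'"
proof -
  have "\<psi> F \<in> pset (pset S)" if "autp k \<psi> \<psi>'" "F \<in> pset (pset S)" for \<psi> \<psi>' F
  proof -
    have "\<psi> varX2 \<in> pset (pset k)" "\<psi> varY2 \<in> pset (pset k)"
      by (rule autpD(5)[OF that(1)], simp add: varX2_pset varY2_pset k(1))+
    then have "\<psi> varX2 \<in> pset (pset S)" "\<psi> varY2 \<in> pset (pset S)"
      using pset_mono[OF pset_mono[OF k(2)]] by blast+
    then show ?thesis
      using eval2_mem[OF rhom_const2 sring_pset[OF sring_pset[OF S]] const2_pset[OF S] _ _ that(2), of "\<psi> varX2" "\<psi> varY2"]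
        endo_eval2[OF autpD(1)[OF that(1)], of F] by simp
  qed
  from this[OF aut] this[OF autp_sym[OF aut]] show ?thesis
    using aut unfolding autp_def by blast
qed

section \<open>Descent of coordinates\<close>

text \<open>No element of \<open>S\<close> outside \<open>k\<close> is purely inseparable over
  \<open>k\<close>. The formulation by powers of \<open>T - c\<close> is the one that leading forms
  supply.\<close>

definition radically_closed :: "'c::field set \<Rightarrow> 'c set \<Rightarrow> bool" where
  "radically_closed k S \<longleftrightarrow> (\<forall>c\<in>S. \<forall>m>0. [:- c, 1:] ^ m \<in> pset k \<longrightarrow> c \<in> k)"

text \<open>Setting \<open>X = 1\<close> leaves \<open>\<alpha> (T - c)^m\<close>; its leading
  coefficient \<open>\<alpha>\<close> lies in \<open>k\<close> and can be divided out.\<close>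

lemma binomial_power_descent:
  assumes k: "sfield k" and rc: "radically_closed k S" and c: "c \<in> S" and m: "m > 0" and a: "\<alpha> \<noteq> 0"
    and mem: "const2 \<alpha> * (varY2 - const2 c * varX2 ^ s) ^ m \<in> pset (pset k)"
  shows "c \<in> k"
proof -
  note k1 = sfield_sring[OF k]
  define ev where "ev = map_poly (\<lambda>p. poly p (1 :: 'a))"
  have rev: "rhom ev" unfolding ev_def by (rule rhom_map_poly[OF rhom_poly])
  have evs: "ev varX2 = 1" "ev varY2 = [:0, 1:]" "ev (const2 d) = [:d:]" for d
    by (simp_all add: ev_def varX2_def varY2_def const2_def map_poly_pCons one_pCons)
  have eq: "ev (const2 \<alpha> * (varY2 - const2 c * varX2 ^ s) ^ m) = [:\<alpha>:] * [:- c, 1:] ^ m"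
    by (simp add: rhom_simps[OF rev] evs)
  have "ev F \<in> pset k" if "F \<in> pset (pset k)" for F
    unfolding pset_def ev_def using that k1
    by (auto simp: coeff_map_poly poly_altdef pset_def intro!: sring_sum)
  from this[OF mem] have 1: "[:\<alpha>:] * [:- c, 1:] ^ m \<in> pset k" by (simp only: eq)
  have "coeff ([:\<alpha>:] * [:- c, 1:] ^ m) m = \<alpha>" by (simp add: coeff_linear_power)
  then have "\<alpha> \<in> k" using 1 unfolding pset_def by (metis mem_Collect_eq)
  then have "[:inverse \<alpha>:] \<in> pset k" using k k1 by (simp add: pset_pCons pset_0 sfield_def)
  from sring_mult[OF sring_pset[OF k1] this 1] have "[:- c, 1:] ^ m \<in> pset k" using a by simp
  then show ?thesis using rc c m unfolding radically_closed_def by blast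
qed

text \<open>The degree of \<open>z = \<theta> X\<close> is lowered by a linear and then an
  elementary map. Their constants occur in leading forms over \<open>k\<close> that are multiples of
  powers of \<open>Y - c X^s\<close>, so they lie in \<open>k\<close>; undoing the maps leaves an
  automorphism over \<open>k\<close>.\<close>

lemma variable_descent:
  fixes S :: "'c::alg_closed_field set"
  assumes S: "sfield S" and k: "sfield k" "k \<subseteq> S" and rc: "radically_closed k S"
  shows "autp S \<theta> \<theta>' \<Longrightarrow> \<theta> varX2 \<in> pset (pset k) \<Longrightarrow> \<theta> varX2 \<in> Fil2 1 1 (int D) \<Longrightarrow>
    \<exists>\<tau> \<tau>'. autp k \<tau> \<tau>' \<and> \<tau> varX2 = \<theta> varX2"
proof (induction D arbitrary: \<theta> \<theta>' rule: less_induct)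
  case (less D)
  interpret g: graded "Hm2 1 1" "Fil2 1 1" "const2 :: 'c \<Rightarrow> _" by (rule graded2)
  note S1 = sfield_sring[OF S] and k1 = sfield_sring[OF k(1)]
  note aut = less.prems(1)
  define z where "z = \<theta> varX2"
  show ?case
  proof (cases "D \<le> 1")
    case True
    then have "z \<in> Fil2 1 1 1" using g.Fil_mono[OF less.prems(3)] by (simp add: z_def)
    then show ?thesis
      using coordinate_of_degree_one[OF k(1), of z] less.prems(2) autp_not_const[OF aut] unfolding z_def by blast
  next
    case False
    then have D: "D \<ge> 2" by simp
    have D1: "int (D - 1) = int D - 1" using D by simp
    show ?thesis
    proof (cases "part 1 1 (int D) z = 0")
      case True
      then have "z \<in> Fil2 1 1 (int (D - 1))"
        using lead_part[OF less.prems(3)] unfolding D1 z_def by (simp add: g.lead_0_iff)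
      then show ?thesis using less.IH[OF _ aut less.prems(2), of "D - 1"] D unfolding z_def by simp
    next
      case P0: False
      have D0: "D > 0" using D by simp
      obtain \<alpha> u v where w: "\<alpha> \<noteq> 0" "u \<in> S" "v \<in> S" "v = 0 \<and> u = 1 \<or> v = 1"
        "part 1 1 (int D) z = const2 \<alpha> * (const2 u * varX2 + const2 v * varY2) ^ D"
        using newton_linear[OF S aut D0 less.prems(3)] P0 unfolding z_def by blast
      have part_k: "part a b d f \<in> pset (pset k)" if "f \<in> pset (pset k)" for a b d f
        using that k1 unfolding pset_def by (simp add: coeff_part sring_0)
      have uv: "u \<in> k" "v \<in> k" "u \<noteq> 0 \<or> v \<noteq> 0"
      proof -
        have "u \<in> k" if "v = 1"
        proof -
          have "part 1 1 (int D) z = const2 \<alpha> * (varY2 - const2 (- u) * varX2 ^ 1) ^ D"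
            using w(5) that by (simp add: rhom_minus[OF rhom_const2] add.commute)
          then have "const2 \<alpha> * (varY2 - const2 (- u) * varX2 ^ 1) ^ D \<in> pset (pset k)"
            using part_k[OF less.prems(2)] by (metis z_def)
          from binomial_power_descent[OF k(1) rc sring_minus[OF S1 w(2)] D0 w(1) this]
          show ?thesis using sring_minus[OF k1] by fastforce
        qed
        then show "u \<in> k" "v \<in> k" "u \<noteq> 0 \<or> v \<noteq> 0" using w(4) k1 by (auto simp: sring_0 sring_1)
      qed
      obtain \<mu> \<mu>' u' v' where L: "autp k \<mu> \<mu>'" "\<mu> varX2 = const2 u * varX2 + const2 v * varY2"
        "\<mu> varY2 = const2 u' * varX2 + const2 v' * varY2" "\<mu>' varX2 \<in> Hm2 1 1 1" "\<mu>' varY2 \<in> Hm2 1 1 1"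
        by (rule linear_autp[OF k(1) uv]) blast
      define l where "l = const2 u * varX2 + const2 v * varY2"
      have \<mu>l: "\<mu>' l = varX2" using autpD(4)[OF L(1), of varX2] L(2) by (simp add: l_def)
      note eg = endo_graded[OF autpD(2)[OF L(1)] L(4,5)]
      note r = rhom_simps[OF endo_rhom[OF autpD(2)[OF L(1)]]] endo_const[OF autpD(2)[OF L(1)]]
      have "g.lead (int D) z (const2 \<alpha> * l ^ D)" using lead_part[OF less.prems(3)] w(5) by (simp add: z_def l_def)
      from eg(3)[OF this] have lz: "g.lead (int D) (\<mu>' z) (const2 \<alpha> * varX2 ^ D)" by (simp add: r \<mu>l)
      define \<theta>1 where "\<theta>1 = (\<lambda>x. \<mu>' (\<theta> x))"
      define \<theta>1' where "\<theta>1' = (\<lambda>x. \<theta>' (\<mu> x))"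
      have aut1: "autp S \<theta>1 \<theta>1'"
        unfolding \<theta>1_def \<theta>1'_def by (rule autp_comp[OF autp_sym[OF autp_mono[OF S1 k1 k(2) L(1)]] aut])
      have \<theta>1X: "\<theta>1 varX2 = \<mu>' z" by (simp add: \<theta>1_def z_def)
      obtain s m c \<beta> where e: "s \<ge> 2" "m \<ge> 1" "c \<noteq> 0" "c \<in> S" "\<beta> \<noteq> 0" "D = s * m"
        "lead2 1 (int s) (int D) (\<mu>' z) (const2 \<beta> * (varY2 - const2 c * varX2 ^ s) ^ m)"
        by (rule autp_pure_power_edge[OF S aut1 D lz[folded \<theta>1X] w(1), unfolded \<theta>1X]) blast
      interpret gs: graded "Hm2 1 (int s)" "Fil2 1 (int s)" "const2 :: 'c \<Rightarrow> _" by (rule graded2)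
      have zk: "\<mu>' z \<in> pset (pset k)" using autpD(6)[OF L(1)] less.prems(2) by (simp add: z_def)
      have "part 1 (int s) (int D) (\<mu>' z) = const2 \<beta> * (varY2 - const2 c * varX2 ^ s) ^ m"
        by (rule gs.lead_unique[OF lead_part[OF gs.lead_Fil[OF e(7)]] e(7)])
      then have mem: "const2 \<beta> * (varY2 - const2 c * varX2 ^ s) ^ m \<in> pset (pset k)"
        using part_k[OF zk] by metis
      have m0: "m > 0" using e(2) by simp
      have ck: "c \<in> k" by (rule binomial_power_descent[OF k(1) rc e(4) m0 e(5) mem])
      define \<eta> where "\<eta> = elem c s"
      define \<eta>' where "\<eta>' = elem (- c) s"
      have at: "autp k \<eta> \<eta>'"
        using autp_elem[OF k1 ck, of s] by (simp add: \<eta>_def \<eta>'_def)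
      note eh = endo_graded[OF endo_elem[of c s] elem_Hm2[of c s], folded \<eta>_def]
      note rh = elem_simps[of c s, folded \<eta>_def] endo_const[OF endo_elem[of c s, folded \<eta>_def]]
      have "\<eta> (varY2 - const2 c * varX2 ^ s) = varY2" by (simp add: \<eta>_def elem_simps)
      then have "gs.lead (int (s * m)) (\<eta> (\<mu>' z)) (const2 \<beta> * varY2 ^ m)"
        using eh(3)[OF e(7)] by (simp add: rh(4,7,9) e(6))
      from low_degree_after_shear[OF this e(1,2)] have F: "\<eta> (\<mu>' z) \<in> Fil2 1 1 (int (D - 1))"
        unfolding D1 by (simp add: e(6))
      have aut2: "autp S (\<lambda>x. \<eta> (\<theta>1 x)) (\<lambda>x. \<theta>1' (\<eta>' x))"
        by (rule autp_comp[OF autp_mono[OF S1 k1 k(2) at] aut1])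
      have mem2: "\<eta> (\<theta>1 varX2) \<in> pset (pset k)" unfolding \<theta>1X by (rule autpD(5)[OF at zk])
      obtain \<tau> \<tau>' where \<tau>: "autp k \<tau> \<tau>'" "\<tau> varX2 = \<eta> (\<mu>' z)"
        using less.IH[OF _ aut2 mem2, of "D - 1"] F D unfolding \<theta>1X by auto
      have "autp k (\<lambda>x. \<mu> (\<eta>' (\<tau> x))) (\<lambda>x. \<tau>' (\<eta> (\<mu>' x)))"
        by (rule autp_comp[OF L(1) autp_comp[OF autp_sym[OF at] \<tau>(1)]])
      moreover have "\<mu> (\<eta>' (\<tau> varX2)) = z" by (simp add: \<tau>(2) autpD[OF at] autpD[OF L(1)])
      ultimately show ?thesis unfolding z_def by blast
    qed
  qed
qed

section \<open>The field generated by a root of unity\<close>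

lemma sring_range: assumes "rhom f" shows "sring (range f)"
  unfolding sring_def
  by (auto simp: rhom_1[OF assms, symmetric] rhom_diff[OF assms, symmetric] rhom_mult[OF assms, symmetric])

lemma rhom_to_ac: "rhom (to_ac :: 'a::field \<Rightarrow> _)"
  by (rule rhomI) simp_all

text \<open>Frobenius permutes the \<open>n\<close>-th roots of unity and does not increase the degree over the
  ground field, hence preserves it along the orbit of \<open>\<zeta>\<close>; this is what separability of
  \<open>k(\<zeta>)\<close> amounts to here.\<close>

context
  fixes \<zeta> :: "'a::field alg_closure" and n :: nat
  assumes n: "n > 0" and root: "\<zeta> ^ n = 1"
begin

definition aeval :: "'a poly \<Rightarrow> 'a alg_closure \<Rightarrow> 'a alg_closure" where
  "aeval F x = poly (map_poly to_ac F) x"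

lemma rhom_aeval: "rhom (\<lambda>F. aeval F x)"
  unfolding aeval_def by (rule rhom_comp[OF rhom_poly rhom_map_poly[OF rhom_to_ac]])

lemma aeval_const [simp]: "aeval [:a:] x = to_ac a"
  by (simp add: aeval_def map_poly_pCons)

text \<open>The degree of the minimal polynomial, meaningful for algebraic elements.\<close>

definition alg_deg :: "'a alg_closure \<Rightarrow> nat" where
  "alg_deg x = (LEAST d. \<exists>F. F \<noteq> 0 \<and> aeval F x = 0 \<and> degree F = d)"

lemma alg_deg_le: "F \<noteq> 0 \<Longrightarrow> aeval F x = 0 \<Longrightarrow> alg_deg x \<le> degree F"
  unfolding alg_deg_def by (rule Least_le) blast

lemma alg_deg_witness: assumes "F \<noteq> 0" "aeval F x = 0"
  obtains G where "G \<noteq> 0" "aeval G x = 0" "degree G = alg_deg x"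
proof -
  have "\<exists>G. G \<noteq> 0 \<and> aeval G x = 0 \<and> degree G = alg_deg x"
    unfolding alg_deg_def by (rule LeastI[of _ "degree F"]) (use assms in blast)
  then show ?thesis using that by blast
qed

lemma zeta_algebraic: "aeval (monom 1 n - 1) \<zeta> = 0" "monom 1 n - 1 \<noteq> (0 :: 'a poly)"
proof -
  show "aeval (monom 1 n - 1) \<zeta> = 0"
    unfolding aeval_def by (simp add: rhom_simps[OF rhom_map_poly[OF rhom_to_ac]] map_poly_monom poly_monom root)
  have "coeff (monom 1 n - 1 :: 'a poly) n = 1" using n by simp
  then show "monom 1 n - 1 \<noteq> (0 :: 'a poly)" by (metis coeff_0 zero_neq_one)
qed

definition adjoin :: "'a alg_closure set" where
  "adjoin = range (\<lambda>F. aeval F \<zeta>)"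

text \<open>Dividing an annihilating polynomial of least degree by \<open>F\<close> leaves a nonzero
  remainder \<open>R\<close> of smaller degree with
  \<open>R(\<zeta>) = - Q(\<zeta>) F(\<zeta>)\<close>, and the inverse of \<open>R(\<zeta>)\<close>
  is available by induction.\<close>

lemma adjoin_inverse: "aeval F \<zeta> \<noteq> 0 \<Longrightarrow> degree F < alg_deg \<zeta> \<Longrightarrow> inverse (aeval F \<zeta>) \<in> adjoin"
proof (induction "degree F" arbitrary: F rule: less_induct)
  case less
  note r = rhom_simps[OF rhom_aeval[of \<zeta>]]
  obtain M where M: "M \<noteq> 0" "aeval M \<zeta> = 0" "degree M = alg_deg \<zeta>"
    using alg_deg_witness[OF zeta_algebraic(2,1)] .
  show ?case
  proof (cases "degree F = 0")
    case True
    then obtain a where "F = [:a:]" by (metis degree_eq_zeroE)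
    then have "inverse (aeval F \<zeta>) = aeval [:inverse a:] \<zeta>" by simp
    then show ?thesis unfolding adjoin_def by blast
  next
    case False
    have F0: "F \<noteq> 0" using False by auto
    define Q R where "Q = M div F" and "R = M mod F"
    have MQ: "M = Q * F + R" by (simp add: Q_def R_def)
    have "aeval (Q * F + R) \<zeta> = 0" using M(2) by (simp only: MQ[symmetric])
    then have eq: "aeval Q \<zeta> * aeval F \<zeta> + aeval R \<zeta> = 0" by (simp add: r)
    have R0: "R \<noteq> 0"
    proof
      assume "R = 0"
      then have "aeval Q \<zeta> = 0" using eq less.prems(1) by (simp add: r)
      moreover have "Q \<noteq> 0" using MQ M(1) \<open>R = 0\<close> by auto
      ultimately have "alg_deg \<zeta> \<le> degree Q" using alg_deg_le by blast
      moreover have "degree M = degree Q + degree F" using MQ \<open>R = 0\<close> \<open>Q \<noteq> 0\<close> F0 by (simp add: degree_mult_eq)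
      ultimately show False using M(3) False by simp
    qed
    have dR: "degree R < degree F" using degree_mod_less[OF F0, of M] R0 by (simp add: R_def)
    have "aeval R \<zeta> \<noteq> 0" using alg_deg_le[OF R0, of \<zeta>] dR less.prems(2) by auto
    then have "inverse (aeval R \<zeta>) \<in> adjoin" using less.hyps[OF dR] dR less.prems(2) by simp
    then obtain G where G: "inverse (aeval R \<zeta>) = aeval G \<zeta>" by (auto simp: adjoin_def)
    have "aeval R \<zeta> = - (aeval Q \<zeta> * aeval F \<zeta>)" using eq by (simp add: eq_neg_iff_add_eq_0 add.commute)
    then have "(- aeval Q \<zeta> * inverse (aeval R \<zeta>)) * aeval F \<zeta> = 1"
      using \<open>aeval R \<zeta> \<noteq> 0\<close> by (simp add: field_simps)
    then have "inverse (aeval F \<zeta>) = - aeval Q \<zeta> * aeval G \<zeta>" using G by (metis inverse_unique mult.commute)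
    also have "\<dots> = aeval (- Q * G) \<zeta>" by (simp add: r)
    finally show ?thesis unfolding adjoin_def by blast
  qed
qed

lemma adjoin_reduced: assumes "c \<in> adjoin" obtains F where "c = aeval F \<zeta>" "degree F < alg_deg \<zeta>"
proof -
  note r = rhom_simps[OF rhom_aeval[of \<zeta>]]
  obtain G where G: "c = aeval G \<zeta>" using assms by (auto simp: adjoin_def)
  obtain M where M: "M \<noteq> 0" "aeval M \<zeta> = 0" "degree M = alg_deg \<zeta>"
    using alg_deg_witness[OF zeta_algebraic(2,1)] .
  have "aeval G \<zeta> = aeval (G div M * M + G mod M) \<zeta>" by simp
  also have "\<dots> = aeval (G mod M) \<zeta>" using M(2) by (simp only: r) simp
  finally have 1: "c = aeval (G mod M) \<zeta>" using G by simp
  have "degree M \<noteq> 0"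
  proof
    assume "degree M = 0"
    then obtain a where "M = [:a:]" by (metis degree_eq_zeroE)
    then show False using M(1,2) by simp
  qed
  then have "degree (G mod M) < alg_deg \<zeta>" using degree_mod_less[OF M(1), of G] M(3) by auto
  then show ?thesis using that 1 by blast
qed

lemma sfield_adjoin: "sfield adjoin"
  unfolding sfield_def
proof (intro conjI ballI)
  show "sring adjoin" unfolding adjoin_def by (rule sring_range[OF rhom_aeval])
  fix x assume x: "x \<in> adjoin"
  then obtain F where F: "x = aeval F \<zeta>" "degree F < alg_deg \<zeta>" by (rule adjoin_reduced)
  show "inverse x \<in> adjoin"
    using adjoin_inverse[of F] F x by (cases "x = 0") auto
qed

lemma range_to_ac_adjoin: "range to_ac \<subseteq> adjoin" and zeta_adjoin: "\<zeta> \<in> adjoin"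
proof -
  have "to_ac a = aeval [:a:] \<zeta>" for a by simp
  then show "range to_ac \<subseteq> adjoin" unfolding adjoin_def by (metis image_subsetI rangeI)
  have "\<zeta> = aeval [:0, 1:] \<zeta>" by (simp add: aeval_def map_poly_pCons)
  then show "\<zeta> \<in> adjoin" unfolding adjoin_def by blast
qed

lemma frobenius_rhom:
  assumes "prime CHAR('b::comm_ring_1)" shows "rhom (\<lambda>x :: 'b. x ^ CHAR('b))"
  using assms by (intro rhomI) (simp_all add: freshmans_dream power_mult_distrib)

text \<open>Write \<open>c = F(\<zeta>)\<close> with \<open>degree F < alg_deg \<zeta>\<close>.
  Frobenius applied to the coefficients of \<open>F\<close>, minus the constant \<open>c^p\<close>,
  annihilates \<open>\<zeta>^p\<close>; its degree is too small for \<open>\<zeta>^p\<close>, so it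
  is zero and \<open>F\<close> is constant.\<close>

lemma adjoin_pth_root:
  assumes p: "prime CHAR('a)" and c: "c \<in> adjoin" "c ^ CHAR('a) \<in> range to_ac"
  shows "c \<in> range to_ac"
proof -
  define p where "p = CHAR('a)"
  have pK: "CHAR('a alg_closure) = p" by (simp add: p_def)
  have p0: "p > 0" using p prime_gt_0_nat by (simp add: p_def)
  have fr: "rhom (\<lambda>x :: 'a. x ^ p)" using frobenius_rhom[where 'b='a] p by (simp add: p_def)
  have frK: "rhom (\<lambda>x :: 'a alg_closure. x ^ p)"
    using frobenius_rhom[where 'b="'a alg_closure"] p pK by (simp add: p_def)
  define Fr where "Fr = map_poly (\<lambda>x :: 'a. x ^ p)"
  have rFr: "rhom Fr" unfolding Fr_def by (rule rhom_map_poly[OF fr])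
  have Fr: "aeval (Fr F) (x ^ p) = aeval F x ^ p" for F x
  proof (rule rhom_ext1[OF rhom_comp[OF rhom_aeval rFr] rhom_comp[OF frK rhom_aeval]])
    show "aeval (Fr [:a:]) (x ^ p) = aeval [:a:] x ^ p" for a
      using p0 by (simp add: Fr_def map_poly_pCons)
    show "aeval (Fr [:0, 1:]) (x ^ p) = aeval [:0, 1:] x ^ p"
      using p0 by (simp add: Fr_def map_poly_pCons aeval_def)
  qed
  have coeff_Fr: "coeff (Fr F) i = coeff F i ^ p" for F i using p0 by (simp add: Fr_def coeff_map_poly)
  have Fr0: "Fr F \<noteq> 0" if "F \<noteq> 0" for F
  proof
    assume "Fr F = 0"
    then have "coeff F i = 0" for i using coeff_Fr[of F i] by simp
    then show False using that by (simp add: poly_eq_iff)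
  qed
  have dFr: "degree (Fr F) \<le> degree F" for F unfolding Fr_def by (rule map_poly_degree_leq)
  have mono: "alg_deg (x ^ p) \<le> alg_deg x" if G: "G \<noteq> 0" "aeval G x = 0" for G x
  proof -
    obtain F where F: "F \<noteq> 0" "aeval F x = 0" "degree F = alg_deg x" using alg_deg_witness[OF G] .
    have "aeval (Fr F) (x ^ p) = 0" using F(2) p0 by (simp add: Fr)
    then show ?thesis using alg_deg_le[OF Fr0[OF F(1)]] dFr[of F] F(3) by fastforce
  qed
  have orbit: "alg_deg (\<zeta> ^ (p ^ Suc e)) \<le> alg_deg (\<zeta> ^ p)" for e
  proof (induction e)
    case (Suc e)
    have "(\<zeta> ^ (p ^ Suc e)) ^ n = 1" by (metis power_commutes power_mult power_one root mult.commute)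
    then have "aeval (monom 1 n - 1) (\<zeta> ^ (p ^ Suc e)) = 0"
      unfolding aeval_def by (simp add: rhom_simps[OF rhom_map_poly[OF rhom_to_ac]] map_poly_monom poly_monom)
    from mono[OF zeta_algebraic(2) this] Suc show ?case by (simp add: power_mult[symmetric] mult.commute)
  qed simp
  \<comment> \<open>The powers \<open>\<zeta>^(p^e)\<close> repeat among the finitely many roots of
    unity, and injectivity of Frobenius moves the repetition back to \<open>\<zeta>\<close>
    itself.\<close>
  have "\<exists>e. \<zeta> ^ (p ^ Suc e) = \<zeta>"
  proof -
    have "finite {x :: 'a alg_closure. x ^ n = 1}"
    proof -
      have ne: "monom 1 n - 1 \<noteq> (0 :: 'a alg_closure poly)"
      proof
        assume "monom 1 n - 1 = (0 :: 'a alg_closure poly)"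
        then have "coeff (monom 1 n - 1 :: 'a alg_closure poly) n = 0" by (simp only: coeff_0)
        then show False using n by simp
      qed
      have "{x :: 'a alg_closure. x ^ n = 1} = {x. poly (monom 1 n - 1) x = 0}" by (simp add: poly_monom)
      then show ?thesis using poly_roots_finite[OF ne] by simp
    qed
    moreover have "range (\<lambda>e. \<zeta> ^ (p ^ e)) \<subseteq> {x. x ^ n = 1}"
      by (auto simp: power_mult[symmetric]) (metis mult.commute power_mult power_one root)
    ultimately have "finite (range (\<lambda>e :: nat. \<zeta> ^ (p ^ e)))" by (rule rev_finite_subset)
    then have "\<not> inj (\<lambda>e :: nat. \<zeta> ^ (p ^ e))" using finite_imageD infinite_UNIV_nat by blast
    then obtain i j where ij: "i < j" "\<zeta> ^ (p ^ i) = \<zeta> ^ (p ^ j)"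
      unfolding inj_def by (metis linorder_neqE_nat)
    have "x = y" if "x ^ (p ^ i) = y ^ (p ^ i)" for x y :: "'a alg_closure"
      using that
    proof (induction i)
      case (Suc i)
      have "(x ^ (p ^ i)) ^ p = (y ^ (p ^ i)) ^ p" using Suc.prems by (simp add: power_mult[symmetric] mult.commute)
      then have "(x ^ (p ^ i) - y ^ (p ^ i)) ^ p = 0" using rhom_diff[OF frK] by simp
      then show ?case using Suc.IH by simp
    qed simp
    moreover have "(\<zeta> ^ (p ^ (j - i))) ^ (p ^ i) = \<zeta> ^ (p ^ i)"
      using ij by (simp add: power_mult[symmetric] power_add[symmetric])
    ultimately have "\<zeta> ^ (p ^ (j - i)) = \<zeta>" by blast
    moreover have "j - i = Suc (j - i - 1)" using ij(1) by simp
    ultimately show ?thesis by metis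
  qed
  then have deg: "alg_deg \<zeta> \<le> alg_deg (\<zeta> ^ p)" using orbit by metis
  obtain F where F: "c = aeval F \<zeta>" "degree F < alg_deg \<zeta>" using c(1) by (rule adjoin_reduced)
  obtain d where d: "c ^ p = to_ac d" using c(2) by (auto simp: p_def)
  define G where "G = Fr F - [:d:]"
  have "aeval G (\<zeta> ^ p) = 0"
    by (simp add: G_def rhom_diff[OF rhom_aeval] Fr F(1)[symmetric] d)
  moreover have "degree G < alg_deg \<zeta>"
    using dFr[of F] F(2) degree_diff_le[of "Fr F" "degree F" "[:d:]"] by (simp add: G_def)
  ultimately have "G = 0" using alg_deg_le[of G "\<zeta> ^ p"] deg by fastforce
  then have "coeff (Fr F) i = coeff [:d:] i" for i by (simp add: G_def)
  then have "coeff F i = 0" if "i > 0" for i using that coeff_Fr[of F i] by (simp add: coeff_const_poly)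
  then have "F = [:coeff F 0:]" by (intro poly_eqI) (auto simp: coeff_const_poly)
  then have "c = to_ac (coeff F 0)" using F(1) by (metis aeval_const)
  then show ?thesis by blast
qed

text \<open>If \<open>m\<close> is nonzero in the field, \<open>c\<close> is read off from the
  coefficient \<open>- m c\<close>. Otherwise \<open>m = p m1\<close> and
  \<open>(T - c)^m = (T^p - c^p)^m1\<close>; induction puts \<open>c^p\<close> into the ground
  field, and \<open>adjoin_pth_root\<close> then \<open>c\<close>.\<close>

lemma radically_closed_adjoin: "radically_closed (range to_ac) adjoin"
proof -
  have "c \<in> range to_ac" if "c \<in> adjoin" "m > 0" "[:- c, 1:] ^ m \<in> pset (range to_ac)" for c m
    using that
  proof (induction m arbitrary: c rule: less_induct)
    case (less m)
    note sr = sring_range[OF rhom_to_ac]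
    show ?case
    proof (cases "of_nat m = (0 :: 'a alg_closure)")
      case False
      have "coeff ([:- c, 1:] ^ m) (m - 1) = of_nat m * (- c)"
        using less.prems(2) by (subst coeff_linear_poly_power) (simp_all add: binomial_symmetric)
      then have "of_nat m * (- c) \<in> range to_ac" using less.prems(3) by (metis coeff_pset)
      then obtain a where "of_nat m * (- c) = to_ac a" by blast
      then have "of_nat m * c = to_ac (- a)" by (metis add.inverse_inverse mult_minus_right to_ac_minus)
      then have "c = to_ac (- a / of_nat m)" using False by (simp add: field_simps)
      then show ?thesis by blast
    next
      case True
      define p where "p = CHAR('a)"
      have pm: "p dvd m" using True by (simp add: of_nat_eq_0_iff_char_dvd p_def)
      then obtain m1 where m1: "m = p * m1" by blast
      then have p0: "p > 0" "m1 > 0" using less.prems(2) by simp_all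
      then have pp: "prime p" using prime_CHAR_semidom[where 'a='a] by (simp add: p_def)
      then have p1: "p > 1" using prime_gt_1_nat by blast
      have frP: "rhom (\<lambda>x :: 'a alg_closure poly. x ^ p)"
        using frobenius_rhom[where 'b="'a alg_closure poly"] pp by (simp add: p_def semiring_char_poly)
      have "[:- c, 1:] = [:0, 1:] - [:c:]" by simp
      then have "[:- c, 1:] ^ p = [:0, 1:] ^ p - [:c:] ^ p" using rhom_diff[OF frP] by metis
      then have 1: "[:- c, 1:] ^ p = pcompose [:- (c ^ p), 1:] (monom 1 p)"
        by (simp add: pcompose_pCons monom_altdef poly_const_pow)
      have 2: "[:- c, 1:] ^ m = pcompose ([:- (c ^ p), 1:] ^ m1) (monom 1 p)"
        unfolding m1 power_mult 1 by (simp add: rhom_power[OF rhom_pcompose])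
      have co: "coeff (pcompose q (monom 1 p)) (p * i) = coeff q i" for q :: "'a alg_closure poly" and i
      proof (induction q arbitrary: i)
        case (pCons a q)
        show ?case
        proof (cases i)
          case 0
          then show ?thesis using p0 by (simp add: pcompose_pCons coeff_mult coeff_monom)
        next
          case (Suc i')
          have "coeff (monom 1 p * pcompose q (monom 1 p)) (p + p * i') = coeff (pcompose q (monom 1 p)) (p * i')"
            by (simp add: coeff_monom_mult)
          then show ?thesis using p0 Suc pCons.IH[of i'] by (simp add: pcompose_pCons coeff_pCons split: nat.splits)
        qed
      qed simp
      have "coeff ([:- (c ^ p), 1:] ^ m1) i \<in> range to_ac" for i
        using coeff_pset[OF less.prems(3), of "p * i"] unfolding 2 co .
      then have "[:- (c ^ p), 1:] ^ m1 \<in> pset (range to_ac)" unfolding pset_def by blast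
      moreover have "c ^ p \<in> adjoin" by (rule sring_power[OF sfield_sring[OF sfield_adjoin] less.prems(1)])
      moreover have "m1 < m" using m1 p1 p0 by simp
      ultimately have "c ^ p \<in> range to_ac" using less.IH p0 by blast
      then show ?thesis using adjoin_pth_root[OF _ less.prems(1)] pp by (simp add: p_def)
    qed
  qed
  then show ?thesis unfolding radically_closed_def by blast
qed

end

section \<open>The surface \<open>b z\<^sup>n = a\<close>\<close>

lemma poly_alg_induct:
  fixes P :: "'a::comm_ring_1 poly \<Rightarrow> bool"
  assumes "\<And>c. P [:c:]" "P [:0, 1:]" "\<And>p q. P p \<Longrightarrow> P q \<Longrightarrow> P (p + q)" "\<And>p q. P p \<Longrightarrow> P q \<Longrightarrow> P (p * q)"
  shows "P p"
proof (induction p)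
  case 0
  show ?case using assms(1)[of 0] by simp
next
  case (pCons a p)
  show ?case unfolding pCons_decomp[of a p] by (intro assms pCons.IH)
qed

lemma poly3_alg_induct:
  fixes P :: "'a::comm_ring_1 poly poly poly \<Rightarrow> bool"
  assumes "\<And>c. P [:const2 c:]" "P [:varX2:]" "P [:varY2:]" "P varZ3"
    and "\<And>p q. P p \<Longrightarrow> P q \<Longrightarrow> P (p + q)" "\<And>p q. P p \<Longrightarrow> P q \<Longrightarrow> P (p * q)"
  shows "P F"
proof (rule poly_alg_induct[OF _ _ assms(5,6)])
  show "P [:0, 1:]" using assms(4) by (simp add: varZ3_def)
  show "P [:f:]" for f
  proof (rule poly_alg_induct[of "\<lambda>f. P [:f:]"])
    show "P [:[:0, 1:]:]" using assms(3) by (simp add: varY2_def)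
    show "P [:[:q:]:]" for q
    proof (rule poly_alg_induct[of "\<lambda>q. P [:[:q:]:]"])
      show "P [:[:[:c:]:]:]" for c using assms(1)[of c] by (simp add: const2_def)
      show "P [:[:[:0, 1:]:]:]" using assms(2) by (simp add: varX2_def)
    qed (use assms(5)[of "[:[:_:]:]" "[:[:_:]:]"] assms(6)[of "[:[:_:]:]" "[:[:_:]:]"] in auto)
  qed (use assms(5)[of "[:_:]" "[:_:]"] assms(6)[of "[:_:]" "[:_:]"] in auto)
qed

lemma card_roots_eq_degree:
  fixes p :: "'c::alg_closed_field poly"
  assumes "p \<noteq> 0" "\<And>a. poly p a = 0 \<Longrightarrow> poly (pderiv p) a \<noteq> 0"
  shows "card {x. poly p x = 0} = degree p"
  using assms
proof (induction "degree p" arbitrary: p)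
  case 0
  then obtain c where "p = [:c:]" by (metis degree_eq_zeroE)
  then show ?case using 0 by simp
next
  case (Suc d)
  then obtain x where x: "poly p x = 0" using alg_closed_imp_poly_has_root[of p] by auto
  then obtain q where q: "p = [:- x, 1:] * q" using poly_eq_0_iff_dvd by blast
  have q0: "q \<noteq> 0" using Suc.prems q by auto
  have dp: "pderiv p = [:- x, 1:] * pderiv q + q"
    unfolding q pderiv_mult by (simp add: pderiv_pCons)
  have "poly q x \<noteq> 0" using Suc.prems(2)[OF x] by (simp add: dp)
  moreover have "degree p = Suc (degree q)" unfolding q using q0 by (subst degree_mult_eq) simp_all
  moreover have "card {x. poly q x = 0} = degree q"
  proof (rule Suc.hyps)
    show "d = degree q" using Suc.hyps(2) \<open>degree p = Suc (degree q)\<close> by simp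
    show "poly (pderiv q) a \<noteq> 0" if "poly q a = 0" for a
      using Suc.prems(2)[of a] that by (simp add: q[symmetric] dp) (simp add: q)
  qed (rule q0)
  moreover have "{x. poly p x = 0} = insert x {x. poly q x = 0}" unfolding q by auto
  ultimately show ?case using poly_roots_finite[OF q0] by simp
qed

text \<open>If \<open>n\<close> does not divide \<open>k\<close>, some root \<open>w\<close> has
  \<open>w^k \<noteq> 1\<close>, because \<open>T^r - 1\<close> with \<open>r = k mod n\<close> has
  fewer than \<open>n\<close> roots. Multiplication by \<open>w\<close> permutes the roots but
  scales the sum by \<open>w^k\<close>.\<close>

lemma sum_roots_of_unity_power:
  assumes n: "n > 0" "of_nat n \<noteq> (0 :: 'c::alg_closed_field)"
  shows "finite {\<zeta> :: 'c. \<zeta> ^ n = 1}"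
    and "(\<Sum>\<zeta> | \<zeta> ^ n = 1. \<zeta> ^ k) = (if n dvd k then of_nat n else (0 :: 'c))"
proof -
  have deg: "degree (monom 1 m - 1 :: 'c poly) = m" "monom 1 m - 1 \<noteq> (0 :: 'c poly)" if "m > 0" for m
  proof -
    have "degree (1 :: 'c poly) < degree (monom 1 m :: 'c poly)" using that by (simp add: degree_monom_eq)
    then show "degree (monom 1 m - 1 :: 'c poly) = m"
      using degree_add_eq_left[of "- 1 :: 'c poly" "monom 1 m"] by (simp add: degree_monom_eq)
    then show "monom 1 m - 1 \<noteq> (0 :: 'c poly)" using that by (metis degree_0 less_irrefl)
  qed
  have set: "{\<zeta> :: 'c. \<zeta> ^ m = 1} = {x. poly (monom 1 m - 1) x = 0}" for m by (simp add: poly_monom)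
  show fin: "finite {\<zeta> :: 'c. \<zeta> ^ n = 1}" unfolding set by (rule poly_roots_finite[OF deg(2)[OF n(1)]])
  have "poly (pderiv (monom 1 n - 1)) a \<noteq> 0" if "poly (monom 1 n - 1) a = 0" for a :: 'c
  proof -
    have "a \<noteq> 0" using that n(1) by (auto simp: poly_monom power_0_left)
    then show ?thesis using n by (simp add: pderiv_diff pderiv_monom poly_monom)
  qed
  then have card: "card {\<zeta> :: 'c. \<zeta> ^ n = 1} = n"
    unfolding set using card_roots_eq_degree[OF deg(2)[OF n(1)]] deg(1)[OF n(1)] by simp
  show "(\<Sum>\<zeta> | \<zeta> ^ n = 1. \<zeta> ^ k) = (if n dvd k then of_nat n else (0 :: 'c))"
  proof (cases "n dvd k")
    case True
    then obtain l where "k = n * l" by blast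
    then have "(\<Sum>\<zeta> :: 'c | \<zeta> ^ n = 1. \<zeta> ^ k) = (\<Sum>\<zeta> :: 'c | \<zeta> ^ n = 1. 1)"
      by (intro sum.cong) (auto simp: power_mult)
    then show ?thesis using card True by simp
  next
    case False
    define r where "r = k mod n"
    have r: "0 < r" "r < n" using False n(1) by (auto simp: r_def mod_greater_zero_iff_not_dvd)
    have "\<exists>w :: 'c. w ^ n = 1 \<and> w ^ r \<noteq> 1"
    proof (rule ccontr)
      assume "\<not> ?thesis"
      then have "{\<zeta> :: 'c. \<zeta> ^ n = 1} \<subseteq> {x. poly (monom 1 r - 1) x = 0}" unfolding set[symmetric] by blast
      then have "n \<le> card {x :: 'c. poly (monom 1 r - 1) x = 0}"
        using card_mono[OF poly_roots_finite[OF deg(2)[OF r(1)]]] card by metis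
      also have "\<dots> \<le> r" using card_poly_roots_bound[OF deg(2)[OF r(1)]] deg(1)[OF r(1)] by simp
      finally show False using r by simp
    qed
    then obtain w :: 'c where w: "w ^ n = 1" "w ^ r \<noteq> 1" by blast
    have "k = n * (k div n) + r" by (simp add: r_def)
    then have "w ^ k = (w ^ n) ^ (k div n) * w ^ r" by (metis power_add power_mult)
    then have wk: "w ^ k \<noteq> 1" using w by simp
    have w0: "w \<noteq> 0" using w(1) n(1) by (auto simp: power_0_left)
    have bij: "bij_betw (\<lambda>\<zeta>. w * \<zeta>) {\<zeta> :: 'c. \<zeta> ^ n = 1} {\<zeta>. \<zeta> ^ n = 1}"
    proof (rule bij_betwI[where g = "\<lambda>\<zeta>. inverse w * \<zeta>"])
      show "(\<lambda>\<zeta>. w * \<zeta>) \<in> {\<zeta>. \<zeta> ^ n = 1} \<rightarrow> {\<zeta>. \<zeta> ^ n = 1}" using w by (simp add: power_mult_distrib)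
      show "(\<lambda>\<zeta>. inverse w * \<zeta>) \<in> {\<zeta>. \<zeta> ^ n = 1} \<rightarrow> {\<zeta>. \<zeta> ^ n = 1}"
        using w by (simp add: power_mult_distrib power_inverse)
    qed (use w0 in simp_all)
    have "(\<Sum>\<zeta> :: 'c | \<zeta> ^ n = 1. \<zeta> ^ k) = (\<Sum>\<zeta> | \<zeta> ^ n = 1. (w * \<zeta>) ^ k)"
      using sum.reindex_bij_betw[OF bij, of "\<lambda>\<zeta>. \<zeta> ^ k"] by simp
    also have "\<dots> = w ^ k * (\<Sum>\<zeta> :: 'c | \<zeta> ^ n = 1. \<zeta> ^ k)" by (simp add: power_mult_distrib sum_distrib_left)
    finally have "(1 - w ^ k) * (\<Sum>\<zeta> :: 'c | \<zeta> ^ n = 1. \<zeta> ^ k) = 0" by (simp add: algebra_simps)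
    then show ?thesis using wk False by simp
  qed
qed

lemma degree_gpoly:
  fixes a b :: "'c::field poly poly"
  assumes "b \<noteq> 0" "n > 0"
  shows "degree ([:b:] * varZ3 ^ n - [:a:]) = n" "coeff ([:b:] * varZ3 ^ n - [:a:]) n = b"
    "coeff ([:b:] * varZ3 ^ n - [:a:]) 0 = - a" "[:b:] * varZ3 ^ n - [:a:] \<noteq> 0"
proof -
  have eq: "[:b:] * varZ3 ^ n = monom b n" by (simp add: varZ3_def monom_altdef)
  show c: "coeff ([:b:] * varZ3 ^ n - [:a:]) n = b" "coeff ([:b:] * varZ3 ^ n - [:a:]) 0 = - a"
    using assms unfolding eq by (simp_all add: coeff_const_poly)
  then show "[:b:] * varZ3 ^ n - [:a:] \<noteq> 0" using assms(1) by (metis coeff_0)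
  show "degree ([:b:] * varZ3 ^ n - [:a:]) = n"
    unfolding eq diff_conv_add_uminus using assms
    by (subst degree_add_eq_left) (simp_all add: degree_monom_eq)
qed

text \<open>The quotient ring is not formed: \<open>eval3 const2 x y z\<close> presents it as a
  polynomial ring in two variables, with \<open>x, y, z\<close> the images of
  \<open>X, Y, Z\<close>.\<close>

locale plane =
  fixes a b :: "'c::field poly poly" and n :: nat and x y z :: "'c poly poly"
  assumes b_nz: "b \<noteq> 0" and n_ge: "n \<ge> 2"
    and surj: "surj (eval3 const2 x y z)"
    and ker: "\<And>F. eval3 const2 x y z F = 0 \<longleftrightarrow> [:b:] * varZ3 ^ n - [:a:] dvd F"
begin

abbreviation "g \<equiv> [:b:] * varZ3 ^ n - [:a:]"
abbreviation "ev \<equiv> eval3 const2 x y z"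
abbreviation "res \<equiv> eval2 const2 x y"

lemma n_pos: "n > 0" using n_ge by simp

lemmas gpoly = degree_gpoly[OF b_nz n_pos, of a]

lemma rhom_ev: "rhom ev" and rhom_res: "rhom res"
  by (rule rhom_eval3[OF rhom_const2], rule rhom_eval2[OF rhom_const2])

lemmas res_simps = rhom_simps[OF rhom_res]

lemma ev_const: "ev [:f:] = res f" and ev_Z: "ev varZ3 = z"
  by (simp_all add: eval3_const eval3_varZ rhom_const2)

lemma res_inj: "res f = 0 \<longleftrightarrow> f = 0"
proof
  assume "res f = 0"
  then have "g dvd [:f:]" using ker[of "[:f:]"] by (simp add: ev_const)
  then show "f = 0"
    using dvd_imp_degree_le[of g "[:f:]"] gpoly(1) n_pos by (cases "f = 0") auto
qed (simp add: res_simps)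

lemma rel: "res b * z ^ n = res a"
proof -
  have "ev g = 0" unfolding ker by (rule dvd_refl)
  then show ?thesis by (simp only: rhom_simps[OF rhom_ev] ev_const ev_Z right_minus_eq)
qed

lemma z_nz: "z \<noteq> 0"
proof
  assume "z = 0"
  then have "g dvd varZ3" using ker[of varZ3] unfolding ev_Z by blast
  then have "degree g \<le> degree (varZ3 :: 'c poly poly poly)" by (rule dvd_imp_degree_le) (simp add: varZ3_def)
  then show False using gpoly(1) n_ge by (simp add: varZ3_def)
qed

text \<open>Compare the terms free of \<open>Z\<close> in \<open>f - Z W = g H\<close>: the constant
  coefficient of \<open>g\<close> is \<open>- a\<close>.\<close>

lemma res_dvd_z: assumes "res f = z * w" obtains f1 where "f = a * f1"
proof -
  obtain W where W: "w = ev W" using surj by (metis surjD)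
  have "ev ([:f:] - varZ3 * W) = 0" using assms by (simp add: rhom_simps[OF rhom_ev] ev_const ev_Z W)
  then obtain H where H: "[:f:] - varZ3 * W = g * H" using ker by (metis dvdE)
  have "coeff ([:f:] - varZ3 * W) 0 = f" by (simp add: varZ3_def)
  moreover have "coeff (g * H) 0 = - a * coeff H 0" using gpoly(3) by (simp only: coeff_mult_0)
  ultimately have "f = a * (- coeff H 0)" using H by simp
  then show ?thesis by (rule that)
qed

text \<open>A nonconstant polynomial in \<open>z\<close> lying in \<open>k[x, y]\<close> makes \<open>b\<close> a unit, as \<open>b\<close> is the leading
  coefficient of \<open>g\<close>.\<close>

lemma res_poly_z:
  assumes "poly (map_poly const2 e) z = res f" "degree e > 0"
  obtains b0 where "b = const2 b0"
proof -
  define E where "E = map_poly const2 e"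
  define E3 :: "'c poly poly poly" where "E3 = E"
  have rE: "poly (map_poly res E) z = poly E z"
    unfolding E_def by (simp add: map_poly_map_poly rhom_0[OF rhom_const2] rhom_0[OF rhom_res] o_def eval2_const)
  have "ev E = poly E z" using rE by (simp add: eval3_def)
  then have "ev (E - [:f:]) = 0" using assms(1) by (simp add: rhom_simps[OF rhom_ev] ev_const E_def)
  then obtain H where H: "E - [:f:] = g * H" using ker by (metis dvdE)
  have cE: "coeff E i = const2 (coeff e i)" for i by (simp add: E_def coeff_map_poly)
  have dE: "degree E = degree e" unfolding E_def by (rule degree_map_poly) simp
  have dEf: "degree (E - [:f:]) = degree e"
    unfolding diff_conv_add_uminus using assms(2) dE by (subst degree_add_eq_left) simp_all
  have "lead_coeff (E - [:f:]) = const2 (lead_coeff e)"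
    using assms(2) by (simp add: dEf cE coeff_const_poly)
  then have "b * lead_coeff H = const2 (lead_coeff e)"
    using gpoly(1,2) by (simp add: H lead_coeff_mult)
  then have 1: "(const2 (inverse (lead_coeff e)) * lead_coeff H) * b = 1"
    using assms(2) by (metis const2_1 const2_mult degree_0 leading_coeff_0_iff left_inverse less_irrefl mult.assoc mult.commute)
  then have "b dvd 1" by (metis dvd_triv_right)
  then obtain c where c: "b = [:c:]" "c dvd 1" by (auto simp: is_unit_poly_iff)
  then obtain b0 where "c = [:b0:]" by (auto simp: is_unit_poly_iff)
  then show ?thesis using that[of b0] c by (simp add: const2_def)
qed

text \<open>For \<open>\<zeta>^n = 1\<close> the value does not depend on the chosen preimage, since
  \<open>g\<close> involves \<open>Z\<close> only through \<open>Z^n\<close>.\<close>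

definition rot :: "'c \<Rightarrow> 'c poly poly \<Rightarrow> 'c poly poly" where
  "rot \<zeta> F = eval3 const2 x y (const2 \<zeta> * z) (inv_into UNIV ev F)"

lemma ev_rot_cong:
  assumes "\<zeta> ^ n = 1" "ev F = ev G"
  shows "eval3 const2 x y (const2 \<zeta> * z) F = eval3 const2 x y (const2 \<zeta> * z) G"
proof -
  note r = rhom_simps[OF rhom_eval3[OF rhom_const2], of x y "const2 \<zeta> * z"]
  have "ev (F - G) = 0" using assms(2) by (simp add: rhom_simps[OF rhom_ev])
  then obtain H where H: "F - G = g * H" using ker by (metis dvdE)
  have "(const2 \<zeta> * z) ^ n = z ^ n"
    using assms(1) by (simp add: power_mult_distrib rhom_power[OF rhom_const2, symmetric])
  then have "eval3 const2 x y (const2 \<zeta> * z) g = 0"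
    using rel by (simp only: r eval3_const eval3_varZ[OF rhom_const2] right_minus_eq)
  then have "eval3 const2 x y (const2 \<zeta> * z) (F - G) = 0" by (simp add: H r)
  then show ?thesis by (simp add: r)
qed

lemma rot_ev: assumes "\<zeta> ^ n = 1" shows "rot \<zeta> (ev F) = eval3 const2 x y (const2 \<zeta> * z) F"
  unfolding rot_def by (rule ev_rot_cong[OF assms surj_f_inv_f[OF surj]])

lemma rot_res: assumes "\<zeta> ^ n = 1" shows "rot \<zeta> (res f) = res f"
  using rot_ev[OF assms, of "[:f:]"] by (simp add: ev_const eval3_const)

lemma rot_z: assumes "\<zeta> ^ n = 1" shows "rot \<zeta> z = const2 \<zeta> * z"
  using rot_ev[OF assms, of varZ3] by (simp add: ev_Z eval3_varZ rhom_const2)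

lemma endo_rot: assumes "\<zeta> ^ n = 1" shows "endo (rot \<zeta>)"
  unfolding endo_def
proof (intro conjI allI rhomI)
  note r = rhom_simps[OF rhom_eval3[OF rhom_const2], of x y "const2 \<zeta> * z"]
  note s = surj_f_inv_f[OF surj]
  show "rot \<zeta> (const2 c) = const2 c" for c
    using rot_res[OF assms, of "const2 c"] by (simp add: eval2_const)
  show "rot \<zeta> 1 = 1" using rot_res[OF assms, of 1] by (simp add: res_simps)
  show "rot \<zeta> (F + G) = rot \<zeta> F + rot \<zeta> G" for F G
    using rot_ev[OF assms, of "inv_into UNIV ev F + inv_into UNIV ev G"] rot_ev[OF assms, of "inv_into UNIV ev F"] rot_ev[OF assms, of "inv_into UNIV ev G"]
    by (simp add: rhom_simps[OF rhom_ev] s r)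
  show "rot \<zeta> (F * G) = rot \<zeta> F * rot \<zeta> G" for F G
    using rot_ev[OF assms, of "inv_into UNIV ev F * inv_into UNIV ev G"] rot_ev[OF assms, of "inv_into UNIV ev F"] rot_ev[OF assms, of "inv_into UNIV ev G"]
    by (simp add: rhom_simps[OF rhom_ev] s r)
qed

lemma rot_rot:
  assumes "\<zeta> ^ n = 1" "\<xi> ^ n = 1" shows "rot \<zeta> (rot \<xi> F) = rot (\<xi> * \<zeta>) F"
proof -
  obtain G where G: "F = ev G" using surj by (metis surjD)
  have X: "rot \<zeta> x = x" "rot \<zeta> y = y"
    using rot_res[OF assms(1), of varX2] rot_res[OF assms(1), of varY2] by (simp_all add: eval2_varX eval2_varY rhom_const2)
  note e = endo_rot[OF assms(1)]
  have "rot \<zeta> (rot \<xi> F) = eval3 const2 x y (const2 \<xi> * (const2 \<zeta> * z)) G"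
    unfolding G rot_ev[OF assms(2)] eval3_comp[OF endo_rhom[OF e] rhom_const2]
    by (simp add: X endo_const[OF e] rhom_mult[OF endo_rhom[OF e]] rot_z[OF assms(1)])
  also have "\<dots> = rot (\<xi> * \<zeta>) F"
    unfolding G using rot_ev[of "\<xi> * \<zeta>" G] assms by (simp add: power_mult_distrib const2_mult mult.assoc)
  finally show ?thesis .
qed

lemma rot_1: "rot 1 F = F"
proof -
  obtain G where "F = ev G" using surj by (metis surjD)
  then show ?thesis using rot_ev[of 1 G] by simp
qed

lemma rot_funpow: assumes "\<zeta> ^ n = 1" shows "(rot \<zeta> ^^ i) F = rot (\<zeta> ^ i) F"
proof (induction i)
  case (Suc i)
  have "(\<zeta> ^ i) ^ n = 1" using assms by (metis power_commutes power_mult power_one mult.commute)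
  then show ?case using Suc rot_rot[OF assms, of "\<zeta> ^ i" F] by (simp add: mult.commute)
qed (simp add: rot_1)

lemma rot_cong_z: assumes "\<zeta> ^ n = 1" shows "z dvd rot \<zeta> F - F"
proof -
  obtain G where G: "F = ev G" using surj by (metis surjD)
  obtain g0 G1 where G1: "G = pCons g0 G1" by (cases G)
  have "rot \<zeta> F - F = z * (const2 \<zeta> * eval3 const2 x y (const2 \<zeta> * z) G1 - eval3 const2 x y z G1)"
    unfolding G rot_ev[OF assms] G1 by (simp add: eval3_pCons rhom_const2 algebra_simps)
  then show ?thesis by simp
qed

text \<open>Preimages \<open>P\<close> and \<open>Q\<close> of the two coordinates with coefficients
  in \<open>S\<close> show that their images under \<open>rot\<close> again have coefficients in
  \<open>S\<close>.\<close>

lemma autp_rot: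
  assumes S: "sring S" "\<zeta> \<in> S" and \<zeta>: "\<zeta> ^ n = 1"
    and mem: "x \<in> pset (pset S)" "y \<in> pset (pset S)" "z \<in> pset (pset S)"
    and pre: "P \<in> pset (pset (pset S))" "Q \<in> pset (pset (pset S))" "ev P = varX2" "ev Q = varY2"
  shows "autp S (rot \<zeta>) (rot (\<zeta> ^ (n - 1)))"
proof -
  have n1: "\<zeta> * \<zeta> ^ (n - 1) = 1" using \<zeta> n_pos by (metis power_eq_if less_irrefl)
  have \<zeta>': "(\<zeta> ^ (n - 1)) ^ n = 1" using \<zeta> by (metis power_commutes power_mult power_one mult.commute)
  note S2 = sring_pset[OF sring_pset[OF S(1)]]
  have pres: "rot \<xi> F \<in> pset (pset S)" if \<xi>: "\<xi> ^ n = 1" "\<xi> \<in> S" and F: "F \<in> pset (pset S)" for \<xi> F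
  proof -
    have "eval3 const2 x y (const2 \<xi> * z) G \<in> pset (pset S)" if "G \<in> pset (pset (pset S))" for G
      unfolding eval3_sum[OF rhom_const2]
    proof (intro sring_sum[OF S2] sring_mult[OF S2] sring_power[OF S2] const2_pset S \<xi> mem)
      fix i
      show "eval2 const2 x y (coeff G i) \<in> pset (pset S)"
        by (rule eval2_mem[OF rhom_const2 S2 const2_pset[OF S(1)] mem(1,2) coeff_pset[OF that]])
    qed
    then have "rot \<xi> varX2 \<in> pset (pset S)" "rot \<xi> varY2 \<in> pset (pset S)"
      using rot_ev[OF \<xi>(1), of P] rot_ev[OF \<xi>(1), of Q] pre by simp_all
    then show ?thesis
      using eval2_mem[OF rhom_const2 S2 const2_pset[OF S(1)] _ _ F, of "rot \<xi> varX2" "rot \<xi> varY2"]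
        endo_eval2[OF endo_rot[OF \<xi>(1)], of F] by simp
  qed
  show ?thesis
    unfolding autp_def
    using endo_rot[OF \<zeta>] endo_rot[OF \<zeta>'] rot_rot[OF \<zeta> \<zeta>'] rot_rot[OF \<zeta>' \<zeta>] n1 rot_1
      pres[OF \<zeta> S(2)] pres[OF \<zeta>' sring_power[OF S]]
    by (simp add: mult.commute)
qed

end

text \<open>\<open>field_gcd\<close> supplies gcds of polynomials, by which fractions are reduced to
  lowest terms.\<close>

locale closed_plane = plane a b n x y z
  for a b :: "'c::{alg_closed_field, field_gcd} poly poly" and n x y z +
  assumes n_nz: "of_nat n \<noteq> (0 :: 'c)"
begin

text \<open>Averaging over all roots of unity projects onto the invariants \<open>k[x, y, z\<^sup>n]\<close>, which are fractions
  over \<open>k[x, y]\<close> with denominator a power of \<open>b\<close>.\<close>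

lemma rot_average:
  obtains M f where "res b ^ M * (\<Sum>\<zeta> | \<zeta> ^ n = 1. rot \<zeta> F) = res f"
proof -
  obtain G where G: "F = ev G" using surj by (metis surjD)
  define M where "M = degree G"
  have "(\<Sum>\<zeta> | \<zeta> ^ n = 1. rot \<zeta> F) = (\<Sum>\<zeta> | \<zeta> ^ n = 1. \<Sum>k\<le>M. res (coeff G k) * z ^ k * const2 (\<zeta> ^ k))"
  proof (intro sum.cong refl)
    fix \<zeta> :: 'c assume "\<zeta> \<in> {\<zeta>. \<zeta> ^ n = 1}"
    then have "rot \<zeta> F = eval3 const2 x y (const2 \<zeta> * z) G" unfolding G using rot_ev by simp
    then show "rot \<zeta> F = (\<Sum>k\<le>M. res (coeff G k) * z ^ k * const2 (\<zeta> ^ k))"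
      by (simp add: M_def eval3_sum[OF rhom_const2] power_mult_distrib rhom_power[OF rhom_const2] mult_ac)
  qed
  also have "\<dots> = (\<Sum>k\<le>M. res (coeff G k) * z ^ k * const2 (\<Sum>\<zeta> | \<zeta> ^ n = 1. \<zeta> ^ k))"
    by (subst sum.swap) (simp add: sum_distrib_left rhom_sum[OF rhom_const2])
  also have "\<dots> = (\<Sum>k\<le>M. if n dvd k then res (coeff G k) * z ^ k * const2 (of_nat n) else 0)"
    by (intro sum.cong refl) (simp add: sum_roots_of_unity_power[OF n_pos n_nz])
  finally have eq: "res b ^ M * (\<Sum>\<zeta> | \<zeta> ^ n = 1. rot \<zeta> F) =
    (\<Sum>k\<le>M. if n dvd k then res b ^ M * (res (coeff G k) * z ^ k * const2 (of_nat n)) else 0)"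
    by (simp add: sum_distrib_left if_distrib[of "\<lambda>u. res b ^ M * u"] cong: if_cong)
  have "\<exists>f. (if n dvd k then res b ^ M * (res (coeff G k) * z ^ k * const2 (of_nat n)) else 0) = res f" if k: "k \<le> M" for k
  proof (cases "n dvd k")
    case True
    then obtain l where l: "k = n * l" by blast
    have "l \<le> M" using l k n_pos by (metis le_trans mult_le_mono1 nat_mult_1 Suc_leI One_nat_def)
    then have "res b ^ M * z ^ k = res b ^ (M - l) * res a ^ l"
      unfolding l power_mult rel[symmetric] power_mult_distrib by (simp add: power_add[symmetric] mult.assoc[symmetric])
    then have "res b ^ M * (res (coeff G k) * z ^ k * const2 (of_nat n)) =
        res (b ^ (M - l) * a ^ l * coeff G k * const2 (of_nat n))"
      by (simp add: res_simps eval2_const algebra_simps)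
    then show ?thesis using True by (intro exI) simp
  next
    case False
    then show ?thesis by (intro exI[of _ 0]) (simp add: res_simps)
  qed
  then obtain f where f: "\<And>k. k \<le> M \<Longrightarrow> (if n dvd k then res b ^ M * (res (coeff G k) * z ^ k * const2 (of_nat n)) else 0) = res (f k)"
    by metis
  have "res b ^ M * (\<Sum>\<zeta> | \<zeta> ^ n = 1. rot \<zeta> F) = res (sum f {..M})"
    unfolding eq by (simp add: f rhom_sum[OF rhom_res])
  then show ?thesis by (rule that)
qed

end

section \<open>Normal form over an algebraically closed field\<close>

definition pe :: "'c::comm_ring_1 poly \<Rightarrow> 'c poly poly \<Rightarrow> 'c poly poly" where
  "pe q w = poly (map_poly const2 q) w"

lemma rhom_pe: "rhom (\<lambda>q. pe q w)"
  unfolding pe_def by (rule rhom_comp[OF rhom_poly rhom_map_poly[OF rhom_const2]])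

lemma pe_const [simp]: "pe [:c:] w = const2 c"
  and pe_X: "pe [:0, 1:] w = w"
  and pe_linear: "pe [:- c, 1:] w = w - const2 c"
  by (simp_all add: pe_def map_poly_pCons rhom_minus[OF rhom_const2])

lemma pe_hom:
  assumes "rhom f" "\<And>c. f (const2 c) = const2 c" shows "f (pe q w) = pe q (f w)"
  by (rule rhom_ext1[OF rhom_comp[OF assms(1) rhom_pe] rhom_pe]) (simp_all add: assms(2) pe_X)

lemma pe_diff_dvd: "w - v dvd pe q w - pe q v"
proof (rule poly_alg_induct[of "\<lambda>q. w - v dvd pe q w - pe q v"])
  fix p q assume pq: "w - v dvd pe p w - pe p v" "w - v dvd pe q w - pe q v"
  note r = rhom_add[OF rhom_pe] rhom_mult[OF rhom_pe]
  have "pe (p + q) w - pe (p + q) v = (pe p w - pe p v) + (pe q w - pe q v)" by (simp add: r)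
  then show "w - v dvd pe (p + q) w - pe (p + q) v" using pq by (metis dvd_add)
  have "pe (p * q) w - pe (p * q) v = (pe p w - pe p v) * pe q w + pe p v * (pe q w - pe q v)"
    by (simp add: r algebra_simps)
  then show "w - v dvd pe (p * q) w - pe (p * q) v" using pq by (metis dvd_add dvd_mult dvd_mult2)
qed (simp_all add: pe_X)

lemma pe_at_const: "pe q (const2 c) = const2 (poly q c)"
  by (rule rhom_ext1[OF rhom_pe rhom_comp[OF rhom_const2 rhom_poly]]) (simp_all add: pe_X)

lemma pe_eq_pcompose: "pe q w = pcompose (map_poly (\<lambda>c. [:c:]) q) w"
  by (rule rhom_ext1[OF rhom_pe rhom_comp[OF rhom_pcompose rhom_map_poly[OF rhom_const_poly]]])
    (simp_all add: pe_X map_poly_pCons pcompose_pCons, simp add: const2_def, simp add: one_pCons[symmetric] pcompose_1)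

text \<open>Reduction modulo \<open>X\<close>, hence modulo \<open>z\<close> in coordinates with
  \<open>z = X\<close>.\<close>

definition at0 :: "'c::comm_ring_1 poly poly \<Rightarrow> 'c poly" where
  "at0 = map_poly (\<lambda>p. poly p 0)"

lemma rhom_at0: "rhom at0"
  unfolding at0_def by (rule rhom_map_poly[OF rhom_poly])

lemma at0_simps [simp]: "at0 varX2 = 0" "at0 varY2 = [:0, 1:]" "at0 (const2 c) = [:c:]" "at0 [:q:] = [:poly q 0:]"
  by (simp_all add: at0_def varX2_def varY2_def const2_def map_poly_pCons)

lemma coeff_at0: "coeff (at0 F) j = coeff (coeff F j) 0"
  by (simp add: at0_def coeff_map_poly poly_0_coeff_0)

lemma at0_eq_0_iff: "at0 F = 0 \<longleftrightarrow> varX2 dvd (F :: 'c::comm_ring_1 poly poly)"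
proof
  assume "at0 F = 0"
  then have "coeff (coeff F j) 0 = 0" for j using coeff_at0[of F j] by simp
  then show "varX2 dvd F" by (rule varX_dvd)
next
  assume "varX2 dvd F"
  then obtain G where "F = varX2 * G" by blast
  then show "at0 F = 0" by (simp add: rhom_mult[OF rhom_at0])
qed

lemma at0_pe: "at0 (pe q w) = pcompose q (at0 w)"
  by (rule rhom_ext1[OF rhom_comp[OF rhom_at0 rhom_pe] rhom_pcompose])
    (simp_all add: pe_X pcompose_pCons)

lemma poly_poly_eq:
  fixes F :: "'c::comm_ring_1 poly poly"
  shows "poly (poly F s) t = poly (map_poly (\<lambda>p. poly p t) F) (poly s t)"
  by (rule rhom_ext1[of "\<lambda>F. poly (poly F s) t" "\<lambda>F. poly (map_poly (\<lambda>p. poly p t) F) (poly s t)"])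
    (auto simp: map_poly_pCons intro: rhom_comp[OF rhom_poly rhom_poly] rhom_comp[OF rhom_poly rhom_map_poly[OF rhom_poly]])

lemma monic_linear_prod:
  fixes u :: "'d \<Rightarrow> 'r::idom"
  shows "degree (\<Prod>c\<in>#M. [:- u c, 1:]) = size M \<and> lead_coeff (\<Prod>c\<in>#M. [:- u c, 1:]) = 1"
proof (induction M)
  case (add c M)
  then have "(\<Prod>c\<in>#M. [:- u c, 1:]) \<noteq> 0" by (metis leading_coeff_0_iff zero_neq_one)
  then have d: "degree ([:- u c, 1:] * (\<Prod>c\<in>#M. [:- u c, 1:])) = Suc (size M)"
    using add by (subst degree_mult_eq) simp_all
  have "lead_coeff ([:- u c, 1:] * (\<Prod>c\<in>#M. [:- u c, 1:])) = 1"
    using conjunct2[OF add] by (simp only: lead_coeff_mult) simp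
  then show ?case using d by simp
qed simp

lemma rhom_prod_mset: "rhom f \<Longrightarrow> f (\<Prod>c\<in>#M. g c) = (\<Prod>c\<in>#M. f (g c))"
  by (induction M) (simp_all add: rhom_1 rhom_mult)

lemma unit_poly_poly:
  fixes e :: "'c::field poly poly"
  assumes "e dvd 1" obtains k where "k \<noteq> 0" "e = const2 k"
proof -
  obtain c where c: "e = [:c:]" "c dvd 1" using assms by (auto simp: is_unit_poly_iff)
  then obtain k where "c = [:k:]" "k dvd 1" by (auto simp: is_unit_poly_iff)
  then show ?thesis using that[of k] c by (auto simp: const2_def dvd_field_iff)
qed

context closed_plane
begin

text \<open>Integral closedness of a gcd domain: clearing denominators in \<open>h(w) = e\<close>
  for \<open>w\<close> in lowest terms \<open>\<alpha>1 / \<beta>1\<close> makes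
  \<open>\<beta>1\<close> divide \<open>\<alpha>1^m\<close>, so \<open>\<beta>1\<close> is a
  unit.\<close>

lemma integral_fraction:
  assumes fr: "res \<beta> * w = res \<alpha>" "\<beta> \<noteq> 0" and h: "pe h w = res e" "degree h > 0"
  obtains f where "w = res f"
proof -
  define d where "d = gcd \<alpha> \<beta>"
  have d0: "d \<noteq> 0" using fr(2) by (simp add: d_def)
  define \<alpha>1 \<beta>1 where "\<alpha>1 = \<alpha> div d" and "\<beta>1 = \<beta> div d"
  have ab: "\<alpha> = d * \<alpha>1" "\<beta> = d * \<beta>1" by (simp_all add: \<alpha>1_def \<beta>1_def d_def)
  have cop: "coprime \<alpha>1 \<beta>1" unfolding \<alpha>1_def \<beta>1_def d_def using fr(2) by (intro div_gcd_coprime) simp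
  have "res d * (res \<beta>1 * w) = res d * res \<alpha>1" using fr(1) unfolding ab by (simp add: res_simps mult.assoc)
  then have w1: "res \<beta>1 * w = res \<alpha>1" using d0 res_inj by simp
  define m where "m = degree h"
  have "pe h w = (\<Sum>i\<le>m. const2 (coeff h i) * w ^ i)"
    unfolding pe_def m_def by (rule poly_map_poly_sum) simp_all
  then have "res e * res \<beta>1 ^ m = (\<Sum>i\<le>m. const2 (coeff h i) * w ^ i * res \<beta>1 ^ m)"
    using h(1) by (simp add: sum_distrib_right)
  also have "\<dots> = (\<Sum>i\<le>m. res (const2 (coeff h i) * \<alpha>1 ^ i * \<beta>1 ^ (m - i)))"
  proof (intro sum.cong refl)
    fix i assume i: "i \<in> {..m}"
    have "w ^ i * res \<beta>1 ^ m = (res \<beta>1 * w) ^ i * res \<beta>1 ^ (m - i)"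
      using i by (simp add: power_mult_distrib power_add[symmetric] mult.commute mult.left_commute)
    then show "const2 (coeff h i) * w ^ i * res \<beta>1 ^ m = res (const2 (coeff h i) * \<alpha>1 ^ i * \<beta>1 ^ (m - i))"
      unfolding w1 by (simp add: res_simps eval2_const mult.assoc)
  qed
  finally have "res (e * \<beta>1 ^ m - (\<Sum>i\<le>m. const2 (coeff h i) * \<alpha>1 ^ i * \<beta>1 ^ (m - i))) = 0"
    by (simp add: res_simps rhom_sum[OF rhom_res])
  then have eq: "e * \<beta>1 ^ m = (\<Sum>i\<le>m. const2 (coeff h i) * \<alpha>1 ^ i * \<beta>1 ^ (m - i))"
    unfolding res_inj by simp
  have "m > 0" using h(2) by (simp add: m_def)
  have "{..m} = insert m {..<m}" by auto
  then have "const2 (coeff h m) * \<alpha>1 ^ m = e * \<beta>1 ^ m - (\<Sum>i<m. const2 (coeff h i) * \<alpha>1 ^ i * \<beta>1 ^ (m - i))"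
    unfolding eq by simp
  also have "\<beta>1 dvd \<dots>"
    using \<open>m > 0\<close> by (intro dvd_diff dvd_mult dvd_sum dvd_power) auto
  finally have "\<beta>1 dvd const2 (coeff h m) * \<alpha>1 ^ m" .
  then have "\<beta>1 dvd const2 (inverse (coeff h m)) * (const2 (coeff h m) * \<alpha>1 ^ m)" by (rule dvd_mult)
  moreover have "coeff h m \<noteq> 0" using h(2) by (auto simp: m_def)
  ultimately have "\<beta>1 dvd \<alpha>1 ^ m" by (simp add: mult.assoc[symmetric] const2_mult[symmetric])
  then have "\<beta>1 dvd 1" using cop by (meson coprime_common_divisor coprime_power_left_iff dvd_refl)
  then obtain k where k: "k \<noteq> 0" "\<beta>1 = const2 k" by (rule unit_poly_poly)
  have "w = const2 (inverse k) * (const2 k * w)" using k(1) by (simp add: mult.assoc[symmetric] const2_mult[symmetric])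
  also have "\<dots> = res (const2 (inverse k) * \<alpha>1)" using w1 k(2) by (simp add: res_simps eval2_const)
  finally show ?thesis by (rule that)
qed

lemma sum_rot_const: "(\<Sum>\<zeta> :: 'c | \<zeta> ^ n = 1. F) = const2 (of_nat n) * (F :: 'c poly poly)"
proof -
  have "of_nat (card {\<zeta> :: 'c. \<zeta> ^ n = 1}) = (of_nat n :: 'c)"
    using sum_roots_of_unity_power(2)[OF n_pos n_nz, of 0] by simp
  then have "const2 (of_nat (card {\<zeta> :: 'c. \<zeta> ^ n = 1})) = (const2 (of_nat n) :: 'c poly poly)" by (simp only:)
  then have "of_nat (card {\<zeta> :: 'c. \<zeta> ^ n = 1}) = (const2 (of_nat n) :: 'c poly poly)"
    by (simp only: rhom_of_nat[OF rhom_const2])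
  then show ?thesis by (simp only: sum_constant)
qed

text \<open>As \<open>X\<close> is an eigenvector, \<open>rot \<zeta> Y = \<gamma> Y + q(X)\<close>,
  and triviality modulo \<open>X\<close> gives \<open>\<gamma> = 1\<close>. The average is
  \<open>n Y + Q(X)\<close> with a constant denominator \<open>b0^M\<close>.\<close>

lemma structure_const:
  assumes z: "z = varX2" and b: "b = const2 b0"
  shows "\<exists>r f. varY2 - [:r:] = res f"
proof -
  have "\<exists>q. rot \<zeta> varY2 = varY2 + [:q:]" if \<zeta>: "\<zeta> ^ n = 1" for \<zeta>
  proof -
    obtain P Q where PQ: "varX2 = ev P" "varY2 = ev Q" using surj by (metis surjD)
    have U: "F \<in> pset (pset UNIV)" "H \<in> pset (pset (pset UNIV))" for F :: "'c poly poly" and H :: "'c poly poly poly"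
      by (simp_all add: pset_def)
    have "sring (UNIV :: 'c set)" by (simp add: sring_def)
    from autp_rot[OF this UNIV_I \<zeta> U(1) U(1) U(1) U(2) U(2) PQ(1)[symmetric] PQ(2)[symmetric]]
    have aut: "autp UNIV (rot \<zeta>) (rot (\<zeta> ^ (n - 1)))" .
    have "\<zeta> \<noteq> 0" using \<zeta> n_pos by (auto simp: power_0_left)
    then obtain \<gamma> q where q: "rot \<zeta> varY2 = const2 \<gamma> * varY2 + [:q:]"
      using shear_shape[OF aut] rot_z[OF \<zeta>] unfolding z by metis
    have "varX2 dvd rot \<zeta> varY2 - varY2" using rot_cong_z[OF \<zeta>, of varY2] by (simp add: z)
    then have "at0 (rot \<zeta> varY2 - varY2) = 0" by (simp add: at0_eq_0_iff)
    then have "coeff (at0 (rot \<zeta> varY2 - varY2)) 1 = 0" by simp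
    then have "\<gamma> = 1" unfolding coeff_at0 q by (simp add: coeff_varY)
    then show ?thesis using q by auto
  qed
  then obtain q where q: "\<And>\<zeta>. \<zeta> ^ n = 1 \<Longrightarrow> rot \<zeta> varY2 = varY2 + [:q \<zeta>:]" by metis
  define Q where "Q = (\<Sum>\<zeta> | \<zeta> ^ n = 1. q \<zeta>)"
  have "(\<Sum>\<zeta> | \<zeta> ^ n = 1. rot \<zeta> varY2) = (\<Sum>\<zeta> | \<zeta> ^ n = 1. varY2 + [:q \<zeta>:])"
    by (intro sum.cong refl) (simp add: q)
  also have "\<dots> = const2 (of_nat n) * varY2 + [:Q:]"
    unfolding sum.distrib sum_rot_const Q_def by (simp add: rhom_sum[OF rhom_const_poly])
  finally have s: "(\<Sum>\<zeta> | \<zeta> ^ n = 1. rot \<zeta> varY2) = const2 (of_nat n) * varY2 + [:Q:]" .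
  obtain M f where "res b ^ M * (\<Sum>\<zeta> | \<zeta> ^ n = 1. rot \<zeta> varY2) = res f" by (rule rot_average)
  then have f: "const2 (b0 ^ M) * (const2 (of_nat n) * varY2 + [:Q:]) = res f"
    by (simp add: s b eval2_const rhom_power[OF rhom_const2])
  have b0: "b0 \<noteq> 0" using b b_nz by auto
  define \<kappa> where "\<kappa> = inverse (b0 ^ M * of_nat n)"
  have k1: "\<kappa> * b0 ^ M * of_nat n = 1" using b0 n_nz by (simp add: \<kappa>_def field_simps)
  have "res (const2 \<kappa> * f) = const2 (\<kappa> * b0 ^ M) * (const2 (of_nat n) * varY2 + [:Q:])"
    unfolding rhom_mult[OF rhom_res] f[symmetric] by (simp add: eval2_const const2_mult mult.assoc)
  also have "\<dots> = const2 (\<kappa> * b0 ^ M * of_nat n) * varY2 + const2 (\<kappa> * b0 ^ M) * [:Q:]"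
    by (simp add: const2_mult algebra_simps)
  also have "\<dots> = varY2 - [:- smult (\<kappa> * b0 ^ M) Q:]" by (simp add: k1) (simp add: const2_def)
  finally show ?thesis by metis
qed

text \<open>Modulo \<open>b\<close>, the ring \<open>k[x, y]\<close> is generated by one element
  \<open>\<rho>\<close> lifting \<open>Y\<close> modulo \<open>X\<close>. A value \<open>c\<close>
  of \<open>\<rho>\<close> therefore determines \<open>x\<close> and \<open>y\<close> on the curve
  \<open>b = 0\<close>, and then \<open>Y\<close> as a polynomial in \<open>X = z\<close>.\<close>

lemma structure_nonconst:
  assumes z: "z = varX2" and nb: "\<And>b0. b \<noteq> const2 b0"
  shows "\<exists>r h f. varY2 - [:r:] = res f \<and> res b = pe h (varY2 - [:r:])"
proof -
  define bh where "bh = res b"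
  have bh0: "bh \<noteq> 0" using res_inj b_nz by (simp add: bh_def)
  note re = endo_of_eval2[of x y]
  note A0 = rhom_simps[OF rhom_at0]
  obtain G where G: "varY2 = ev G" using surj by (metis surjD)
  obtain g0 G1 where G1: "G = pCons g0 G1" by (cases G)
  define \<rho> where "\<rho> = res g0"
  have Y: "varY2 = \<rho> + varX2 * ev G1" using G unfolding G1 eval3_pCons[OF rhom_const2] \<rho>_def z .
  have at0\<rho>: "at0 \<rho> = [:0, 1:]" using arg_cong[OF Y, of at0] by (simp add: A0)
  \<comment> \<open>The difference lies in \<open>k[x, y]\<close> and vanishes modulo
    \<open>z\<close>, so it is a multiple of \<open>res a = bh * z ^ n\<close>.\<close>
  have key: "bh dvd res f - pe (at0 (res f)) \<rho>" for f
  proof -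
    define q where "q = at0 (res f)"
    have eq: "res f - pe q \<rho> = res (f - pe q g0)"
      by (simp add: res_simps \<rho>_def pe_hom[OF rhom_res] eval2_const)
    have "at0 (res (f - pe q g0)) = 0"
      unfolding eq[symmetric] by (simp add: A0 at0_pe at0\<rho> q_def pcompose_idR)
    then obtain w where "res (f - pe q g0) = z * w" unfolding at0_eq_0_iff z by blast
    then obtain f1 where "f - pe q g0 = a * f1" by (rule res_dvd_z)
    then have "res (f - pe q g0) = bh * (z ^ n * res f1)"
      by (simp add: res_simps rel[symmetric] bh_def mult.assoc)
    then show ?thesis unfolding eq[unfolded q_def] q_def by simp
  qed
  define \<beta> where "\<beta> = at0 bh"
  have "bh dvd bh - (bh - pe \<beta> \<rho>)" using dvd_diff[OF dvd_refl key[of b]] by (simp only: bh_def \<beta>_def)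
  then have dvd_\<beta>: "bh dvd pe \<beta> \<rho>" by simp
  have \<beta>0: "\<beta> \<noteq> 0"
  proof
    assume "\<beta> = 0"
    then obtain w where "res b = z * w" unfolding \<beta>_def at0_eq_0_iff z bh_def by blast
    then obtain f1 where "b = a * f1" by (rule res_dvd_z)
    then have "bh * (z ^ n * res f1) = bh * 1" using rel by (simp add: bh_def res_simps mult.assoc[symmetric])
    then have "varX2 ^ n * res f1 = 1" unfolding z using bh0 by simp
    then have "at0 (varX2 ^ n * res f1) = 1" by (simp add: A0)
    then show False using n_pos by (simp add: A0 power_0_left)
  qed
  have bh_nonunit: "\<not> bh dvd 1"
  proof
    assume "bh dvd 1"
    then obtain k where "bh = const2 k" by (rule unit_poly_poly)
    then have "res (b - const2 k) = 0" by (simp add: res_simps eval2_const bh_def)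
    then show False using nb[of k] unfolding res_inj by simp
  qed
  have d\<beta>: "degree \<beta> > 0"
  proof (rule ccontr)
    assume "\<not> degree \<beta> > 0"
    then obtain e where e: "\<beta> = [:e:]" by (metis degree_eq_zeroE not_gr_zero)
    then have "e \<noteq> 0" using \<beta>0 by simp
    have "bh dvd const2 (inverse e) * pe \<beta> \<rho>" using dvd_\<beta> by (rule dvd_mult)
    then have "bh dvd 1" using \<open>e \<noteq> 0\<close> by (simp add: e const2_mult[symmetric])
    then show False using bh_nonunit by blast
  qed
  \<comment> \<open>Modulo \<open>bh\<close> and \<open>\<rho> - c\<close>, \<open>x\<close> and
    \<open>y\<close> are the constants \<open>\<xi> c\<close> and \<open>\<eta> c\<close>. Since
    \<open>Y = G(x, y, z)\<close> with \<open>z = X\<close>, \<open>Y\<close> becomes the polynomial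
    \<open>u c\<close> in \<open>X\<close>.\<close>
  define \<xi> \<eta> where "\<xi> c = poly (at0 x) c" and "\<eta> c = poly (at0 y) c" for c
  define E where "E c = eval3 (\<lambda>k. [:k:]) [:\<xi> c:] [:\<eta> c:] [:0, 1:]" for c
  define u where "u c = E c G" for c
  note rE = rhom_eval3[OF rhom_const_poly]
  define I where "I c = {bh * A + (\<rho> - const2 c) * B | A B. True}" for c
  have I_add: "F + H \<in> I c" if FH: "F \<in> I c" "H \<in> I c" for F H c
  proof -
    obtain A B A' B' where "F = bh * A + (\<rho> - const2 c) * B" "H = bh * A' + (\<rho> - const2 c) * B'"
      using FH by (auto simp: I_def)
    then have "F + H = bh * (A + A') + (\<rho> - const2 c) * (B + B')" by (simp only:) (simp only: algebra_simps)
    then show ?thesis unfolding I_def by blast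
  qed
  have I_mult: "F * H \<in> I c" if F: "F \<in> I c" for F H c
  proof -
    obtain A B where "F = bh * A + (\<rho> - const2 c) * B" using F by (auto simp: I_def)
    then have "F * H = bh * (A * H) + (\<rho> - const2 c) * (B * H)" by (simp only:) (simp only: algebra_simps)
    then show ?thesis unfolding I_def by blast
  qed
  have I_bh: "F \<in> I c" if "bh dvd F" for F c
  proof -
    obtain A where "F = bh * A" using \<open>bh dvd F\<close> by (rule dvdE)
    then have "F = bh * A + (\<rho> - const2 c) * 0" by simp
    then show ?thesis unfolding I_def by blast
  qed
  have I_\<rho>: "F \<in> I c" if "\<rho> - const2 c dvd F" for F c
  proof -
    obtain B where "F = (\<rho> - const2 c) * B" using \<open>\<rho> - const2 c dvd F\<close> by (rule dvdE)
    then have "F = bh * 0 + (\<rho> - const2 c) * B" by simp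
    then show ?thesis unfolding I_def by blast
  qed
  have I_res: "res f - const2 (poly (at0 (res f)) c) \<in> I c" for f c
  proof -
    have "pe (at0 (res f)) \<rho> - const2 (poly (at0 (res f)) c) \<in> I c"
      unfolding pe_at_const[symmetric] by (rule I_\<rho>[OF pe_diff_dvd])
    from I_add[OF I_bh[OF key[of f]] this] show ?thesis by simp
  qed
  have I_ev: "ev F - [:E c F:] \<in> I c" for F c
  proof (rule poly3_alg_induct[of "\<lambda>F. ev F - [:E c F:] \<in> I c"])
    have 0: "0 \<in> I c" by (rule I_bh) simp
    show "ev [:const2 k:] - [:E c [:const2 k:]:] \<in> I c" for k
      using 0 by (simp add: E_def eval3_const eval2_const) (simp add: const2_def)
    show "ev [:varX2:] - [:E c [:varX2:]:] \<in> I c"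
      using I_res[of varX2 c] by (simp add: E_def eval3_const eval2_varX rhom_const2 rhom_const_poly \<xi>_def const2_def)
    show "ev [:varY2:] - [:E c [:varY2:]:] \<in> I c"
      using I_res[of varY2 c] by (simp add: E_def eval3_const eval2_varY rhom_const2 rhom_const_poly \<eta>_def const2_def)
    show "ev varZ3 - [:E c varZ3:] \<in> I c"
      using 0 by (simp add: E_def eval3_varZ rhom_const2 rhom_const_poly z) (simp add: varX2_def)
    fix F H assume FH: "ev F - [:E c F:] \<in> I c" "ev H - [:E c H:] \<in> I c"
    show "ev (F + H) - [:E c (F + H):] \<in> I c"
      using I_add[OF FH] by (simp add: E_def rhom_add[OF rE] rhom_add[OF rhom_ev] algebra_simps)
    have "ev (F * H) - [:E c (F * H):] = (ev F - [:E c F:]) * ev H + (ev H - [:E c H:]) * [:E c F:]"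
      by (simp only: E_def rhom_mult[OF rE] rhom_mult[OF rhom_ev] rhom_mult[OF rhom_const_poly]) (simp only: algebra_simps)
    then show "ev (F * H) - [:E c (F * H):] \<in> I c"
      using I_add[OF I_mult[OF FH(1)] I_mult[OF FH(2)]] by (simp only:)
  qed
  have I_u: "[:- u c, 1:] \<in> I c" for c
    using I_ev[of G c] unfolding G[symmetric] by (simp add: u_def varY2_def)
  obtain M where M: "size M = degree \<beta>" "\<beta> = smult (lead_coeff \<beta>) (\<Prod>c\<in>#M. [:- c, 1:])"
    using alg_closed_imp_factorization[OF \<beta>0] by blast
  define e where "e = lead_coeff \<beta>"
  have e0: "e \<noteq> 0" using \<beta>0 by (simp add: e_def)
  have \<beta>eq: "\<beta> = [:e:] * (\<Prod>c\<in>#M. [:- c, 1:])" using M(2) by (simp add: e_def)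
  have pe\<beta>: "pe \<beta> \<rho> = const2 e * (\<Prod>c\<in>#M. \<rho> - const2 c)"
    unfolding \<beta>eq by (simp only: rhom_mult[OF rhom_pe] rhom_prod_mset[OF rhom_pe] pe_const pe_linear)
  have "bh dvd const2 (inverse e) * pe \<beta> \<rho>" using dvd_\<beta> by (rule dvd_mult)
  then have dvd_prod: "bh dvd (\<Prod>c\<in>#M. \<rho> - const2 c)"
    using e0 by (simp add: pe\<beta> mult.assoc[symmetric] const2_mult[symmetric])
  define N where "N = (\<Prod>c\<in>#M. [:- u c, 1:])"
  \<comment> \<open>The relations \<open>Y - u c \<in> I c\<close> are multiplied over all roots
    \<open>c\<close> of \<open>\<beta>\<close>, with multiplicity.\<close>
  have "\<exists>V W. (\<Prod>c\<in>#M. [:- u c, 1:]) = (\<Prod>c\<in>#M. \<rho> - const2 c) * W + bh * V"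
  proof (induction M)
    case empty
    show ?case by (intro exI[of _ 0] exI[of _ 1]) simp
  next
    case (add c M)
    then obtain V W where VW: "(\<Prod>c\<in>#M. [:- u c, 1:]) = (\<Prod>c\<in>#M. \<rho> - const2 c) * W + bh * V" by blast
    obtain A B where AB: "[:- u c, 1:] = bh * A + (\<rho> - const2 c) * B" using I_u[of c] by (auto simp: I_def)
    have "(\<Prod>c\<in>#add_mset c M. [:- u c, 1:]) = (bh * A + (\<rho> - const2 c) * B) * ((\<Prod>c\<in>#M. \<rho> - const2 c) * W + bh * V)"
      by (simp only: image_mset_add_mset prod_mset.add_mset AB VW)
    also have "\<dots> = (\<Prod>c\<in>#add_mset c M. \<rho> - const2 c) * (B * W) +
        bh * (A * ((\<Prod>c\<in>#M. \<rho> - const2 c) * W + bh * V) + (\<rho> - const2 c) * B * V)"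
      by (simp add: algebra_simps)
    finally show ?case by blast
  qed
  then have "bh dvd N" using dvd_prod unfolding N_def by (metis dvd_add dvd_mult2 dvd_triv_left)
  then obtain W where W: "N = bh * W" by blast
  have N: "degree N = size M" "lead_coeff N = 1" 
    using monic_linear_prod[of u M] unfolding N_def by (rule conjunct1, rule conjunct2)
  have W0: "W \<noteq> 0" using W N by auto
  \<comment> \<open>Degrees in \<open>Y\<close>: \<open>bh\<close> divides the monic
    \<open>N\<close> of degree \<open>degree \<beta> \<le> degree bh\<close>, so the cofactor
    \<open>W\<close> has degree \<open>0\<close> and an invertible leading coefficient.\<close>
  have "degree \<beta> \<le> degree bh" unfolding \<beta>_def at0_def by (rule map_poly_degree_leq)
  moreover have "degree N = degree bh + degree W" unfolding W using bh0 W0 by (rule degree_mult_eq)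
  ultimately have "degree W = 0" using N(1) M(1) by simp
  then obtain w where w: "W = [:w:]" by (metis degree_eq_zeroE)
  have "lead_coeff bh * w = 1" using N(2) unfolding W lead_coeff_mult by (simp add: w)
  then have "w dvd 1" by (metis dvd_triv_right)
  then have "W dvd 1" by (simp add: w is_unit_poly_iff)
  then obtain w0 where w0: "w0 \<noteq> 0" "W = const2 w0" by (rule unit_poly_poly)
  have bhN: "bh = const2 (inverse w0) * N"
    unfolding W w0(2) using w0(1) by (simp add: mult.assoc[symmetric] const2_mult[symmetric] mult.commute[of bh])
  have u0: "poly (u c) 0 = c" for c
  proof -
    have r0: "rhom (\<lambda>F. poly (at0 F) c)" by (rule rhom_comp[OF rhom_poly rhom_at0])
    have "poly (u c) 0 = eval3 (\<lambda>k. k) (\<xi> c) (\<eta> c) 0 G"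
      unfolding u_def E_def using eval3_comp[OF rhom_poly[of 0] rhom_const_poly, of "[:\<xi> c:]" "[:\<eta> c:]" "[:0, 1:]" G] by simp
    also have "\<dots> = eval2 (\<lambda>k. k) (\<xi> c) (\<eta> c) g0" unfolding G1 by (simp add: eval3_pCons rhom_id)
    also have "\<dots> = poly (at0 \<rho>) c"
      unfolding \<rho>_def using eval2_comp[OF r0 rhom_const2, of x y g0] by (simp add: \<xi>_def \<eta>_def)
    also have "\<dots> = c" by (simp add: at0\<rho>)
    finally show ?thesis .
  qed
  \<comment> \<open>On the curve \<open>Y = u c\<close> the product \<open>\<beta>(\<rho>)\<close>
    vanishes, so \<open>\<rho>\<close> is constantly equal to a root of \<open>\<beta>\<close>; its
    value at \<open>X = 0\<close> is \<open>c\<close>.\<close>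
  have \<rho>u: "poly \<rho> (u c) = [:c:]" if c: "c \<in># M" for c
  proof -
    have "[:- u c, 1:] dvd N" unfolding N_def using c by (intro dvd_prod_mset) auto
    then obtain T where "N = [:- u c, 1:] * T" by blast
    then have "poly bh (u c) = 0" unfolding bhN by simp
    then have "poly (pe \<beta> \<rho>) (u c) = 0" using dvd_\<beta> by (metis dvd_def mult_zero_left poly_mult)
    then have "poly (\<Prod>c\<in>#M. \<rho> - const2 c) (u c) = 0" using e0 unfolding pe\<beta> by (simp add: const2_def)
    then have "(\<Prod>c'\<in>#M. poly (\<rho> - const2 c') (u c)) = 0" using rhom_prod_mset[OF rhom_poly[of "u c"], of "\<lambda>c. \<rho> - const2 c" M] by simp
    then obtain c' where c': "poly (\<rho> - const2 c') (u c) = 0" by (auto simp: prod_mset_zero_iff)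
    then have 1: "poly \<rho> (u c) = [:c':]" by (simp add: const2_def)
    have "poly (poly \<rho> (u c)) 0 = poly (at0 \<rho>) (poly (u c) 0)" unfolding at0_def by (rule poly_poly_eq)
    then have "c' = c" using 1 by (simp add: at0\<rho> u0)
    then show ?thesis using 1 by simp
  qed
  \<comment> \<open>Curves for different \<open>c\<close> carry different constant values of
    \<open>\<rho>\<close> and cannot meet, whereas a nonconstant difference would have a
    zero.\<close>
  have const_diff: "\<exists>d. u c = u c' + [:d:]" if c: "c \<in># M" "c' \<in># M" for c c'
  proof -
    have "degree (u c - u c') = 0"
    proof (rule ccontr)
      assume deg: "degree (u c - u c') \<noteq> 0"
      then obtain t where "poly (u c - u c') t = 0" using alg_closed_imp_poly_has_root by blast
      then have t: "poly (u c) t = poly (u c') t" by simp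
      have "poly (poly \<rho> (u c)) t = poly (poly \<rho> (u c')) t" unfolding poly_poly_eq t ..
      then have "c = c'" by (simp add: \<rho>u c)
      then show False using deg by simp
    qed
    then obtain d where "u c - u c' = [:d:]" by (metis degree_eq_zeroE)
    then have "u c = u c' + [:d:]" by (simp add: algebra_simps)
    then show ?thesis by blast
  qed
  have "M \<noteq> {#}" using M(1) d\<beta> by auto
  then obtain c0 where c0: "c0 \<in># M" by blast
  define r where "r = u c0"
  define U where "U = varY2 - [:r:]"
  obtain d where d: "\<And>c. c \<in># M \<Longrightarrow> u c = r + [:d c:]" using const_diff[OF _ c0] unfolding r_def by metis
  define h where "h = [:inverse w0:] * (\<Prod>c\<in>#M. [:- d c, 1:])"
  have degh: "degree h = size M" unfolding h_def using w0(1) monic_linear_prod[of d M] by simp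
  have Neq: "N = (\<Prod>c\<in>#M. U - const2 (d c))"
    unfolding N_def
  proof (intro arg_cong[of _ _ prod_mset] image_mset_cong)
    fix c assume "c \<in># M"
    then show "[:- u c, 1:] = U - const2 (d c)" by (simp add: d U_def varY2_def const2_def)
  qed
  have bh_h: "bh = pe h U"
    unfolding bhN Neq h_def
    by (simp only: rhom_mult[OF rhom_pe] rhom_prod_mset[OF rhom_pe] pe_const pe_linear)
  have dh: "degree h > 0" using degh M(1) d\<beta> by simp
  \<comment> \<open>From \<open>h(w) = h(U)\<close> for \<open>w = rot \<zeta> U\<close>,
    \<open>w\<close> is linear in \<open>Y\<close> with constant leading coefficient, equal to
    \<open>1\<close> by reduction modulo \<open>X\<close>. Evaluation at \<open>Y = r\<close> makes
    the remaining shift \<open>s(X)\<close> constant, and reduction modulo \<open>X\<close> makes it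
    \<open>0\<close>.\<close>
  have rotU: "rot \<zeta> U = U" if \<zeta>: "\<zeta> ^ n = 1" for \<zeta>
  proof -
    define w where "w = rot \<zeta> U"
    note er = endo_rot[OF \<zeta>]
    have hw: "pe h w = pe h U"
      unfolding w_def using pe_hom[OF endo_rhom[OF er] endo_const[OF er], of h U] rot_res[OF \<zeta>, of b] bh_h by (simp add: bh_def)
    define hh where "hh = map_poly (\<lambda>c. [:c:]) h"
    have dhh: "degree hh = degree h" unfolding hh_def by (rule degree_map_poly) simp
    have hw': "pcompose hh w = pcompose hh U" using hw unfolding pe_eq_pcompose hh_def .
    have dU: "degree U = 1" "lead_coeff U = 1" by (simp_all add: U_def varY2_def)
    have dw: "degree w = 1" using arg_cong[OF hw', of degree] dh dU dhh by (simp add: degree_pcompose)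
    have "lead_coeff hh * coeff w 1 ^ degree hh = lead_coeff hh * 1"
      using arg_cong[OF hw', of lead_coeff] dw dU by (simp add: lead_coeff_comp)
    moreover have "lead_coeff hh \<noteq> 0" using dhh dh by (metis degree_0 leading_coeff_0_iff less_irrefl)
    ultimately have ep: "coeff w 1 ^ degree hh = 1" using mult_left_cancel by blast
    have X: "varX2 dvd w - U" using rot_cong_z[OF \<zeta>, of U] by (simp add: w_def z)
    have "coeff w 1 \<noteq> 0" using dw by (metis leading_coeff_0_iff degree_0 zero_neq_one)
    then have "degree hh * degree (coeff w 1) = 0" using arg_cong[OF ep, of degree] by (simp add: degree_power_eq)
    then obtain \<epsilon> where \<epsilon>: "coeff w 1 = [:\<epsilon>:]" using dh dhh by (metis degree_eq_zeroE less_irrefl mult_eq_0_iff)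
    have "coeff (at0 (w - U)) 1 = 0" using X at0_eq_0_iff by (metis coeff_0)
    then have "\<epsilon> = 1" unfolding coeff_at0 by (simp add: \<epsilon>[simplified] U_def varY2_def)
    define s where "s = coeff w 0 + r"
    have weq: "w = U + [:s:]"
    proof (rule poly_eqI)
      fix i :: nat
      have "i = 0 \<or> i = 1 \<or> i > 1" by linarith
      then show "coeff w i = coeff (U + [:s:]) i"
        using dw \<epsilon> \<open>\<epsilon> = 1\<close> by (auto simp: U_def varY2_def s_def coeff_eq_0 coeff_pCons one_pCons split: nat.splits)
    qed
    have "poly (pe h w) r = poly (pe h U) r" by (simp add: hw)
    moreover have pr: "poly (pe h v) r = pcompose h (poly v r)" for v
      by (rule rhom_ext1[OF rhom_comp[OF rhom_poly rhom_pe] rhom_pcompose])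
        (simp_all add: pe_X pcompose_pCons, simp add: const2_def)
    moreover have "poly U r = 0" by (simp add: U_def varY2_def)
    ultimately have "pcompose h s = pcompose h 0" by (simp add: weq)
    then have "degree h * degree s = 0" by (metis degree_pcompose degree_0 mult_0_right)
    then obtain s0 where s0: "s = [:s0:]" using dh by (metis degree_eq_zeroE less_irrefl mult_eq_0_iff)
    have "at0 (w - U) = 0" using X at0_eq_0_iff by blast
    then have "s0 = 0" by (simp add: weq s0)
    then show ?thesis using weq s0 by (simp add: w_def)
  qed
  have "(\<Sum>\<zeta> | \<zeta> ^ n = 1. rot \<zeta> U) = (\<Sum>\<zeta> :: 'c | \<zeta> ^ n = 1. U)" by (intro sum.cong refl) (simp add: rotU)
  then have s: "(\<Sum>\<zeta> | \<zeta> ^ n = 1. rot \<zeta> U) = const2 (of_nat n) * U" by (simp only: sum_rot_const)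
  obtain K f where "res b ^ K * (\<Sum>\<zeta> | \<zeta> ^ n = 1. rot \<zeta> U) = res f" by (rule rot_average)
  then have "res (b ^ K * const2 (of_nat n)) * U = res f" unfolding s by (simp add: res_simps eval2_const mult.assoc)
  moreover have "b ^ K * const2 (of_nat n) \<noteq> 0" using b_nz n_nz by simp
  moreover have "pe h U = res b" using bh_h by (simp add: bh_def)
  ultimately obtain f' where "U = res f'" using dh by (rule integral_fraction)
  then show ?thesis using bh_h unfolding U_def bh_def by blast
qed

lemma plane_structure:
  assumes "z = varX2"
  shows "\<exists>r h f. varY2 - [:r:] = res f \<and> res b = pe h (varY2 - [:r:])"
proof (cases "\<exists>b0. b = const2 b0")
  case True
  then obtain b0 where b0: "b = const2 b0" by blast
  then have "res b = pe [:b0:] w" for w by (simp add: eval2_const)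
  then show ?thesis using structure_const[OF assms b0] by blast
next
  case False
  then show ?thesis using structure_nonconst[OF assms] by blast
qed

end

section \<open>Descent from the algebraic closure\<close>

definition lift2 :: "('c::comm_ring_1 \<Rightarrow> 'd::comm_ring_1) \<Rightarrow> 'c poly poly \<Rightarrow> 'd poly poly" where
  "lift2 f = map_poly (map_poly f)"

definition lift3 :: "('c::comm_ring_1 \<Rightarrow> 'd::comm_ring_1) \<Rightarrow> 'c poly poly poly \<Rightarrow> 'd poly poly poly" where
  "lift3 f = map_poly (lift2 f)"

lemma rhom_inj: assumes "rhom (f :: 'c::field \<Rightarrow> 'd::field)" shows "f c = 0 \<longleftrightarrow> c = 0"
proof
  assume "f c = 0"
  then have "f (c * inverse c) = 0" by (simp add: rhom_mult[OF assms])
  then show "c = 0" using rhom_1[OF assms] by (cases "c = 0") auto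
qed (simp add: rhom_0[OF assms])

context
  fixes f :: "'c::field \<Rightarrow> 'd::field"
  assumes f: "rhom f"
begin

lemma rhom_lift2: "rhom (lift2 f)" and rhom_lift3: "rhom (lift3 f)"
  unfolding lift2_def lift3_def by (intro rhom_map_poly f)+

lemma coeff_lift2: "coeff (coeff (lift2 f F) j) i = f (coeff (coeff F j) i)"
  by (simp add: lift2_def coeff_map_poly rhom_0[OF f])

lemma lift2_simps [simp]: "lift2 f varX2 = varX2" "lift2 f varY2 = varY2" "lift2 f (const2 c) = const2 (f c)"
  by (simp_all add: lift2_def varX2_def varY2_def const2_def map_poly_pCons rhom_0[OF f] rhom_1[OF f])

lemma lift3_simps [simp]: "lift3 f varZ3 = varZ3" "lift3 f [:F:] = [:lift2 f F:]"
  by (simp_all add: lift3_def varZ3_def map_poly_pCons rhom_0[OF rhom_lift2] rhom_1[OF rhom_lift2])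

lemma lift2_inj: "lift2 f F = lift2 f G \<longleftrightarrow> F = G"
proof
  assume "lift2 f F = lift2 f G"
  then have "f (coeff (coeff F j) i - coeff (coeff G j) i) = 0" for i j
    unfolding rhom_diff[OF f] coeff_lift2[symmetric] by simp
  then show "F = G" by (intro poly_poly_eqI) (simp add: rhom_inj[OF f])
qed simp

lemma lift2_eval2:
  "lift2 f (eval2 const2 x y F) = eval2 const2 (lift2 f x) (lift2 f y) (lift2 f F)"
  by (rule rhom_ext2[of "\<lambda>F. lift2 f (eval2 const2 x y F)" "\<lambda>F. eval2 const2 (lift2 f x) (lift2 f y) (lift2 f F)"])
    (simp_all add: eval2_const eval2_varX eval2_varY rhom_const2 rhom_comp[OF rhom_lift2 rhom_eval2]
      rhom_comp[OF rhom_eval2 rhom_lift2])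

lemma lift2_eval3:
  "lift2 f (eval3 const2 x y z F) = eval3 const2 (lift2 f x) (lift2 f y) (lift2 f z) (lift3 f F)"
  by (rule rhom_ext3[of "\<lambda>F. lift2 f (eval3 const2 x y z F)"
        "\<lambda>F. eval3 const2 (lift2 f x) (lift2 f y) (lift2 f z) (lift3 f F)"])
    (simp_all add: eval3_const eval3_varZ eval2_const eval2_varX eval2_varY rhom_const2
      rhom_comp[OF rhom_lift2 rhom_eval3] rhom_comp[OF rhom_eval3 rhom_lift3])

lemma lift3_eval2:
  "lift3 f (eval2 const3 x y F) = eval2 const3 (lift3 f x) (lift3 f y) (lift2 f F)"
  by (rule rhom_ext2[of "\<lambda>F. lift3 f (eval2 const3 x y F)" "\<lambda>F. eval2 const3 (lift3 f x) (lift3 f y) (lift2 f F)"])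
    (simp_all add: eval2_const eval2_varX eval2_varY rhom_const3 rhom_comp[OF rhom_lift3 rhom_eval2]
      rhom_comp[OF rhom_eval2 rhom_lift2])

lemma lift_mem: "lift2 f F \<in> pset (pset (range f))" "lift3 f G \<in> pset (pset (pset (range f)))"
  by (simp_all add: pset_def coeff_lift2, simp add: lift3_def coeff_map_poly rhom_0[OF rhom_lift2] coeff_lift2)

lemma pset_range_lift:
  assumes "F \<in> pset (pset (range f))" obtains G where "F = lift2 f G"
proof -
  have 1: "\<exists>q. p = map_poly h q" if "p \<in> pset (range h)" "h 0 = 0" for p :: "'r::comm_ring_1 poly" and h :: "'s::comm_ring_1 \<Rightarrow> 'r"
  proof -
    have "map_poly h (map_poly (\<lambda>x. if x = 0 then 0 else inv_into UNIV h x) p) = p"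
      using that by (intro poly_eqI) (auto simp: coeff_map_poly pset_def intro: f_inv_into_f)
    then show ?thesis by metis
  qed
  have "pset (range f) \<subseteq> range (map_poly f)" using 1[of _ f] rhom_0[OF f] by blast
  then have "F \<in> pset (range (map_poly f))" using assms by (auto simp: pset_def)
  then show ?thesis using 1[of F "map_poly f"] that by (auto simp: lift2_def)
qed

lemma rhom_dvd: "rhom h \<Longrightarrow> u dvd v \<Longrightarrow> h u dvd h v"
  by (auto simp: rhom_mult elim!: dvdE)

text \<open>The kernel after base change is found by a section: \<open>\<Theta>\<close> is a right
  inverse of the new evaluation, and \<open>F - \<Theta> (ev' F)\<close> is a multiple of
  \<open>g'\<close> since this holds for the generators, which come from below, and passes to sums
  and products.\<close>

lemma plane_lift:
  assumes "plane a b n x y z"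
  shows "plane (lift2 f a) (lift2 f b) n (lift2 f x) (lift2 f y) (lift2 f z)"
proof -
  interpret plane a b n x y z by (rule assms)
  define ev' where "ev' = eval3 const2 (lift2 f x) (lift2 f y) (lift2 f z)"
  define g' where "g' = [:lift2 f b:] * varZ3 ^ n - [:lift2 f a:]"
  have lg: "lift3 f g = g'"
    by (simp only: g'_def rhom_simps[OF rhom_lift3] lift3_simps)
  have rev': "rhom ev'" unfolding ev'_def by (rule rhom_eval3[OF rhom_const2])
  obtain P Q where P: "ev P = varX2" and Q: "ev Q = varY2" using surj by (metis surjD)
  have PQ': "ev' (lift3 f P) = varX2" "ev' (lift3 f Q) = varY2"
    unfolding ev'_def lift2_eval3[symmetric] P Q by simp_all
  define \<Theta> where "\<Theta> = eval2 const3 (lift3 f P) (lift3 f Q)"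
  have r\<Theta>: "rhom \<Theta>" unfolding \<Theta>_def by (rule rhom_eval2[OF rhom_const3])
  have ev\<Theta>: "ev' (\<Theta> F) = F" for F
    unfolding \<Theta>_def eval2_comp[OF rev' rhom_const3] PQ'
    by (simp add: ev'_def eval3_const eval2_const eval2_id)
  have base: "g' dvd lift3 f F - \<Theta> (lift2 f (ev F))" for F
  proof -
    have "ev (eval2 const3 P Q w) = w" for w
      unfolding eval2_comp[OF rhom_ev rhom_const3] P Q by (simp add: ev_const eval2_const eval2_id)
    then have "ev (F - eval2 const3 P Q (ev F)) = 0" by (simp add: rhom_diff[OF rhom_ev])
    then have "g dvd F - eval2 const3 P Q (ev F)" unfolding ker .
    from rhom_dvd[OF rhom_lift3 this]
    have "g' dvd lift3 f (F - eval2 const3 P Q (ev F))" unfolding lg .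
    then show ?thesis unfolding rhom_diff[OF rhom_lift3] lift3_eval2 \<Theta>_def .
  qed
  have all: "g' dvd F - \<Theta> (ev' F)" for F
  proof (rule poly3_alg_induct[of "\<lambda>F. g' dvd F - \<Theta> (ev' F)"])
    show "g' dvd [:const2 c:] - \<Theta> (ev' [:const2 c:])" for c
      by (simp add: ev'_def eval3_const eval2_const \<Theta>_def)
    show "g' dvd [:varX2:] - \<Theta> (ev' [:varX2:])" "g' dvd [:varY2:] - \<Theta> (ev' [:varY2:])" "g' dvd varZ3 - \<Theta> (ev' varZ3)"
      using base[of "[:varX2:]"] base[of "[:varY2:]"] base[of varZ3] by (simp_all add: ev'_def lift2_eval3)
    fix F G assume FG: "g' dvd F - \<Theta> (ev' F)" "g' dvd G - \<Theta> (ev' G)"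
    have "F + G - \<Theta> (ev' (F + G)) = (F - \<Theta> (ev' F)) + (G - \<Theta> (ev' G))"
      by (simp add: rhom_add[OF rev'] rhom_add[OF r\<Theta>])
    then show "g' dvd F + G - \<Theta> (ev' (F + G))" using dvd_add[OF FG] by (simp only:)
    have "F * G - \<Theta> (ev' (F * G)) = (F - \<Theta> (ev' F)) * G + \<Theta> (ev' F) * (G - \<Theta> (ev' G))"
      by (simp add: rhom_mult[OF rev'] rhom_mult[OF r\<Theta>] algebra_simps)
    then show "g' dvd F * G - \<Theta> (ev' (F * G))"
      using dvd_add[OF dvd_mult2[OF FG(1)] dvd_mult[OF FG(2)]] by (simp only:)
  qed
  have g0: "ev' g' = 0"
    unfolding lg[symmetric] ev'_def lift2_eval3[symmetric]
    by (simp only: ker[THEN iffD2, OF dvd_refl] rhom_0[OF rhom_lift2])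
  show ?thesis
  proof
    show "lift2 f b \<noteq> 0" using b_nz lift2_inj[of b 0] by (simp add: rhom_0[OF rhom_lift2])
    show "surj (eval3 const2 (lift2 f x) (lift2 f y) (lift2 f z))"
      using ev\<Theta> unfolding ev'_def by (metis surjI)
    show "eval3 const2 (lift2 f x) (lift2 f y) (lift2 f z) F = 0 \<longleftrightarrow> [:lift2 f b:] * varZ3 ^ n - [:lift2 f a:] dvd F" for F
      unfolding ev'_def[symmetric] g'_def[symmetric]
    proof
      show "g' dvd F" if "ev' F = 0" using all[of F] that by (simp add: rhom_0[OF r\<Theta>])
      show "ev' F = 0" if "g' dvd F"
        using that g0 by (auto simp: rhom_mult[OF rev'] elim!: dvdE)
    qed
  qed (rule n_ge)
qed

lemma autp_unlift:
  assumes "autp (range f) \<tau> \<tau>'"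
  obtains \<sigma> \<sigma>' where "autp UNIV \<sigma> \<sigma>'" "\<And>F. lift2 f (\<sigma> F) = \<tau> (lift2 f F)"
proof -
  have "\<exists>\<sigma>. endo \<sigma> \<and> (\<forall>F. lift2 f (\<sigma> F) = \<tau> (lift2 f F))" if aut: "autp (range f) \<tau> \<tau>'" for \<tau> \<tau>'
  proof -
    obtain x where x: "\<tau> (lift2 f varX2) = lift2 f x" by (rule pset_range_lift[OF autpD(5)[OF aut lift_mem(1)]])
    obtain y where y: "\<tau> (lift2 f varY2) = lift2 f y" by (rule pset_range_lift[OF autpD(5)[OF aut lift_mem(1)]])
    have "lift2 f (eval2 const2 x y F) = \<tau> (lift2 f F)" for F
      unfolding lift2_eval2 x[symmetric] y[symmetric] lift2_simps by (rule endo_eval2[OF autpD(1)[OF aut], symmetric])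
    then show ?thesis using endo_of_eval2[of x y] by blast
  qed
  from this[OF assms] this[OF autp_sym[OF assms]] obtain \<sigma> \<sigma>' where
    s: "endo \<sigma>" "\<And>F. lift2 f (\<sigma> F) = \<tau> (lift2 f F)" "endo \<sigma>'" "\<And>F. lift2 f (\<sigma>' F) = \<tau>' (lift2 f F)" by blast
  have "lift2 f (\<sigma> (\<sigma>' F)) = lift2 f F" "lift2 f (\<sigma>' (\<sigma> F)) = lift2 f F" for F
    by (simp_all add: s autpD[OF assms])
  then have "autp UNIV \<sigma> \<sigma>'" unfolding autp_def lift2_inj using s by (simp add: pset_def)
  then show ?thesis using s(2) by (rule that)
qed

end

text \<open>Linearity over the image of \<open>f\<close>. Products are respected only if one factor
  comes from below, which suffices since \<open>x, y, z\<close> are defined there.\<close>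

definition semilin :: "('c::comm_ring_1 \<Rightarrow> 'd::comm_ring_1) \<Rightarrow> ('d \<Rightarrow> 'c) \<Rightarrow> bool" where
  "semilin f \<pi> \<longleftrightarrow> (\<forall>u v. \<pi> (u + v) = \<pi> u + \<pi> v) \<and> (\<forall>c u. \<pi> (f c * u) = c * \<pi> u)"

lemma semilin_add: "semilin f \<pi> \<Longrightarrow> \<pi> (u + v) = \<pi> u + \<pi> v"
  and semilin_mult: "semilin f \<pi> \<Longrightarrow> \<pi> (f c * u) = c * \<pi> u"
  by (simp_all add: semilin_def)

lemma semilin_0: "semilin f \<pi> \<Longrightarrow> \<pi> 0 = 0"
  using semilin_add[of f \<pi> 0 0] by simp

lemma semilin_diff: "semilin f \<pi> \<Longrightarrow> \<pi> (u - v) = \<pi> u - \<pi> v"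
  using semilin_add[of f \<pi> "u - v" v] by (simp add: algebra_simps)

lemma semilin_sum: "semilin f \<pi> \<Longrightarrow> \<pi> (sum u A) = (\<Sum>i\<in>A. \<pi> (u i))"
  by (induction A rule: infinite_finite_induct) (simp_all add: semilin_0 semilin_add)

lemma semilin_map_poly:
  assumes \<pi>: "semilin f \<pi>" and f: "f 0 = 0" shows "semilin (map_poly f) (map_poly \<pi>)"
  unfolding semilin_def
proof (intro conjI allI)
  note 0 = semilin_0[OF \<pi>]
  show "map_poly \<pi> (p + q) = map_poly \<pi> p + map_poly \<pi> q" for p q
    by (rule poly_eqI) (simp add: coeff_map_poly 0 semilin_add[OF \<pi>])
  show "map_poly \<pi> (map_poly f p * q) = p * map_poly \<pi> q" for p q
    by (rule poly_eqI) (simp add: coeff_map_poly 0 f coeff_mult semilin_sum[OF \<pi>] semilin_mult[OF \<pi>])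
qed

text \<open>The value \<open>1\<close> on the independent set \<open>{1}\<close> extends linearly
  over the smaller field; the result is a retraction of \<open>f\<close>.\<close>

lemma semilin_exists:
  fixes f :: "'c::field \<Rightarrow> 'd::field"
  assumes f: "rhom f" obtains \<pi> where "semilin f \<pi>" "\<pi> 1 = 1"
proof -
  interpret V: vector_space "\<lambda>c. (*) (f c)"
    by unfold_locales (simp_all add: algebra_simps rhom_simps[OF f])
  interpret W: vector_space "(*) :: 'c \<Rightarrow> 'c \<Rightarrow> 'c"
    by unfold_locales (simp_all add: algebra_simps)
  interpret VW: vector_space_pair "\<lambda>c. (*) (f c)" "(*) :: 'c \<Rightarrow> 'c \<Rightarrow> 'c" ..
  have "V.independent {1}" by (simp add: V.dependent_single)
  from VW.linear_independent_extend[OF this, of "\<lambda>_. 1"]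
  obtain \<pi> where \<pi>: "Vector_Spaces.linear (\<lambda>c. (*) (f c)) (*) \<pi>" "\<pi> 1 = 1" by auto
  interpret L: Vector_Spaces.linear "\<lambda>c. (*) (f c)" "(*) :: 'c \<Rightarrow> 'c \<Rightarrow> 'c" \<pi> by (rule \<pi>)
  have "semilin f \<pi>" unfolding semilin_def using L.add L.scale by blast
  then show ?thesis using \<pi>(2) by (rule that)
qed

lemma pe_varX: "pe q varX2 = [:q:]"
  by (rule rhom_ext1[OF rhom_pe rhom_const_poly]) (simp_all add: pe_X varX2_def const2_def)

lemma pe_diff: "pe (p - q) w = pe p w - pe q w"
  by (rule rhom_diff[OF rhom_pe])

lemma pe_shift: "pe h (v - const2 c) = pe (pcompose h [:- c, 1:]) v"
  by (rule rhom_ext1[OF rhom_pe rhom_comp[OF rhom_pe rhom_pcompose]])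
    (simp_all add: pe_X pcompose_pCons pe_linear)

lemma lift2_pe:
  fixes f :: "'c::field \<Rightarrow> 'd::field"
  assumes f: "rhom f" shows "lift2 f (pe q w) = pe (map_poly f q) (lift2 f w)"
  by (rule rhom_ext1[OF rhom_comp[OF rhom_lift2[OF f] rhom_pe] rhom_comp[OF rhom_pe rhom_map_poly[OF f]]])
    (simp_all add: f pe_X map_poly_pCons rhom_0[OF f] rhom_1[OF f])

text \<open>Lifted elements act as scalars for \<open>pp\<close>, so evaluation at lifted points
  commutes with it; it is enough to check monomials with a coefficient from the large field.\<close>

lemma semilin_eval:
  fixes f :: "'c::field \<Rightarrow> 'd::field"
  assumes f: "rhom f" and \<pi>: "semilin f \<pi>"
  defines "pp \<equiv> map_poly (map_poly \<pi>)"
  shows "semilin (lift2 f) pp"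
    and "pp (const2 c) = const2 (\<pi> c)"
    and "pp (pe q (lift2 f w)) = pe (map_poly \<pi> q) w"
    and "pp (eval2 const2 (lift2 f x) (lift2 f y) F) = eval2 const2 x y (pp F)"
proof -
  have 0: "\<pi> 0 = 0" by (rule semilin_0[OF \<pi>])
  show L: "semilin (lift2 f) pp"
    unfolding lift2_def pp_def by (intro semilin_map_poly \<pi>) (simp_all add: rhom_0[OF f])
  show c: "pp (const2 c) = const2 (\<pi> c)" for c
    by (simp add: pp_def const2_def map_poly_pCons 0)
  have cm: "pp (const2 c * lift2 f v) = const2 (\<pi> c) * v" for c v
    using semilin_mult[OF L, of v "const2 c"] by (simp add: c mult.commute)
  have "degree (map_poly \<pi> q) \<le> degree q" by (rule map_poly_degree_leq)
  from poly_map_poly_sum[of const2, OF _ this]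
  have "pe (map_poly \<pi> q) w = (\<Sum>i\<le>degree q. const2 (\<pi> (coeff q i)) * w ^ i)"
    unfolding pe_def by (simp add: coeff_map_poly 0)
  moreover have "pe q (lift2 f w) = (\<Sum>i\<le>degree q. const2 (coeff q i) * lift2 f (w ^ i))"
    unfolding pe_def rhom_power[OF rhom_lift2[OF f]] by (rule poly_map_poly_sum) simp_all
  ultimately show "pp (pe q (lift2 f w)) = pe (map_poly \<pi> q) w"
    by (simp add: semilin_sum[OF L] cm)
  have add: "pp (u + v) = pp u + pp v" for u v by (rule semilin_add[OF L])
  have mono: "pp (eval2 const2 (lift2 f x) (lift2 f y) (varY2 ^ j * (varX2 ^ i * const2 c))) =
      eval2 const2 x y (pp (varY2 ^ j * (varX2 ^ i * const2 c)))" for i j c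
  proof -
    have "varY2 ^ j * (varX2 ^ i * const2 c) = const2 c * lift2 f (varY2 ^ j * varX2 ^ i)"
      by (simp add: rhom_mult[OF rhom_lift2[OF f]] rhom_power[OF rhom_lift2[OF f]] f mult_ac)
    then have 1: "pp (varY2 ^ j * (varX2 ^ i * const2 c)) = const2 (\<pi> c) * (varY2 ^ j * varX2 ^ i)"
      by (simp only: cm)
    have "eval2 const2 (lift2 f x) (lift2 f y) (varY2 ^ j * (varX2 ^ i * const2 c)) = const2 c * lift2 f (y ^ j * x ^ i)"
      by (simp add: rhom_simps[OF rhom_eval2[OF rhom_const2]] eval2_varX eval2_varY eval2_const rhom_const2
          rhom_mult[OF rhom_lift2[OF f]] rhom_power[OF rhom_lift2[OF f]] mult_ac)
    then have 2: "pp (eval2 const2 (lift2 f x) (lift2 f y) (varY2 ^ j * (varX2 ^ i * const2 c))) = const2 (\<pi> c) * (y ^ j * x ^ i)"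
      by (simp only: cm)
    show ?thesis unfolding 1 2
      by (simp add: rhom_simps[OF rhom_eval2[OF rhom_const2]] eval2_varX eval2_varY eval2_const rhom_const2)
  qed
  have "F = (\<Sum>j\<le>degree F. \<Sum>i\<le>degree (coeff F j). varY2 ^ j * (varX2 ^ i * const2 (coeff (coeff F j) i)))" for F :: "'d poly poly"
    using eval2_sum[OF rhom_const2, of varX2 varY2 F] by (simp add: eval2_id mult_ac)
  from arg_cong[OF this[of F], of "\<lambda>F. pp (eval2 const2 (lift2 f x) (lift2 f y) F)"] arg_cong[OF this[of F], of "\<lambda>F. eval2 const2 x y (pp F)"]
  show "pp (eval2 const2 (lift2 f x) (lift2 f y) F) = eval2 const2 x y (pp F)"
    by (simp only: rhom_sum[OF rhom_eval2[OF rhom_const2]] semilin_sum[OF L] mono)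
qed

context plane
begin

lemma plane_autp:
  assumes "autp S \<tau> \<tau>'" shows "plane a b n (\<tau> x) (\<tau> y) (\<tau> z)"
proof
  note e = autpD(1)[OF assms]
  have ev: "eval3 const2 (\<tau> x) (\<tau> y) (\<tau> z) F = \<tau> (ev F)" for F
    using eval3_comp[OF endo_rhom[OF e] rhom_const2, of x y z F] by (simp add: endo_const[OF e])
  show "surj (eval3 const2 (\<tau> x) (\<tau> y) (\<tau> z))"
    unfolding surj_def ev
  proof
    fix w
    obtain F where "\<tau>' w = ev F" using surjD[OF surj] by blast
    then have "w = \<tau> (ev F)" using autpD(3)[OF assms, of w] by simp
    then show "\<exists>F. w = \<tau> (ev F)" by (rule exI)
  qed
  show "eval3 const2 (\<tau> x) (\<tau> y) (\<tau> z) F = 0 \<longleftrightarrow> g dvd F" for F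
    unfolding ev ker[symmetric] using autp_nonzero[OF assms, of "ev F"] rhom_0[OF endo_rhom[OF e]] by auto
qed (rule b_nz n_ge)+

end

lemma (in closed_plane) closed_plane_autp:
  assumes "autp S \<tau> \<tau>'" shows "closed_plane a b n (\<tau> x) (\<tau> y) (\<tau> z)"
  by (intro closed_plane.intro closed_plane_axioms.intro plane_autp[OF assms] n_nz)

text \<open>Transport by \<open>\<tau>'\<close> to coordinates with \<open>z = X\<close>; on the way
  back \<open>r(X)\<close> becomes \<open>pe r z\<close>.\<close>

lemma (in closed_plane) coordinate_structure:
  assumes "autp S \<tau> \<tau>'" "\<tau> varX2 = z"
  obtains r h f where "\<tau> varY2 - pe r z = res f" "res b = pe h (\<tau> varY2 - pe r z)"
proof -
  interpret T: closed_plane a b n "\<tau>' x" "\<tau>' y" "\<tau>' z" by (rule closed_plane_autp[OF autp_sym[OF assms(1)]])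
  note e = autpD(1,2)[OF assms(1)]
  have res: "\<tau> (T.res F) = res F" for F by (simp add: endo_eval2'[OF e(1)] autpD[OF assms(1)])
  have "\<tau>' z = varX2" unfolding assms(2)[symmetric] by (rule autpD(4)[OF assms(1)])
  from T.plane_structure[OF this] obtain r h f where
    1: "varY2 - [:r:] = T.res f" "T.res b = pe h (varY2 - [:r:])" by blast
  have "\<tau> [:r:] = pe r z" unfolding pe_varX[symmetric] using pe_hom[OF endo_rhom[OF e(1)], of r varX2] by (simp add: endo_const[OF e(1)] assms(2))
  then have 2: "\<tau> (varY2 - [:r:]) = \<tau> varY2 - pe r z" by (simp add: rhom_diff[OF endo_rhom[OF e(1)]])
  have "\<tau> varY2 - pe r z = res f" using arg_cong[OF 1(1), of \<tau>] by (simp add: 2 res)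
  moreover have "res b = pe h (\<tau> varY2 - pe r z)"
    using arg_cong[OF 1(2), of \<tau>] pe_hom[OF endo_rhom[OF e(1)], of h "varY2 - [:r:]"] by (simp add: 2 res endo_const[OF e(1)])
  ultimately show ?thesis by (rule that)
qed

context plane
begin

text \<open>The retraction makes \<open>r\<close> and \<open>E\<close> rational, but changing
  \<open>r\<close> by \<open>e\<close> disturbs \<open>h\<close>. Now \<open>e(z)\<close> lies in
  \<open>K[x, y]\<close>: if \<open>e\<close> is nonconstant, \<open>b\<close> is constant and any
  constant \<open>h\<close> works; if \<open>e\<close> is constant, \<open>h\<close> is merely
  shifted before the retraction is applied to it.\<close>

lemma structure_descent:
  fixes f :: "'c \<Rightarrow> 'd::field"
  assumes f: "rhom f" and pl: "plane (lift2 f a) (lift2 f b) n (lift2 f x) (lift2 f y) (lift2 f z)"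
    and E: "lift2 f U - pe r (lift2 f z) = eval2 const2 (lift2 f x) (lift2 f y) E"
    and h: "eval2 const2 (lift2 f x) (lift2 f y) (lift2 f b) = pe h (lift2 f U - pe r (lift2 f z))"
  obtains r0 h0 E0 where "U - pe r0 z = res E0" "res b = pe h0 (U - pe r0 z)"
proof -
  interpret P: plane "lift2 f a" "lift2 f b" n "lift2 f x" "lift2 f y" "lift2 f z" by (rule pl)
  obtain \<pi> where \<pi>: "semilin f \<pi>" "\<pi> 1 = 1" by (rule semilin_exists[OF f])
  define pp where "pp = map_poly (map_poly \<pi>)"
  note pp = semilin_eval[OF f \<pi>(1), folded pp_def]
  have ppL: "pp (lift2 f F) = F" for F
    using semilin_mult[OF pp(1), of F 1] pp(2)[of 1] by (simp add: \<pi>(2))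
  define r0 where "r0 = map_poly \<pi> r"
  define u where "u = U - pe r0 z"
  have u: "u = res (pp E)"
    using arg_cong[OF E, of pp] by (simp add: semilin_diff[OF pp(1)] pp(3,4) ppL u_def r0_def)
  define e where "e = r - map_poly f r0"
  have w: "lift2 f U - pe r (lift2 f z) = lift2 f u - pe e (lift2 f z)"
    by (simp add: u_def e_def pe_diff lift2_pe[OF f] rhom_diff[OF rhom_lift2[OF f]])
  show ?thesis
  proof (cases "degree e > 0")
    case True
    have "pe e (lift2 f z) = lift2 f u - P.res E" using E w by (simp add: algebra_simps)
    also have "\<dots> = P.res (lift2 f (pp E) - E)" unfolding u lift2_eval2[OF f] by (simp add: P.res_simps)
    finally obtain b0 where b0: "lift2 f b = const2 b0" using P.res_poly_z[OF _ True] unfolding pe_def by blast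
    have "b = const2 (\<pi> b0)" using arg_cong[OF b0, of pp] by (simp add: ppL pp(2))
    then have "res b = pe [:\<pi> b0:] (U - pe r0 z)" by (simp add: eval2_const)
    then show ?thesis using u unfolding u_def by (rule that[rotated])
  next
    case False
    then obtain c where c: "e = [:c:]" by (metis degree_eq_zeroE not_gr_zero)
    have "lift2 f (res b) = pe (pcompose h [:- c, 1:]) (lift2 f u)"
      using h unfolding w c lift2_eval2[OF f] by (simp add: pe_shift)
    from arg_cong[OF this, of pp] have "res b = pe (map_poly \<pi> (pcompose h [:- c, 1:])) u" by (simp add: ppL pp(3))
    then show ?thesis using u unfolding u_def by (rule that[rotated])
  qed
qed

end

instance alg_closure :: (field) field_gcd
  by standard

lemma sfield_range:
  fixes f :: "'c::field \<Rightarrow> 'd::field"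
  assumes f: "rhom f" shows "sfield (range f)"
proof -
  have "inverse (f c) = f (inverse c)" for c
  proof (cases "c = 0")
    case False
    then have "f c * f (inverse c) = 1" by (simp add: rhom_mult[OF f, symmetric] rhom_1[OF f])
    then show ?thesis by (rule inverse_unique)
  qed (simp add: rhom_0[OF f])
  then show ?thesis unfolding sfield_def using sring_range[OF f] by auto
qed

text \<open>Otherwise the sum of all roots of unity would be \<open>1\<close> and not
  \<open>0\<close>.\<close>

lemma nontrivial_root_of_unity:
  assumes n: "n \<ge> 2" "of_nat n \<noteq> (0 :: 'c::alg_closed_field)"
  obtains \<zeta> :: "'c::alg_closed_field" where "\<zeta> ^ n = 1" "\<zeta> \<noteq> 1"
proof (rule ccontr)
  assume "\<not> thesis"
  then have "{\<zeta> :: 'c. \<zeta> ^ n = 1} = {1}" using that by auto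
  then show False using sum_roots_of_unity_power(2)[OF _ n(2), of 1] n(1) by simp
qed

context plane
begin

lemma z_coordinate:
  assumes nz: "of_nat n \<noteq> (0 :: 'c)"
  obtains \<sigma> \<sigma>' r h E where "autp UNIV \<sigma> \<sigma>'" "\<sigma> varX2 = z"
    "\<sigma> varY2 - pe r z = res E" "res b = pe h (\<sigma> varY2 - pe r z)"
proof -
  define f :: "'c \<Rightarrow> 'c alg_closure" where "f = to_ac"
  have f: "rhom f" unfolding f_def by (rule rhom_to_ac)
  have nz': "of_nat n \<noteq> (0 :: 'c alg_closure)" using nz rhom_inj[OF f, of "of_nat n"] by (simp add: rhom_of_nat[OF f])
  note pl = plane_lift[OF f plane_axioms]
  interpret P: closed_plane "lift2 f a" "lift2 f b" n "lift2 f x" "lift2 f y" "lift2 f z"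
    by (intro closed_plane.intro closed_plane_axioms.intro pl nz')
  obtain \<zeta> :: "'c alg_closure" where \<zeta>: "\<zeta> ^ n = 1" "\<zeta> \<noteq> 1" by (rule nontrivial_root_of_unity[OF n_ge nz'])
  define S where "S = adjoin \<zeta>"
  have S: "sfield S" unfolding S_def by (rule sfield_adjoin[OF n_pos \<zeta>(1)])
  have kS: "range f \<subseteq> S" unfolding S_def f_def by (rule range_to_ac_adjoin[OF n_pos \<zeta>(1)])
  have \<zeta>S: "\<zeta> \<in> S" unfolding S_def by (rule zeta_adjoin[OF n_pos \<zeta>(1)])
  have rc: "radically_closed (range f) S" unfolding S_def f_def by (rule radically_closed_adjoin[OF n_pos \<zeta>(1)])
  have L2: "lift2 f F \<in> pset (pset S)" and L3: "lift3 f G \<in> pset (pset (pset S))" for F G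
    using lift_mem[OF f] pset_mono[OF pset_mono[OF kS]] pset_mono[OF pset_mono[OF pset_mono[OF kS]]] by blast+
  obtain P Q where P: "ev P = varX2" and Q: "ev Q = varY2" using surj by (metis surjD)
  have PQ: "P.ev (lift3 f P) = varX2" "P.ev (lift3 f Q) = varY2"
    unfolding lift2_eval3[OF f, symmetric] P Q by (simp_all add: f)
  have rot: "autp S (P.rot \<zeta>) (P.rot (\<zeta> ^ (n - 1)))"
    by (rule P.autp_rot[OF sfield_sring[OF S] \<zeta>S \<zeta>(1) L2 L2 L2 L3 L3 PQ])
  have N: "(P.rot \<zeta> ^^ n) F = F" for F by (simp add: P.rot_funpow[OF \<zeta>(1)] \<zeta>(1) P.rot_1)
  have "\<exists>\<theta> \<theta>'. autp S \<theta> \<theta>' \<and> \<theta> varX2 = lift2 f z"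
    by (rule eigenvector_is_coordinate[OF S rot n_pos N P.rot_z[OF \<zeta>(1)] \<zeta>(2) P.z_nz L2 P.rot_cong_z[OF \<zeta>(1)]])
  then obtain \<theta> \<theta>' where \<theta>: "autp S \<theta> \<theta>'" "\<theta> varX2 = lift2 f z" by blast
  obtain d where d: "lift2 f z \<in> Fil2 1 1 d" using top_weight[OF P.z_nz] by blast
  then have D: "lift2 f z \<in> Fil2 1 1 (int (nat d))" unfolding Fil2_def by fastforce
  have "\<exists>\<tau> \<tau>'. autp (range f) \<tau> \<tau>' \<and> \<tau> varX2 = \<theta> varX2"
    by (rule variable_descent[OF S sfield_range[OF f] kS rc \<theta>(1), where D = "nat d"]) (simp_all only: \<theta>(2) lift_mem[OF f] D)
  then obtain \<tau> \<tau>' where \<tau>: "autp (range f) \<tau> \<tau>'" "\<tau> varX2 = lift2 f z" unfolding \<theta>(2) by blast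
  obtain \<sigma> \<sigma>' where \<sigma>: "autp UNIV \<sigma> \<sigma>'" "\<And>F. lift2 f (\<sigma> F) = \<tau> (lift2 f F)" by (rule autp_unlift[OF f \<tau>(1)]) blast
  have sz: "\<sigma> varX2 = z" using \<sigma>(2)[of varX2] \<tau>(2) by (simp add: f lift2_inj)
  have sY: "\<tau> varY2 = lift2 f (\<sigma> varY2)" using \<sigma>(2)[of varY2] by (simp add: f)
  obtain r h E where "\<tau> varY2 - pe r (lift2 f z) = P.res E" "P.res (lift2 f b) = pe h (\<tau> varY2 - pe r (lift2 f z))"
    by (rule P.coordinate_structure[OF \<tau>]) blast
  then obtain r0 h0 E0 where "\<sigma> varY2 - pe r0 z = res E0" "res b = pe h0 (\<sigma> varY2 - pe r0 z)"
    unfolding sY by (rule structure_descent[OF f pl]) blast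
  with \<sigma>(1) sz show ?thesis by (rule that)
qed

lemma generators:
  assumes bij: "bij (eval2 const2 (res u) z)" and h: "b = pe h u"
  shows "\<exists>H. f = eval2 const2 u a H"
    and "\<exists>H. F = eval3 const3 [:u:] g varZ3 H"
proof -
  define e where "e = eval2 const2 (res u) z"
  have re: "rhom e" unfolding e_def by (rule rhom_eval2[OF rhom_const2])
  have e_inj: "e F = e G \<longleftrightarrow> F = G" for F G using bij unfolding e_def bij_def by (auto dest: injD)
  have e_pe: "e (pe q varX2) = res (pe q u)" for q
    using pe_hom[OF re, of q varX2] pe_hom[OF rhom_res, of q u]
    by (simp add: e_def eval2_const eval2_varX rhom_const2)
  have xy: "\<exists>H. f = eval2 const2 u a H" if "res f = e F" for f F
    using that
  proof (induction "degree F" arbitrary: f F rule: less_induct)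
    case less
    obtain q F1 where F: "F = pCons q F1" by (cases F)
    have "F = pe q varX2 + varY2 * F1" unfolding F pe_varX using pCons_decomp[of q F1] by (simp add: varY2_def)
    then have "res f = res (pe q u) + z * e F1"
      using less.prems by (simp add: rhom_add[OF re] rhom_mult[OF re] e_pe) (simp add: e_def eval2_varY rhom_const2)
    then have 1: "res (f - pe q u) = z * e F1" by (simp add: res_simps)
    then obtain f1 where f1: "f - pe q u = a * f1" by (rule res_dvd_z)
    have "\<exists>H. f1 = eval2 const2 u a H"
    proof (cases "F1 = 0")
      case True
      then have "res (a * f1) = 0" using 1 by (simp add: f1 rhom_0[OF re])
      then have "f1 = 0 \<or> a = 0" by (auto simp: res_inj)
      then have "f1 = 0 \<or> res b * z ^ n = 0" by (auto simp: rel res_simps)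
      then have "f1 = 0" using b_nz z_nz res_inj by simp
      then show ?thesis by (intro exI[of _ 0]) (simp add: rhom_0[OF rhom_eval2[OF rhom_const2]])
    next
      case False
      obtain F2 where F2: "res f1 = e F2" using bij unfolding e_def bij_def by (metis surjD)
      have "z * e F1 = res b * z ^ n * res f1" using 1 by (simp add: f1 res_simps rel)
      also have "z ^ n = z * z ^ (n - 1)" using n_pos by (metis power_eq_if less_irrefl)
      finally have "z * e F1 = z * (res b * z ^ (n - 1) * e F2)" by (simp add: F2 mult_ac)
      \<comment> \<open>After cancelling \<open>z\<close>, \<open>F2\<close> divides
        \<open>F1\<close>, so its degree in the variable standing for \<open>z\<close> is below that
        of \<open>F = q + Y F1\<close>.\<close>
      then have "e F1 = e (pe h varX2 * varY2 ^ (n - 1) * F2)"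
        using z_nz e_pe[of h] h by (simp add: rhom_mult[OF re] rhom_power[OF re]) (simp add: e_def eval2_varY rhom_const2)
      then have "F2 dvd F1" unfolding e_inj by simp
      then have "degree F2 < degree F" using dvd_imp_degree_le[of F2 F1] False by (simp add: F)
      then show ?thesis using F2 by (rule less.hyps)
    qed
    then obtain H where H: "f1 = eval2 const2 u a H" by blast
    have "f = pe q u + a * f1" using f1 by (simp add: algebra_simps)
    also have "pe q u = eval2 const2 u a (pe q varX2)"
      using pe_hom[OF rhom_eval2[OF rhom_const2], of u a q varX2] by (simp add: eval2_const eval2_varX rhom_const2)
    also have "\<dots> + a * f1 = eval2 const2 u a (pe q varX2 + varY2 * H)"
      by (simp add: rhom_simps[OF rhom_eval2[OF rhom_const2]] H eval2_varY rhom_const2)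
    finally show ?case by (rule exI)
  qed
  have all: "\<exists>H. f = eval2 const2 u a H" for f
  proof -
    obtain F where "res f = e F" using bij unfolding e_def bij_def by (metis surjD)
    then show ?thesis by (rule xy)
  qed
  then show "\<exists>H. f = eval2 const2 u a H" by blast
  define e3 where "e3 = eval3 const3 [:u:] g varZ3"
  have r3: "rhom e3" unfolding e3_def by (rule rhom_eval3[OF rhom_const3])
  note r3s = rhom_simps[OF r3]
  have e3_u: "e3 [:varX2:] = [:u:]" and e3_g: "e3 [:varY2:] = g" and e3_c: "e3 [:const2 c:] = [:const2 c:]"
    and e3_Z: "e3 varZ3 = varZ3" for c
    by (simp_all add: e3_def eval3_const eval3_varZ eval2_const eval2_varX eval2_varY rhom_const3)
  have "e3 [:pe h varX2:] = [:pe h u:]"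
    by (rule rhom_ext1[of "\<lambda>h. e3 [:pe h varX2:]" "\<lambda>h. [:pe h u:]"])
      (simp_all add: pe_X e3_u e3_c rhom_comp[OF r3 rhom_comp[OF rhom_const_poly rhom_pe]] rhom_comp[OF rhom_const_poly rhom_pe])
  then have "e3 ([:pe h varX2:] * varZ3 ^ n - [:varY2:]) = [:b:] * varZ3 ^ n - g"
    by (simp only: r3s e3_Z e3_g h)
  then obtain A where A: "e3 A = [:a:]" by (simp only: diff_diff_eq2 add_diff_cancel_left')
  have c3: "\<exists>H. [:f:] = e3 H" for f
  proof -
    obtain H where "f = eval2 const2 u a H" using all by blast
    then have "[:f:] = eval2 const3 [:u:] [:a:] H" using eval2_comp[OF rhom_const_poly rhom_const2, of u a H] by simp
    also have "\<dots> = e3 (eval2 const3 [:varX2:] A H)"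
      unfolding eval2_comp[OF r3 rhom_const3] by (simp only: e3_u e3_c A)
    finally show ?thesis by (rule exI)
  qed
  have "\<exists>H. F = e3 H" for F
  proof (rule poly3_alg_induct[of "\<lambda>F. \<exists>H. F = e3 H"])
    show "\<exists>H. varZ3 = e3 H" using e3_Z by metis
    show "\<exists>H. p + q = e3 H" if "\<exists>H. p = e3 H" "\<exists>H. q = e3 H" for p q using that rhom_add[OF r3] by metis
    show "\<exists>H. p * q = e3 H" if "\<exists>H. p = e3 H" "\<exists>H. q = e3 H" for p q using that rhom_mult[OF r3] by metis
  qed (rule c3)+
  then show "\<exists>H. F = eval3 const3 [:u:] g varZ3 H" unfolding e3_def by blast
qed

lemma plane_coordinates:
  assumes nz: "of_nat n \<noteq> (0 :: 'c)"
  obtains u h where "bij (eval2 const2 (res u) z)" "b = pe h u"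
proof -
  obtain \<sigma> \<sigma>' r h u where \<sigma>: "autp UNIV \<sigma> \<sigma>'" "\<sigma> varX2 = z"
    and u: "\<sigma> varY2 - pe r z = res u" and b: "res b = pe h (\<sigma> varY2 - pe r z)"
    by (rule z_coordinate[OF nz])
  have U: "F \<in> pset (pset UNIV)" for F :: "'c poly poly" by (simp add: pset_def)
  have pe2: "eval2 const2 v w (pe q t) = pe q (eval2 const2 v w t)" for v w t :: "'c poly poly" and q
    by (rule pe_hom) (simp_all add: rhom_eval2 rhom_const2 eval2_const)
  \<comment> \<open>This shear replaces \<open>\<sigma> Y\<close> by
    \<open>\<sigma> Y - r(z)\<close>, which lies in \<open>k[x, y]\<close>, and puts the coordinates
    into the order \<open>(u, z)\<close>.\<close>
  define v where "v = varY2 - pe r varX2"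
  have sh: "autp UNIV (eval2 const2 v varX2) (eval2 const2 varY2 (varX2 + pe r varY2))"
  proof (rule autp_eval2I[OF _ U U U U])
    show "sring (UNIV :: 'c set)" by (simp add: sring_def)
  qed (simp_all add: rhom_simps[OF rhom_eval2[OF rhom_const2]] eval2_varX eval2_varY rhom_const2 pe2, simp_all add: v_def
    rhom_simps[OF rhom_eval2[OF rhom_const2]] eval2_varX eval2_varY rhom_const2 pe2)
  note au = autp_comp[OF \<sigma>(1) sh]
  note e = autpD(1)[OF \<sigma>(1)]
  have "\<sigma> v = res u"
    unfolding v_def rhom_diff[OF endo_rhom[OF e]] pe_hom[OF endo_rhom[OF e] endo_const[OF e]] \<sigma>(2) by (rule u)
  then have "\<sigma> (eval2 const2 v varX2 F) = eval2 const2 (res u) z F" for F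
    unfolding endo_eval2'[OF e] \<sigma>(2) by simp
  then have "bij (eval2 const2 (res u) z)"
    using autpD(3,4)[OF au] by (intro o_bij[where g = "\<lambda>F. eval2 const2 varY2 (varX2 + pe r varY2) (\<sigma>' F)"]) (auto simp: fun_eq_iff)
  moreover have "res (b - pe h u) = 0"
    using b pe_hom[OF rhom_res, of h u] by (simp add: res_simps u eval2_const)
  then have "b = pe h u" unfolding res_inj by simp
  ultimately show ?thesis by (rule that)
qed

end

theorem theorem4p5:
  fixes a b :: "'a::field poly poly" and n :: nat and g :: "'a poly poly poly"
  assumes b_nz: "b \<noteq> 0"
    and n_ge: "n \<ge> 2"
    and n_char: "\<not> CHAR('a) dvd n"
    and g_def: "g = [:b:] * varZ3 ^ n - [:a:]"
    and iso: "\<exists>s1 s2 s3 :: 'a poly poly.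
               surj (eval3 const2 s1 s2 s3) \<and>
               (\<forall>F. eval3 const2 s1 s2 s3 F = 0 \<longleftrightarrow> g dvd F)"
  shows "\<exists>s1 s2 s3 :: 'a poly poly.
           surj (eval3 const2 s1 s2 s3) \<and>
           (\<forall>F. eval3 const2 s1 s2 s3 F = 0 \<longleftrightarrow> g dvd F) \<and>
           (\<exists>u :: 'a poly poly.
              bij (eval2 const2 (eval3 const2 s1 s2 s3 [:u:]) (eval3 const2 s1 s2 s3 varZ3)) \<and>
              (\<exists>h :: 'a poly. b = poly (map_poly const2 h) u) \<and>
              (\<forall>f :: 'a poly poly. \<exists>H :: 'a poly poly. f = eval2 const2 u a H) \<and>
              (\<forall>F :: 'a poly poly poly. \<exists>H :: 'a poly poly poly.
                  F = eval3 (\<lambda>c. [:const2 c:]) [:u:] g varZ3 H))"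
proof -
  obtain x y z :: "'a poly poly" where s: "surj (eval3 const2 x y z)"
    and k: "\<And>F. eval3 const2 x y z F = 0 \<longleftrightarrow> g dvd F" using iso by blast
  interpret plane a b n x y z
    by unfold_locales (use b_nz n_ge s k g_def in simp_all)
  have nz: "of_nat n \<noteq> (0 :: 'a)" using n_char by (simp add: of_nat_eq_0_iff_char_dvd)
  obtain u h where bij: "bij (eval2 const2 (res u) z)" and h: "b = pe h u"
    by (rule plane_coordinates[OF nz])
  have "bij (eval2 const2 (ev [:u:]) (ev varZ3))" using bij by (simp add: ev_const ev_Z)
  moreover have "\<exists>h. b = poly (map_poly const2 h) u" using h unfolding pe_def by blast
  ultimately show ?thesis
    using s k generators[OF bij h] unfolding g_def by blast
qed

end
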